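(* There is an algorithm that, given undirected simple graphs $G_1,G_2$ each having a vertex cover of size at most $k$, computes the maximum number of vertices of a star forest that is a subgraph of both $G_1$ and $G_2$, in time $2^{2^{\mathcal{O}(k)}}\cdot n^{\mathcal{O}(1)}$, where $n$ is the number of vertices of the input graphs. In particular, Maximum Common Star Forest Subgraph is fixed-parameter tractable parameterized by $k$.
   Context: A vertex cover of $G$ is a set $S\subseteq V(G)$ such that $G-S$ has no edges. A non-trivial star is a tree on at least $2$ vertices of diameter at most $2$. A star forest is a vertex-disjoint union of non-trivial stars. A graph $H$ is a subgraph of $G$ if there is an injective map $\phi:V(H)\to V(G)$ with $\{\phi(u),\phi(v)\}\in E(G)$ for all $\{u,v\}\in E(H)$. Maximum Common Star Forest Subgraph: given $G_1,G_2$ and an integer $h\ge 0$, decide whether there is a star forest on at least $h$ vertices that is a subgraph of both $G_1$ and $G_2$. *)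

theory Defs
  imports Complex_Main "HOL-Library.Landau_Symbols" "HOL-Library.Log_Nat"
begin

section \<open>Graphs\<close>

datatype 'a graph = Graph (verts: "'a set") (edges: "'a set set")

definition simple_graph :: "'a graph \<Rightarrow> bool" where
  "simple_graph G \<longleftrightarrow> finite (verts G) \<and> (\<forall>e\<in>edges G. e \<subseteq> verts G \<and> card e = 2)"

definition delete_verts :: "'a graph \<Rightarrow> 'a set \<Rightarrow> 'a graph" where
  "delete_verts G S = Graph (verts G - S) {e \<in> edges G. e \<inter> S = {}}"

definition vertex_cover :: "'a graph \<Rightarrow> 'a set \<Rightarrow> bool" where
  "vertex_cover G S \<longleftrightarrow> S \<subseteq> verts G \<and> edges (delete_verts G S) = {}"

definition has_vertex_cover :: "'a graph \<Rightarrow> nat \<Rightarrow> bool" where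
  "has_vertex_cover G k \<longleftrightarrow> (\<exists>S. vertex_cover G S \<and> card S \<le> k)"

definition is_subgraph :: "'a graph \<Rightarrow> 'b graph \<Rightarrow> bool" where
  "is_subgraph H G \<longleftrightarrow>
     (\<exists>\<phi>. inj_on \<phi> (verts H) \<and> \<phi> ` verts H \<subseteq> verts G \<and>
          (\<forall>u v. {u, v} \<in> edges H \<longrightarrow> {\<phi> u, \<phi> v} \<in> edges G))"

definition walk :: "'a graph \<Rightarrow> 'a list \<Rightarrow> bool" where
  "walk G xs \<longleftrightarrow> xs \<noteq> [] \<and> set xs \<subseteq> verts G \<and> successively (\<lambda>u v. {u, v} \<in> edges G) xs"

definition graph_connected :: "'a graph \<Rightarrow> bool" where
  "graph_connected G \<longleftrightarrow> verts G \<noteq> {} \<and>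
     (\<forall>u\<in>verts G. \<forall>v\<in>verts G. \<exists>xs. walk G xs \<and> hd xs = u \<and> last xs = v)"

definition graph_cycle :: "'a graph \<Rightarrow> 'a list \<Rightarrow> bool" where
  "graph_cycle G xs \<longleftrightarrow> walk G xs \<and> distinct xs \<and> length xs \<ge> 3 \<and> {last xs, hd xs} \<in> edges G"

definition graph_tree :: "'a graph \<Rightarrow> bool" where
  "graph_tree G \<longleftrightarrow> simple_graph G \<and> graph_connected G \<and> (\<nexists>xs. graph_cycle G xs)"

definition graph_dist :: "'a graph \<Rightarrow> 'a \<Rightarrow> 'a \<Rightarrow> nat" where
  "graph_dist G u v = (LEAST d. \<exists>xs. walk G xs \<and> hd xs = u \<and> last xs = v \<and> length xs = Suc d)"

definition graph_diameter :: "'a graph \<Rightarrow> nat" where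
  "graph_diameter G = Max {graph_dist G u v | u v. u \<in> verts G \<and> v \<in> verts G}"

definition nontrivial_star :: "'a graph \<Rightarrow> bool" where
  "nontrivial_star G \<longleftrightarrow> graph_tree G \<and> card (verts G) \<ge> 2 \<and> graph_diameter G \<le> 2"

text \<open>The union of no stars, i.e. the graph without vertices, is a star forest; it is the only
  star forest contained in an edgeless graph.\<close>

definition star_forest :: "'a graph \<Rightarrow> bool" where
  "star_forest H \<longleftrightarrow>
     (\<exists>\<S>. finite \<S> \<and> (\<forall>S\<in>\<S>. nontrivial_star S) \<and>
          pairwise (\<lambda>S T. disjnt (verts S) (verts T)) \<S> \<and>
          H = Graph (\<Union>S\<in>\<S>. verts S) (\<Union>S\<in>\<S>. edges S))"

text \<open>Every finite graph has an isomorphic copy with vertices in \<^typ>\<open>nat\<close>, so it is no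
  restriction that common subgraphs have natural numbers as vertices.\<close>

definition common_star_forest :: "'a graph \<Rightarrow> 'b graph \<Rightarrow> nat graph \<Rightarrow> bool" where
  "common_star_forest G1 G2 H \<longleftrightarrow> star_forest H \<and> is_subgraph H G1 \<and> is_subgraph H G2"

definition max_common_star_forest :: "'a graph \<Rightarrow> 'b graph \<Rightarrow> nat" where
  "max_common_star_forest G1 G2 = Max {card (verts H) | H. common_star_forest G1 G2 H}"


section \<open>Algorithms and running time\<close>

text \<open>Algorithms are programs of a while language with scalar variables and unbounded arrays, all
  holding natural numbers.  Every elementary operation, including an array access, costs one unit.
  The only arithmetic is addition and truncated subtraction, so in \<open>t\<close> steps the bit length of the
  stored numbers grows by at most \<open>O(t)\<close>; as for the random access machine without
  multiplication, unit cost is therefore polynomially related to Turing machine time.\<close>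

type_synonym vname = string

datatype aexp = Const nat | Var vname | Elem vname aexp | Plus aexp aexp | Minus aexp aexp

datatype bexp = BLess aexp aexp | BEq aexp aexp | BNot bexp | BAnd bexp bexp

datatype com =
    Skip
  | Assign vname aexp
  | Store vname aexp aexp \<comment> \<open>array, index, new entry\<close>
  | Seq com com
  | Cond bexp com com
  | While bexp com

record state =
  scalars :: "vname \<Rightarrow> nat"
  arrays :: "vname \<Rightarrow> nat \<Rightarrow> nat"

fun aval :: "aexp \<Rightarrow> state \<Rightarrow> nat" where
  "aval (Const n) s = n"
| "aval (Var x) s = scalars s x"
| "aval (Elem x a) s = arrays s x (aval a s)"
| "aval (Plus a b) s = aval a s + aval b s"
| "aval (Minus a b) s = aval a s - aval b s"

fun acost :: "aexp \<Rightarrow> nat" where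
  "acost (Const n) = 1"
| "acost (Var x) = 1"
| "acost (Elem x a) = 1 + acost a"
| "acost (Plus a b) = 1 + acost a + acost b"
| "acost (Minus a b) = 1 + acost a + acost b"

fun bval :: "bexp \<Rightarrow> state \<Rightarrow> bool" where
  "bval (BLess a b) s \<longleftrightarrow> aval a s < aval b s"
| "bval (BEq a b) s \<longleftrightarrow> aval a s = aval b s"
| "bval (BNot b) s \<longleftrightarrow> \<not> bval b s"
| "bval (BAnd b c) s \<longleftrightarrow> bval b s \<and> bval c s"

fun bcost :: "bexp \<Rightarrow> nat" where
  "bcost (BLess a b) = 1 + acost a + acost b"
| "bcost (BEq a b) = 1 + acost a + acost b"
| "bcost (BNot b) = 1 + bcost b"
| "bcost (BAnd b c) = 1 + bcost b + bcost c"

text \<open>\<open>exec c s t s'\<close>: started in \<open>s\<close>, the program \<open>c\<close> halts in \<open>s'\<close> after \<open>t\<close> steps.\<close>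

inductive exec :: "com \<Rightarrow> state \<Rightarrow> nat \<Rightarrow> state \<Rightarrow> bool" where
  Skip: "exec Skip s 1 s"
| Assign: "exec (Assign x a) s (1 + acost a) (s\<lparr>scalars := (scalars s)(x := aval a s)\<rparr>)"
| Store: "exec (Store x i a) s (1 + acost i + acost a)
     (s\<lparr>arrays := (arrays s)(x := (arrays s x)(aval i s := aval a s))\<rparr>)"
| Seq: "exec c s t s' \<Longrightarrow> exec d s' u s'' \<Longrightarrow> exec (Seq c d) s (t + u) s''"
| CondTrue: "bval b s \<Longrightarrow> exec c s t s' \<Longrightarrow> exec (Cond b c d) s (1 + bcost b + t) s'"
| CondFalse: "\<not> bval b s \<Longrightarrow> exec d s t s' \<Longrightarrow> exec (Cond b c d) s (1 + bcost b + t) s'"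
| WhileFalse: "\<not> bval b s \<Longrightarrow> exec (While b c) s (1 + bcost b) s"
| WhileTrue: "bval b s \<Longrightarrow> exec c s t s' \<Longrightarrow> exec (While b c) s' u s'' \<Longrightarrow>
     exec (While b c) s (1 + bcost b + t + u) s''"

inductive_cases exec_SkipE: "exec Skip s t s'"
  and exec_AssignE: "exec (Assign x a) s t s'"
  and exec_StoreE: "exec (Store x i a) s t s'"
  and exec_SeqE: "exec (Seq c d) s t s'"
  and exec_CondE: "exec (Cond b c d) s t s'"
  and exec_WhileE: "exec (While b c) s t s'"

lemma exec_deterministic: "exec c s t s' \<Longrightarrow> exec c s u s'' \<Longrightarrow> u = t \<and> s'' = s'"
proof (induction arbitrary: u s'' rule: exec.induct)
  case (Skip s)
  then show ?case by (rule exec_SkipE) simp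
next
  case (Assign x a s)
  then show ?case by (rule exec_AssignE) simp
next
  case (Store x i a s)
  then show ?case by (rule exec_StoreE) simp
next
  case (Seq c s t s' d u' s2)
  from Seq.prems show ?case
  proof (rule exec_SeqE)
    fix v r w
    assume *: "u = v + w" "exec c s v r" "exec d r w s''"
    from Seq.IH(1)[OF *(2)] have "v = t" "r = s'" by simp_all
    with * Seq.IH(2)[of w s''] show ?thesis by simp
  qed
next
  case (CondTrue b s c t s' d)
  from CondTrue.prems show ?case
  proof (rule exec_CondE)
    fix v
    assume "u = Suc (bcost b + v)" "exec c s v s''"
    with CondTrue.IH[of v s''] show ?thesis by simp
  qed (use CondTrue.hyps in simp)
next
  case (CondFalse b s d t s' c)
  from CondFalse.prems show ?case
  proof (rule exec_CondE)
    fix v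
    assume "u = Suc (bcost b + v)" "exec d s v s''"
    with CondFalse.IH[of v s''] show ?thesis by simp
  qed (use CondFalse.hyps in simp)
next
  case (WhileFalse b s c)
  from WhileFalse.prems show ?case
    by (rule exec_WhileE) (use WhileFalse.hyps in simp_all)
next
  case (WhileTrue b s c t s' u' s2)
  from WhileTrue.prems show ?case
  proof (rule exec_WhileE)
    fix v r w
    assume *: "u = Suc (bcost b + v + w)" "exec c s v r" "exec (While b c) r w s''"
    from WhileTrue.IH(1)[OF *(2)] have "v = t" "r = s'" by simp_all
    with * WhileTrue.IH(2)[of w s''] show ?thesis by simp
  qed (use WhileTrue.hyps in simp)
qed

text \<open>The input, a list of numbers, is passed in the array \<open>in\<close> and its length in the variable
  \<open>len\<close>; everything else is initially zero.  The result is returned in the variable \<open>out\<close>.\<close>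

definition initial_state :: "nat list \<Rightarrow> state" where
  "initial_state xs =
     \<lparr>scalars = (\<lambda>_. 0)(''len'' := length xs),
      arrays = (\<lambda>_ _. 0)(''in'' := (\<lambda>i. if i < length xs then xs ! i else 0))\<rparr>"

definition outputs_in_time :: "com \<Rightarrow> nat list \<Rightarrow> nat \<Rightarrow> nat \<Rightarrow> bool" where
  "outputs_in_time p xs y t \<longleftrightarrow>
     (\<exists>s. exec p (initial_state xs) t s \<and> scalars s ''out'' = y)"


section \<open>Fixed-parameter tractability\<close>

definition computable :: "(nat \<Rightarrow> nat) \<Rightarrow> bool" where
  "computable f \<longleftrightarrow> (\<exists>p. \<forall>k. \<exists>t. outputs_in_time p [k] (f k) t)"

definition input_size :: "nat list \<Rightarrow> nat" where
  "input_size xs = (\<Sum>x\<leftarrow>xs. 1 + floorlog 2 x)"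

text \<open>A parameterized problem consists of a set \<open>I\<close> of instances, an encoding \<open>enc\<close> of the
  instances, the predicate \<open>Q\<close> of yes-instances and the parameterization \<open>\<kappa>\<close>.  The algorithm
  receives the instance only, not the value of the parameter.\<close>

definition fixed_parameter_tractable ::
    "'i set \<Rightarrow> ('i \<Rightarrow> nat list) \<Rightarrow> ('i \<Rightarrow> bool) \<Rightarrow> ('i \<Rightarrow> nat) \<Rightarrow> bool" where
  "fixed_parameter_tractable I enc Q \<kappa> \<longleftrightarrow>
     (\<exists>p f c. computable f \<and>
        (\<forall>x\<in>I. \<exists>t. outputs_in_time p (enc x) (if Q x then 1 else 0) t \<and>
                    t \<le> f (\<kappa> x) * input_size (enc x) ^ c))"


section \<open>The computational problem\<close>

text \<open>Input graphs have the vertices \<open>0, \<dots>, n - 1\<close>.  They are encoded by the number \<open>n\<close> followed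
  by the rows of the adjacency matrix.\<close>

definition input_graph :: "nat graph \<Rightarrow> bool" where
  "input_graph G \<longleftrightarrow> simple_graph G \<and> verts G = {..<card (verts G)}"

definition encode_graph :: "nat graph \<Rightarrow> nat list" where
  "encode_graph G = (let n = card (verts G) in
     n # [if {u, v} \<in> edges G then 1 else 0. u \<leftarrow> [0..<n], v \<leftarrow> [0..<n]])"

definition mcsf_instances :: "(nat graph \<times> nat graph \<times> nat) set" where
  "mcsf_instances = {(G1, G2, h). input_graph G1 \<and> input_graph G2}"

definition mcsf_encode :: "nat graph \<times> nat graph \<times> nat \<Rightarrow> nat list" where
  "mcsf_encode = (\<lambda>(G1, G2, h). encode_graph G1 @ encode_graph G2 @ [h])"

definition mcsf_yes :: "nat graph \<times> nat graph \<times> nat \<Rightarrow> bool" where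
  "mcsf_yes = (\<lambda>(G1, G2, h). \<exists>H. common_star_forest G1 G2 H \<and> h \<le> card (verts H))"

text \<open>A bound in terms of this least value is also a bound in terms of every \<open>k\<close> such that both
  graphs have a vertex cover of size at most \<open>k\<close>, after replacing \<open>f\<close> in
  \<open>fixed_parameter_tractable\<close> by its running maximum.\<close>

definition mcsf_parameter :: "nat graph \<times> nat graph \<times> nat \<Rightarrow> nat" where
  "mcsf_parameter =
     (\<lambda>(G1, G2, h). LEAST k. has_vertex_cover G1 k \<and> has_vertex_cover G2 k)"

end

theory Submission
  imports Defs
begin

text \<open>A star forest with \<open>m\<close> stars that embeds into a graph with a vertex cover of size \<open>k\<close> has
  \<open>m \<le> k\<close>, as each star uses a cover vertex.  Suppose that the centre and one leaf of each star have
  been fixed in both graphs.  The remaining leaves then form a matching between the unused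
  vertices of \<open>G1\<close> and those of \<open>G2\<close>, where \<open>v\<close> and \<open>w\<close> may be matched if for some \<open>j\<close> they are
  adjacent to the two copies of the \<open>j\<close>-th centre.  By the deficiency version of Hall's theorem, the
  maximum size of the matching is the minimum, over the sets \<open>J\<close> of stars, of the number of unused
  vertices of \<open>G1\<close> adjacent to a centre in \<open>J\<close> plus the number of those of \<open>G2\<close> adjacent to a centre
  outside \<open>J\<close>.  No integer programming is needed.

  Twins are exchangeable, so the \<open>2m\<close> fixed vertices can be sought among the first \<open>2m\<close> vertices of
  each twin class; these are at most \<open>k + 2 ^ k * 2m\<close> candidates.  All choices, coded by numbers, are
  tried for \<open>m = 1, 2, \<dots>\<close> up to the first \<open>m\<close> for which there is none, hence for \<open>m \<le> k + 1\<close> only: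
  no vertex cover has to be known.

  Programs are not written down.  Instead, the functions computed by programs with a given bound on
  the running time are shown to be closed under composition, bounded iteration and so on.\<close>

section \<open>Programs computing functions of an environment\<close>

text \<open>Stars have to be non-trivial, so a matching that distributes all leaves would need a
  lower bound for every centre. Fixing one leaf per star in advance removes this constraint: the
  other leaves may be distributed arbitrarily. Hall's condition speaks about all sets of vertices,
  but whether two vertices may be matched depends only on their adjacency to the \<open>m\<close>
  centres, so \<open>2 ^ m\<close> sets of stars decide it. The codes have \<open>4 * m\<close>
  digits in a base of order \<open>2 ^ (2 * k)\<close>, hence there are only \<open>2\<close> to the
  power \<open>O(k ^ 2)\<close> of them; the double exponential bound is generous. The obstacle on
  the machine side is that the search is exponential in \<open>k\<close> while \<open>k\<close> is
  unknown to the program. Running times are therefore polynomial in a size function that contains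
  the lengths of the long loops, and this size is charged only in branches that are really executed:
  the loop over \<open>m\<close> makes \<open>n1\<close> rounds, and most of them must not pay for a
  search.\<close>

definition loc :: "nat \<Rightarrow> vname" where
  "loc i = replicate i (CHR ''x'')"

lemma loc_eq_iff [simp]: "loc i = loc j \<longleftrightarrow> i = j"
  unfolding loc_def by simp

text \<open>The program \<open>C \<rho> d\<close> finds the argument \<open>e i\<close> in the variable \<open>loc (\<rho> i)\<close> and leaves the result in
  \<open>loc d\<close>; it may use \<open>loc d, loc (d + 1), \<dots>\<close> as scratch space.  The argument \<open>A\<close> of \<open>F\<close> is the input
  array, which no program changes.\<close>

definition computes :: "((nat \<Rightarrow> nat) \<Rightarrow> nat \<Rightarrow> com) \<Rightarrow> nat \<Rightarrow> ((nat \<Rightarrow> nat) \<Rightarrow> (nat \<Rightarrow> nat) \<Rightarrow> nat) \<Rightarrow>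
    ((nat \<Rightarrow> nat) \<Rightarrow> (nat \<Rightarrow> nat) \<Rightarrow> nat) \<Rightarrow> bool" where
  "computes C r F T \<longleftrightarrow> (\<forall>\<rho> d s e. (\<forall>i<r. \<rho> i < d \<and> scalars s (loc (\<rho> i)) = e i) \<longrightarrow>
     (\<exists>t s'. exec (C \<rho> d) s t s' \<and> t \<le> T (arrays s ''in'') e \<and>
        scalars s' (loc d) = F (arrays s ''in'') e \<and>
        (\<forall>i<d. scalars s' (loc i) = scalars s (loc i)) \<and> arrays s' = arrays s))"

lemma computesE:
  assumes "computes C r F T" "\<And>i. i < r \<Longrightarrow> \<rho> i < d" "\<And>i. i < r \<Longrightarrow> scalars s (loc (\<rho> i)) = e i"
  obtains t s' where "exec (C \<rho> d) s t s'" "t \<le> T (arrays s ''in'') e"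
    "scalars s' (loc d) = F (arrays s ''in'') e"
    "\<And>i. i < d \<Longrightarrow> scalars s' (loc i) = scalars s (loc i)" "arrays s' = arrays s"
  using assms unfolding computes_def by blast

lemma computes_const: "computes (\<lambda>\<rho> d. Assign (loc d) (Const n)) r (\<lambda>A e. n) (\<lambda>A e. 2)"
  unfolding computes_def
  apply (intro allI impI)
  apply (rule exI conjI exec.Assign)+
  apply auto
  done

lemma computes_var:
  assumes "i < r"
  shows "computes (\<lambda>\<rho> d. Assign (loc d) (Var (loc (\<rho> i)))) r (\<lambda>A e. e i) (\<lambda>A e. 2)"
  unfolding computes_def
  apply (intro allI impI)
  apply (rule exI conjI exec.Assign)+
  using assms apply auto
  done

lemma computes_plus:
  assumes "computes C1 r f T1" "computes C2 r g T2"
  shows "computes (\<lambda>\<rho> d. Seq (C1 \<rho> d) (Seq (C2 \<rho> (Suc d))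
            (Assign (loc d) (Plus (Var (loc d)) (Var (loc (Suc d)))))))
          r (\<lambda>A e. f A e + g A e) (\<lambda>A e. T1 A e + T2 A e + 4)"
  unfolding computes_def
proof (intro allI impI)
  fix \<rho> d and s :: state and e
  assume *: "\<forall>i<r. \<rho> i < d \<and> scalars s (loc (\<rho> i)) = e i"
  obtain t1 s1 where 1: "exec (C1 \<rho> d) s t1 s1" "t1 \<le> T1 (arrays s ''in'') e"
    "scalars s1 (loc d) = f (arrays s ''in'') e"
    "\<And>i. i < d \<Longrightarrow> scalars s1 (loc i) = scalars s (loc i)" "arrays s1 = arrays s"
    by (rule computesE[OF assms(1), of \<rho> d s e]) (use * in auto)
  obtain t2 s2 where 2: "exec (C2 \<rho> (Suc d)) s1 t2 s2" "t2 \<le> T2 (arrays s1 ''in'') e"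
    "scalars s2 (loc (Suc d)) = g (arrays s1 ''in'') e"
    "\<And>i. i < Suc d \<Longrightarrow> scalars s2 (loc i) = scalars s1 (loc i)" "arrays s2 = arrays s1"
    by (rule computesE[OF assms(2), of \<rho> "Suc d" s1 e]) (use * 1 in \<open>auto simp: less_Suc_eq\<close>)
  show "\<exists>t s'. exec (Seq (C1 \<rho> d) (Seq (C2 \<rho> (Suc d))
            (Assign (loc d) (Plus (Var (loc d)) (Var (loc (Suc d))))))) s t s' \<and>
        t \<le> T1 (arrays s ''in'') e + T2 (arrays s ''in'') e + 4 \<and>
        scalars s' (loc d) = f (arrays s ''in'') e + g (arrays s ''in'') e \<and>
        (\<forall>i<d. scalars s' (loc i) = scalars s (loc i)) \<and> arrays s' = arrays s"
    apply (intro exI conjI)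
        apply (rule exec.Seq[OF 1(1) exec.Seq[OF 2(1) exec.Assign]])
    using 1 2 by auto
qed

lemma computes_minus:
  assumes "computes C1 r f T1" "computes C2 r g T2"
  shows "computes (\<lambda>\<rho> d. Seq (C1 \<rho> d) (Seq (C2 \<rho> (Suc d))
            (Assign (loc d) (Minus (Var (loc d)) (Var (loc (Suc d)))))))
          r (\<lambda>A e. f A e - g A e) (\<lambda>A e. T1 A e + T2 A e + 4)"
  unfolding computes_def
proof (intro allI impI)
  fix \<rho> d and s :: state and e
  assume *: "\<forall>i<r. \<rho> i < d \<and> scalars s (loc (\<rho> i)) = e i"
  obtain t1 s1 where 1: "exec (C1 \<rho> d) s t1 s1" "t1 \<le> T1 (arrays s ''in'') e"
    "scalars s1 (loc d) = f (arrays s ''in'') e"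
    "\<And>i. i < d \<Longrightarrow> scalars s1 (loc i) = scalars s (loc i)" "arrays s1 = arrays s"
    by (rule computesE[OF assms(1), of \<rho> d s e]) (use * in auto)
  obtain t2 s2 where 2: "exec (C2 \<rho> (Suc d)) s1 t2 s2" "t2 \<le> T2 (arrays s1 ''in'') e"
    "scalars s2 (loc (Suc d)) = g (arrays s1 ''in'') e"
    "\<And>i. i < Suc d \<Longrightarrow> scalars s2 (loc i) = scalars s1 (loc i)" "arrays s2 = arrays s1"
    by (rule computesE[OF assms(2), of \<rho> "Suc d" s1 e]) (use * 1 in \<open>auto simp: less_Suc_eq\<close>)
  show "\<exists>t s'. exec (Seq (C1 \<rho> d) (Seq (C2 \<rho> (Suc d))
            (Assign (loc d) (Minus (Var (loc d)) (Var (loc (Suc d))))))) s t s' \<and>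
        t \<le> T1 (arrays s ''in'') e + T2 (arrays s ''in'') e + 4 \<and>
        scalars s' (loc d) = f (arrays s ''in'') e - g (arrays s ''in'') e \<and>
        (\<forall>i<d. scalars s' (loc i) = scalars s (loc i)) \<and> arrays s' = arrays s"
    apply (intro exI conjI)
        apply (rule exec.Seq[OF 1(1) exec.Seq[OF 2(1) exec.Assign]])
    using 1 2 by auto
qed

lemma computes_input:
  assumes "computes C r f T"
  shows "computes (\<lambda>\<rho> d. Seq (C \<rho> d) (Assign (loc d) (Elem ''in'' (Var (loc d)))))
          r (\<lambda>A e. A (f A e)) (\<lambda>A e. T A e + 3)"
  unfolding computes_def
proof (intro allI impI)
  fix \<rho> d and s :: state and e
  assume *: "\<forall>i<r. \<rho> i < d \<and> scalars s (loc (\<rho> i)) = e i"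
  obtain t1 s1 where 1: "exec (C \<rho> d) s t1 s1" "t1 \<le> T (arrays s ''in'') e"
    "scalars s1 (loc d) = f (arrays s ''in'') e"
    "\<And>i. i < d \<Longrightarrow> scalars s1 (loc i) = scalars s (loc i)" "arrays s1 = arrays s"
    by (rule computesE[OF assms(1), of \<rho> d s e]) (use * in auto)
  show "\<exists>t s'. exec (Seq (C \<rho> d) (Assign (loc d) (Elem ''in'' (Var (loc d))))) s t s' \<and>
        t \<le> T (arrays s ''in'') e + 3 \<and>
        scalars s' (loc d) = arrays s ''in'' (f (arrays s ''in'') e) \<and>
        (\<forall>i<d. scalars s' (loc i) = scalars s (loc i)) \<and> arrays s' = arrays s"
    apply (intro exI conjI)
        apply (rule exec.Seq[OF 1(1) exec.Assign])
    using 1 by auto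
qed

text \<open>Only the branch taken is charged. This is what later makes skipped searches
  free.\<close>

lemma computes_if:
  assumes "computes C1 r f T1" "computes C2 r g T2" "computes C3 r h T3" "computes C4 r k T4"
  shows "computes (\<lambda>\<rho> d. Seq (C1 \<rho> d) (Seq (C2 \<rho> (Suc d))
            (Cond (BLess (Var (loc d)) (Var (loc (Suc d)))) (C3 \<rho> d) (C4 \<rho> d))))
          r (\<lambda>A e. if f A e < g A e then h A e else k A e)
          (\<lambda>A e. T1 A e + T2 A e + 4 + (if f A e < g A e then T3 A e else T4 A e))"
  unfolding computes_def
proof (intro allI impI)
  fix \<rho> d and s :: state and e
  assume *: "\<forall>i<r. \<rho> i < d \<and> scalars s (loc (\<rho> i)) = e i"
  let ?A = "arrays s ''in''"
  obtain t1 s1 where 1: "exec (C1 \<rho> d) s t1 s1" "t1 \<le> T1 (arrays s ''in'') e"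
    "scalars s1 (loc d) = f (arrays s ''in'') e"
    "\<And>i. i < d \<Longrightarrow> scalars s1 (loc i) = scalars s (loc i)" "arrays s1 = arrays s"
    by (rule computesE[OF assms(1), of \<rho> d s e]) (use * in auto)
  obtain t2 s2 where 2: "exec (C2 \<rho> (Suc d)) s1 t2 s2" "t2 \<le> T2 (arrays s1 ''in'') e"
    "scalars s2 (loc (Suc d)) = g (arrays s1 ''in'') e"
    "\<And>i. i < Suc d \<Longrightarrow> scalars s2 (loc i) = scalars s1 (loc i)" "arrays s2 = arrays s1"
    by (rule computesE[OF assms(2), of \<rho> "Suc d" s1 e]) (use * 1 in \<open>auto simp: less_Suc_eq\<close>)
  obtain t3 s3 where 3: "exec (C3 \<rho> d) s2 t3 s3" "t3 \<le> T3 (arrays s2 ''in'') e"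
    "scalars s3 (loc d) = h (arrays s2 ''in'') e"
    "\<And>i. i < d \<Longrightarrow> scalars s3 (loc i) = scalars s2 (loc i)" "arrays s3 = arrays s2"
    by (rule computesE[OF assms(3), of \<rho> d s2 e]) (use * 1 2 in \<open>auto simp: less_Suc_eq\<close>)
  obtain t4 s4 where 4: "exec (C4 \<rho> d) s2 t4 s4" "t4 \<le> T4 (arrays s2 ''in'') e"
    "scalars s4 (loc d) = k (arrays s2 ''in'') e"
    "\<And>i. i < d \<Longrightarrow> scalars s4 (loc i) = scalars s2 (loc i)" "arrays s4 = arrays s2"
    by (rule computesE[OF assms(4), of \<rho> d s2 e]) (use * 1 2 in \<open>auto simp: less_Suc_eq\<close>)
  have b: "bval (BLess (Var (loc d)) (Var (loc (Suc d)))) s2 \<longleftrightarrow> f ?A e < g ?A e"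
    using 1 2 by simp
  show "\<exists>t s'. exec (Seq (C1 \<rho> d) (Seq (C2 \<rho> (Suc d))
            (Cond (BLess (Var (loc d)) (Var (loc (Suc d)))) (C3 \<rho> d) (C4 \<rho> d)))) s t s' \<and>
        t \<le> T1 ?A e + T2 ?A e + 4 + (if f ?A e < g ?A e then T3 ?A e else T4 ?A e) \<and>
        scalars s' (loc d) = (if f ?A e < g ?A e then h ?A e else k ?A e) \<and>
        (\<forall>i<d. scalars s' (loc i) = scalars s (loc i)) \<and> arrays s' = arrays s"
  proof (cases "f ?A e < g ?A e")
    case True
    show ?thesis
      apply (intro exI conjI)
          apply (rule exec.Seq[OF 1(1) exec.Seq[OF 2(1) exec.CondTrue[OF _ 3(1)]]])
      using 1 2 3 b True by auto
  next
    case False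
    show ?thesis
      apply (intro exI conjI)
          apply (rule exec.Seq[OF 1(1) exec.Seq[OF 2(1) exec.CondFalse[OF _ 4(1)]]])
      using 1 2 4 b False by auto
  qed
qed

text \<open>Bound values are de Bruijn indices: the new value becomes argument 0 and shifts the
  others, and \<open>case_nat d \<rho>\<close> records that it is kept in \<open>loc d\<close> while
  the body works above it.\<close>

lemma computes_let:
  assumes "computes C1 r f T1" "computes C2 (Suc r) g T2"
  shows "computes (\<lambda>\<rho> d. Seq (C1 \<rho> d) (Seq (C2 (case_nat d \<rho>) (Suc d))
            (Assign (loc d) (Var (loc (Suc d))))))
          r (\<lambda>A e. g A (case_nat (f A e) e))
          (\<lambda>A e. T1 A e + T2 A (case_nat (f A e) e) + 2)"
  unfolding computes_def
proof (intro allI impI)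
  fix \<rho> d and s :: state and e
  assume *: "\<forall>i<r. \<rho> i < d \<and> scalars s (loc (\<rho> i)) = e i"
  let ?A = "arrays s ''in''"
  let ?e = "case_nat (f ?A e) e"
  obtain t1 s1 where 1: "exec (C1 \<rho> d) s t1 s1" "t1 \<le> T1 (arrays s ''in'') e"
    "scalars s1 (loc d) = f (arrays s ''in'') e"
    "\<And>i. i < d \<Longrightarrow> scalars s1 (loc i) = scalars s (loc i)" "arrays s1 = arrays s"
    by (rule computesE[OF assms(1), of \<rho> d s e]) (use * in auto)
  obtain t2 s2 where 2: "exec (C2 (case_nat d \<rho>) (Suc d)) s1 t2 s2" "t2 \<le> T2 (arrays s1 ''in'') ?e"
    "scalars s2 (loc (Suc d)) = g (arrays s1 ''in'') ?e"
    "\<And>i. i < Suc d \<Longrightarrow> scalars s2 (loc i) = scalars s1 (loc i)" "arrays s2 = arrays s1"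
    by (rule computesE[OF assms(2), of "case_nat d \<rho>" "Suc d" s1 ?e])
      (use * 1 in \<open>auto simp: less_Suc_eq split: nat.splits\<close>)
  show "\<exists>t s'. exec (Seq (C1 \<rho> d) (Seq (C2 (case_nat d \<rho>) (Suc d))
            (Assign (loc d) (Var (loc (Suc d)))))) s t s' \<and>
        t \<le> T1 ?A e + T2 ?A ?e + 2 \<and> scalars s' (loc d) = g ?A ?e \<and>
        (\<forall>i<d. scalars s' (loc i) = scalars s (loc i)) \<and> arrays s' = arrays s"
    apply (intro exI conjI)
        apply (rule exec.Seq[OF 1(1) exec.Seq[OF 2(1) exec.Assign]])
    using 1 2 by auto
qed

lemma computes_rename:
  assumes "computes C q F T" "\<And>i. i < q \<Longrightarrow> p i < r"
  shows "computes (\<lambda>\<rho>. C (\<lambda>i. \<rho> (p i))) r (\<lambda>A e. F A (\<lambda>i. e (p i))) (\<lambda>A e. T A (\<lambda>i. e (p i)))"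
  unfolding computes_def
proof (intro allI impI)
  fix \<rho> d and s :: state and e
  assume *: "\<forall>i<r. \<rho> i < d \<and> scalars s (loc (\<rho> i)) = e i"
  obtain t1 s1 where 1: "exec (C (\<lambda>i. \<rho> (p i)) d) s t1 s1" "t1 \<le> T (arrays s ''in'') (\<lambda>i. e (p i))"
    "scalars s1 (loc d) = F (arrays s ''in'') (\<lambda>i. e (p i))"
    "\<And>i. i < d \<Longrightarrow> scalars s1 (loc i) = scalars s (loc i)" "arrays s1 = arrays s"
    by (rule computesE[OF assms(1), of "\<lambda>i. \<rho> (p i)" d s "\<lambda>i. e (p i)"]) (use * assms(2) in auto)
  then show "\<exists>t s'. exec (C (\<lambda>i. \<rho> (p i)) d) s t s' \<and> t \<le> T (arrays s ''in'') (\<lambda>i. e (p i)) \<and>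
        scalars s' (loc d) = F (arrays s ''in'') (\<lambda>i. e (p i)) \<and>
        (\<forall>i<d. scalars s' (loc i) = scalars s (loc i)) \<and> arrays s' = arrays s"
    by blast
qed

text \<open>The accumulator is kept in \<open>loc d\<close>, the number of rounds in
  \<open>loc (d+1)\<close>, the counter in \<open>loc (d+2)\<close>; the body works from
  \<open>loc (d+3)\<close> on and sees the counter as argument 0 and the accumulator as argument 1.
  A round costs 10 besides the body: 4 for the test, 2 for the copy, 4 for the increment. The 6
  outside the sum are the initialisation of the counter and the final failing test.\<close>

lemma computes_fold:
  fixes f0 f g T0 TN TB
  defines "acc \<equiv> \<lambda>A e. rec_nat (f0 A e) (\<lambda>i a. g A (case_nat i (case_nat a e)))"
  assumes "computes C0 r f0 T0" "computes CN r f TN" "computes CB (Suc (Suc r)) g TB"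
  shows "computes (\<lambda>\<rho> d. Seq (C0 \<rho> d) (Seq (CN \<rho> (Suc d)) (Seq (Assign (loc (d+2)) (Const 0))
            (While (BLess (Var (loc (d+2))) (Var (loc (d+1))))
              (Seq (CB (case_nat (d+2) (case_nat d \<rho>)) (d+3))
                (Seq (Assign (loc d) (Var (loc (d+3))))
                  (Assign (loc (d+2)) (Plus (Var (loc (d+2))) (Const 1)))))))))
          r (\<lambda>A e. acc A e (f A e))
          (\<lambda>A e. T0 A e + TN A e + 6 +
            (\<Sum>i<f A e. TB A (case_nat i (case_nat (acc A e i) e)) + 10))"
  unfolding computes_def
proof (intro allI impI)
  fix \<rho> d and s :: state and e
  assume *: "\<forall>i<r. \<rho> i < d \<and> scalars s (loc (\<rho> i)) = e i"
  let ?A = "arrays s ''in''"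
  let ?b = "BLess (Var (loc (d+2))) (Var (loc (d+1)))"
  let ?B = "Seq (CB (case_nat (d+2) (case_nat d \<rho>)) (d+3)) (Seq (Assign (loc d) (Var (loc (d+3))))
                  (Assign (loc (d+2)) (Plus (Var (loc (d+2))) (Const 1))))"
  let ?n = "f ?A e"
  \<comment> \<open>Generalised to a start at round \<open>i1\<close>, so that the induction can be
    on the number of rounds left.\<close>
  have loop: "\<exists>t s'. exec (While ?b ?B) s1 t s' \<and>
      t \<le> (\<Sum>i\<in>{i1..<?n}. TB ?A (case_nat i (case_nat (acc ?A e i) e)) + 10) + 4 \<and>
      scalars s' (loc d) = acc ?A e ?n \<and> (\<forall>i<d. scalars s' (loc i) = scalars s (loc i)) \<and>
      arrays s' = arrays s"
    if "i1 \<le> ?n" "scalars s1 (loc d) = acc ?A e i1" "scalars s1 (loc (d+1)) = ?n"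
      "scalars s1 (loc (d+2)) = i1" "\<forall>i<d. scalars s1 (loc i) = scalars s (loc i)"
      "arrays s1 = arrays s" for s1 i1
    using that
  proof (induction "?n - i1" arbitrary: i1 s1)
    case 0
    then show ?case
      by (intro exI[of _ 4] exI[of _ s1] conjI)
        (use exec.WhileFalse[of ?b s1 ?B] in \<open>auto simp: eval_nat_numeral\<close>)
  next
    case (Suc x)
    let ?e = "case_nat i1 (case_nat (acc ?A e i1) e)"
    obtain t2 s2 where 2: "exec (CB (case_nat (d+2) (case_nat d \<rho>)) (d+3)) s1 t2 s2"
      "t2 \<le> TB (arrays s1 ''in'') ?e" "scalars s2 (loc (d+3)) = g (arrays s1 ''in'') ?e"
      "\<And>i. i < d+3 \<Longrightarrow> scalars s2 (loc i) = scalars s1 (loc i)" "arrays s2 = arrays s1"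
      by (rule computesE[OF assms(4), of "case_nat (d+2) (case_nat d \<rho>)" "d+3" s1 ?e])
        (use * Suc.prems in \<open>auto simp: less_Suc_eq trans_less_add1 split: nat.splits\<close>)
    define s3 where "s3 = s2\<lparr>scalars := (scalars s2)(loc d := scalars s2 (loc (d+3)))\<rparr>"
    define s4 where "s4 = s3\<lparr>scalars := (scalars s3)(loc (d+2) := scalars s3 (loc (d+2)) + 1)\<rparr>"
    have "exec (Assign (loc d) (Var (loc (d+3)))) s2 2 s3"
      using exec.Assign[of "loc d" "Var (loc (d+3))" s2] by (simp add: s3_def eval_nat_numeral)
    moreover have "exec (Assign (loc (d+2)) (Plus (Var (loc (d+2))) (Const 1))) s3 4 s4"
      using exec.Assign[of "loc (d+2)" "Plus (Var (loc (d+2))) (Const 1)" s3]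
      by (simp add: s4_def eval_nat_numeral)
    ultimately have ex: "exec ?B s1 (t2 + (2 + 4)) s4"
      by (rule exec.Seq[OF 2(1) exec.Seq])
    have lt: "i1 < ?n" using Suc.hyps(2) by linarith
    have "\<exists>t s'. exec (While ?b ?B) s4 t s' \<and>
      t \<le> (\<Sum>i\<in>{Suc i1..<?n}. TB ?A (case_nat i (case_nat (acc ?A e i) e)) + 10) + 4 \<and>
      scalars s' (loc d) = acc ?A e ?n \<and> (\<forall>i<d. scalars s' (loc i) = scalars s (loc i)) \<and>
      arrays s' = arrays s"
    proof (rule Suc.hyps(1))
      show "x = ?n - Suc i1" using Suc.hyps(2) by linarith
      show "scalars s4 (loc d) = acc ?A e (Suc i1)"
        using 2 Suc.prems by (simp add: s4_def s3_def acc_def)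
    qed (use 2 Suc.prems lt in \<open>auto simp: s4_def s3_def\<close>)
    then obtain t5 s5 where 5: "exec (While ?b ?B) s4 t5 s5"
      "t5 \<le> (\<Sum>i\<in>{Suc i1..<?n}. TB ?A (case_nat i (case_nat (acc ?A e i) e)) + 10) + 4"
      "scalars s5 (loc d) = acc ?A e ?n" "\<forall>i<d. scalars s5 (loc i) = scalars s (loc i)"
      "arrays s5 = arrays s" by blast
    have "exec (While ?b ?B) s1 (1 + bcost ?b + (t2 + (2+4)) + t5) s5"
      by (rule exec.WhileTrue[OF _ ex 5(1)]) (use Suc.prems lt in simp)
    moreover have "(\<Sum>i\<in>{i1..<?n}. TB ?A (case_nat i (case_nat (acc ?A e i) e)) + 10) =
        TB ?A ?e + 10 + (\<Sum>i\<in>{Suc i1..<?n}. TB ?A (case_nat i (case_nat (acc ?A e i) e)) + 10)"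
      using lt by (simp add: sum.atLeast_Suc_lessThan)
    ultimately show ?case using 2 5 Suc.prems
      by (intro exI[of _ "1 + bcost ?b + (t2 + (2+4)) + t5"] exI[of _ s5] conjI) simp_all
  qed
  obtain t1 s1 where 1: "exec (C0 \<rho> d) s t1 s1" "t1 \<le> T0 (arrays s ''in'') e"
    "scalars s1 (loc d) = f0 (arrays s ''in'') e"
    "\<And>i. i < d \<Longrightarrow> scalars s1 (loc i) = scalars s (loc i)" "arrays s1 = arrays s"
    by (rule computesE[OF assms(2), of \<rho> d s e]) (use * in auto)
  obtain t2 s2 where 2: "exec (CN \<rho> (Suc d)) s1 t2 s2" "t2 \<le> TN (arrays s1 ''in'') e"
    "scalars s2 (loc (Suc d)) = f (arrays s1 ''in'') e"
    "\<And>i. i < Suc d \<Longrightarrow> scalars s2 (loc i) = scalars s1 (loc i)" "arrays s2 = arrays s1"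
    by (rule computesE[OF assms(3), of \<rho> "Suc d" s1 e]) (use * 1 in \<open>auto simp: less_Suc_eq\<close>)
  define s3 where "s3 = s2\<lparr>scalars := (scalars s2)(loc (d+2) := 0)\<rparr>"
  have 3: "exec (Assign (loc (d+2)) (Const 0)) s2 2 s3"
    using exec.Assign[of "loc (d+2)" "Const 0" s2] by (simp add: s3_def eval_nat_numeral)
  have "\<exists>t s'. exec (While ?b ?B) s3 t s' \<and>
      t \<le> (\<Sum>i\<in>{0..<?n}. TB ?A (case_nat i (case_nat (acc ?A e i) e)) + 10) + 4 \<and>
      scalars s' (loc d) = acc ?A e ?n \<and> (\<forall>i<d. scalars s' (loc i) = scalars s (loc i)) \<and>
      arrays s' = arrays s"
    by (rule loop) (use 1 2 in \<open>auto simp: s3_def acc_def\<close>)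
  then obtain t4 s4 where 4: "exec (While ?b ?B) s3 t4 s4"
      "t4 \<le> (\<Sum>i\<in>{0..<?n}. TB ?A (case_nat i (case_nat (acc ?A e i) e)) + 10) + 4"
      "scalars s4 (loc d) = acc ?A e ?n" "\<forall>i<d. scalars s4 (loc i) = scalars s (loc i)"
      "arrays s4 = arrays s" by blast
  show "\<exists>t s'. exec (Seq (C0 \<rho> d) (Seq (CN \<rho> (Suc d)) (Seq (Assign (loc (d+2)) (Const 0))
            (While ?b ?B)))) s t s' \<and>
       t \<le> T0 ?A e + TN ?A e + 6 + (\<Sum>i<f ?A e. TB ?A (case_nat i (case_nat (acc ?A e i) e)) + 10) \<and>
       scalars s' (loc d) = acc ?A e (f ?A e) \<and>
       (\<forall>i<d. scalars s' (loc i) = scalars s (loc i)) \<and> arrays s' = arrays s"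
    apply (intro exI conjI)
        apply (rule exec.Seq[OF 1(1) exec.Seq[OF 2(1) exec.Seq[OF 3 4(1)]]])
    using 1 2 4 by (auto simp: lessThan_atLeast0)
qed

definition input_array :: "nat list \<Rightarrow> nat \<Rightarrow> nat" where
  "input_array xs i = (if i < length xs then xs ! i else 0)"

lemma computes_outputs:
  assumes "computes C 0 F T"
  shows "\<exists>t. outputs_in_time (Seq (C id 0) (Assign ''out'' (Var (loc 0)))) xs (F (input_array xs) e) t \<and>
     t \<le> T (input_array xs) e + 2"
proof -
  let ?s = "initial_state xs"
  have A: "arrays ?s ''in'' = input_array xs" by (simp add: initial_state_def input_array_def fun_eq_iff)
  obtain t1 s1 where 1: "exec (C id 0) ?s t1 s1" "t1 \<le> T (arrays ?s ''in'') e"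
    "scalars s1 (loc 0) = F (arrays ?s ''in'') e"
    by (rule computesE[OF assms(1), of id 0 ?s e]) auto
  show ?thesis unfolding outputs_in_time_def
    apply (intro exI conjI)
      apply (rule exec.Seq[OF 1(1) exec.Assign])
    using 1 A by auto
qed

section \<open>Polynomial running time\<close>

text \<open>Bounds are polynomial in the arguments \<open>e 0, \<dots>, e (r - 1)\<close> and the additional size \<open>H A e\<close>, but do
  not depend on the entries of the input array, which may contain a huge threshold \<open>h\<close>.  The size
  \<open>H\<close> accounts for loops of exponential length.\<close>

definition polybd :: "((nat \<Rightarrow> nat) \<Rightarrow> (nat \<Rightarrow> nat) \<Rightarrow> nat) \<Rightarrow> nat \<Rightarrow>
    ((nat \<Rightarrow> nat) \<Rightarrow> (nat \<Rightarrow> nat) \<Rightarrow> nat) \<Rightarrow> bool" where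
  "polybd H r T \<longleftrightarrow> (\<exists>c. \<forall>A e M. 2 \<le> M \<and> (\<forall>i<r. e i \<le> M) \<and> H A e \<le> M \<longrightarrow> T A e \<le> M ^ c)"

text \<open>The value is bounded as well as the time, since it may become an argument of another
  function or the number of rounds of a loop.\<close>

definition ptime :: "((nat \<Rightarrow> nat) \<Rightarrow> (nat \<Rightarrow> nat) \<Rightarrow> nat) \<Rightarrow> nat \<Rightarrow>
    ((nat \<Rightarrow> nat) \<Rightarrow> (nat \<Rightarrow> nat) \<Rightarrow> nat) \<Rightarrow> bool" where
  "ptime H r F \<longleftrightarrow> (\<exists>C T. computes C r F T \<and> polybd H r T \<and> polybd H r F)"

definition pdec :: "((nat \<Rightarrow> nat) \<Rightarrow> (nat \<Rightarrow> nat) \<Rightarrow> nat) \<Rightarrow> nat \<Rightarrow>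
    ((nat \<Rightarrow> nat) \<Rightarrow> (nat \<Rightarrow> nat) \<Rightarrow> bool) \<Rightarrow> bool" where
  "pdec H r P \<longleftrightarrow> ptime H r (\<lambda>A e. of_bool (P A e))"

lemma polybdI:
  assumes "\<And>A e M. 2 \<le> M \<Longrightarrow> (\<And>i. i < r \<Longrightarrow> e i \<le> M) \<Longrightarrow> H A e \<le> M \<Longrightarrow> T A e \<le> M ^ c"
  shows "polybd H r T"
  using assms unfolding polybd_def by blast

lemma polybd_mono:
  assumes "polybd H r T" "\<And>A e. S A e \<le> T A e"
  shows "polybd H r S"
  using assms unfolding polybd_def by (meson le_trans)

text \<open>Constants disappear in the exponent because \<open>n \<le> 2 ^ n \<le> M ^ n\<close>.
  This is the purpose of \<open>2 \<le> M\<close>: a bound is a single exponent, and coefficients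
  never have to be tracked.\<close>

lemma polybd_const: "polybd H r (\<lambda>A e. n)"
proof (rule polybdI)
  fix M :: nat
  assume "2 \<le> M"
  then have "2 ^ n \<le> M ^ n" by (rule power_mono) simp
  moreover have "n \<le> 2 ^ n" by simp
  ultimately show "n \<le> M ^ n" by (rule le_trans[rotated])
qed

lemma polybd_var: "i < r \<Longrightarrow> polybd H r (\<lambda>A e. e i)"
  by (rule polybdI[where c = 1]) simp

lemma polybd_size: "polybd H r H"
  by (rule polybdI[where c = 1]) simp

lemma polybd_add:
  assumes "polybd H r S" "polybd H r T"
  shows "polybd H r (\<lambda>A e. S A e + T A e)"
proof -
  obtain c where c: "\<And>A e M. 2 \<le> M \<Longrightarrow> (\<And>i. i < r \<Longrightarrow> e i \<le> M) \<Longrightarrow> H A e \<le> M \<Longrightarrow> S A e \<le> M ^ c"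
    using assms(1) unfolding polybd_def by blast
  obtain d where d: "\<And>A e M. 2 \<le> M \<Longrightarrow> (\<And>i. i < r \<Longrightarrow> e i \<le> M) \<Longrightarrow> H A e \<le> M \<Longrightarrow> T A e \<le> M ^ d"
    using assms(2) unfolding polybd_def by blast
  show ?thesis
  proof (rule polybdI[where c = "Suc (c + d)"])
    fix A e and M :: nat
    assume *: "2 \<le> M" "\<And>i. i < r \<Longrightarrow> e i \<le> M" "H A e \<le> M"
    have "S A e \<le> M ^ (c + d)" "T A e \<le> M ^ (c + d)"
      using c[OF *] d[OF *] *(1)
      by (meson le_trans power_increasing le_add1 le_add2 one_le_numeral)+
    then have "S A e + T A e \<le> 2 * M ^ (c + d)" by simp
    also have "\<dots> \<le> M * M ^ (c + d)" using *(1) by simp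
    finally show "S A e + T A e \<le> M ^ Suc (c + d)" by simp
  qed
qed

lemma polybd_max:
  assumes "polybd H r S" "polybd H r T"
  shows "polybd H r (\<lambda>A e. if P A e then S A e else T A e)"
  by (rule polybd_mono[OF polybd_add[OF assms]]) simp

text \<open>Polynomials compose: once \<open>M ^ Suc c\<close> bounds the new argument and the old
  ones, it takes the place of \<open>M\<close> in the bound for \<open>T\<close>. The exponent is
  \<open>Suc c\<close> because \<open>M \<le> M ^ c\<close> fails for \<open>c = 0\<close>.\<close>

lemma polybd_push:
  assumes "polybd H r f" "polybd H' (Suc r) T"
    and "\<And>A e. H' A (case_nat (f A e) e) \<le> H A e"
  shows "polybd H r (\<lambda>A e. T A (case_nat (f A e) e))"
proof -
  obtain c where c: "\<And>A e M. 2 \<le> M \<Longrightarrow> (\<And>i. i < r \<Longrightarrow> e i \<le> M) \<Longrightarrow> H A e \<le> M \<Longrightarrow> f A e \<le> M ^ c"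
    using assms(1) unfolding polybd_def by blast
  obtain d where d: "\<And>A e M. 2 \<le> M \<Longrightarrow> (\<And>i. i < Suc r \<Longrightarrow> e i \<le> M) \<Longrightarrow> H' A e \<le> M
      \<Longrightarrow> T A e \<le> M ^ d"
    using assms(2) unfolding polybd_def by blast
  show ?thesis
  proof (rule polybdI[where c = "Suc c * d"])
    fix A e and M :: nat
    assume *: "2 \<le> M" "\<And>i. i < r \<Longrightarrow> e i \<le> M" "H A e \<le> M"
    have M: "M \<le> M ^ Suc c" "M ^ c \<le> M ^ Suc c" using *(1) by simp_all
    have "T A (case_nat (f A e) e) \<le> (M ^ Suc c) ^ d"
    proof (rule d)
      show "case_nat (f A e) e i \<le> M ^ Suc c" if "i < Suc r" for i
        using that c[OF *] M le_trans[OF *(2) M(1)] by (cases i) (auto simp del: power_Suc)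
      show "H' A (case_nat (f A e) e) \<le> M ^ Suc c"
        using assms(3)[of A e] *(3) M(1) by linarith
    qed (use * M in \<open>auto intro: le_trans\<close>)
    then show "T A (case_nat (f A e) e) \<le> M ^ (Suc c * d)"
      by (simp only: power_mult)
  qed
qed

text \<open>The bound \<open>h\<close> on the accumulator is a separate hypothesis: a polynomially
  bounded step can produce huge values when iterated, for example by repeated squaring.\<close>

lemma polybd_sum:
  assumes "polybd H r f" "polybd H r h"
    and "polybd H' (Suc (Suc r)) g"
    and "\<And>A e i. i < f A e \<Longrightarrow> acc A e i \<le> h A e"
    and "\<And>A e i. i < f A e \<Longrightarrow> H' A (case_nat i (case_nat (acc A e i) e)) \<le> H A e"
  shows "polybd H r (\<lambda>A e. \<Sum>i<f A e. g A (case_nat i (case_nat (acc A e i) e)))"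
proof -
  obtain c where c: "\<And>A e M. 2 \<le> M \<Longrightarrow> (\<And>i. i < r \<Longrightarrow> e i \<le> M) \<Longrightarrow> H A e \<le> M \<Longrightarrow>
      f A e + h A e \<le> M ^ c"
    using polybd_add[OF assms(1,2)] unfolding polybd_def by blast
  obtain d where d: "\<And>A e M. 2 \<le> M \<Longrightarrow> (\<And>i. i < Suc (Suc r) \<Longrightarrow> e i \<le> M) \<Longrightarrow>
      H' A e \<le> M \<Longrightarrow> g A e \<le> M ^ d"
    using assms(3) unfolding polybd_def by blast
  show ?thesis
  proof (rule polybdI[where c = "c + Suc c * d"])
    fix A e and M :: nat
    assume *: "2 \<le> M" "\<And>i. i < r \<Longrightarrow> e i \<le> M" "H A e \<le> M"
    have M: "M \<le> M ^ Suc c" "M ^ c \<le> M ^ Suc c" using *(1) by simp_all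
    have g: "g A (case_nat i (case_nat (acc A e i) e)) \<le> (M ^ Suc c) ^ d" if "i < f A e" for i
    proof (rule d)
      have "i \<le> M ^ c" "acc A e i \<le> M ^ c" using c[OF *] assms(4)[OF that] that by linarith+
      then show "case_nat i (case_nat (acc A e i) e) j \<le> M ^ Suc c" if "j < Suc (Suc r)" for j
        using that le_trans[OF *(2) M(1)] le_trans[OF _ M(2)]
        by (auto split: nat.split simp del: power_Suc)
      show "H' A (case_nat i (case_nat (acc A e i) e)) \<le> M ^ Suc c"
        using assms(5)[OF that] *(3) M(1) by linarith
    qed (use * M in \<open>auto intro: le_trans\<close>)
    have "(\<Sum>i<f A e. g A (case_nat i (case_nat (acc A e i) e))) \<le> (\<Sum>i<f A e. (M ^ Suc c) ^ d)"
      by (rule sum_mono) (use g in simp)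
    also have "\<dots> = f A e * (M ^ Suc c) ^ d" by simp
    also have "\<dots> \<le> M ^ c * (M ^ Suc c) ^ d"
      using c[OF *] by (intro mult_le_mono1) linarith
    also have "\<dots> = M ^ (c + Suc c * d)" by (simp only: power_add power_mult)
    finally show "(\<Sum>i<f A e. g A (case_nat i (case_nat (acc A e i) e))) \<le> M ^ (c + Suc c * d)" .
  qed
qed

lemma polybd_rename:
  assumes "polybd H q F" "\<And>i. i < q \<Longrightarrow> p i < r"
  shows "polybd (\<lambda>A e. H A (\<lambda>i. e (p i))) r (\<lambda>A e. F A (\<lambda>i. e (p i)))"
proof -
  obtain c where c: "\<And>A e M. 2 \<le> M \<Longrightarrow> (\<And>i. i < q \<Longrightarrow> e i \<le> M) \<Longrightarrow> H A e \<le> M \<Longrightarrow> F A e \<le> M ^ c"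
    using assms(1) unfolding polybd_def by blast
  show ?thesis by (rule polybdI[where c = c]) (simp add: c assms(2))
qed

lemma polybd_weaken_size:
  assumes "polybd (\<lambda>A e. 0) r F"
  shows "polybd H r F"
proof -
  obtain c where c: "\<And>A e M. 2 \<le> M \<Longrightarrow> (\<And>i. i < r \<Longrightarrow> e i \<le> M) \<Longrightarrow> F A e \<le> M ^ c"
    using assms unfolding polybd_def by blast
  show ?thesis by (rule polybdI[OF c])
qed

section \<open>Closure properties of polynomial time\<close>

lemma ptimeI: "computes C r F T \<Longrightarrow> polybd H r T \<Longrightarrow> polybd H r F \<Longrightarrow> ptime H r F"
  unfolding ptime_def by blast

lemma ptime_weaken_size: "ptime (\<lambda>A e. 0) r F \<Longrightarrow> ptime H r F"
  unfolding ptime_def using polybd_weaken_size by blast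

named_theorems ptime_intros

lemma ptime_const [ptime_intros]: "ptime H r (\<lambda>A e. n)"
  by (rule ptimeI[OF computes_const polybd_const polybd_const])

lemma ptime_var [ptime_intros]: "i < r \<Longrightarrow> ptime H r (\<lambda>A e. e i)"
  by (rule ptimeI[OF computes_var polybd_const polybd_var])

lemma ptime_plus [ptime_intros]:
  assumes "ptime H r f" "ptime H r g"
  shows "ptime H r (\<lambda>A e. f A e + g A e)"
proof -
  obtain C1 T1 where 1: "computes C1 r f T1" "polybd H r T1" "polybd H r f"
    using assms(1) unfolding ptime_def by blast
  obtain C2 T2 where 2: "computes C2 r g T2" "polybd H r T2" "polybd H r g"
    using assms(2) unfolding ptime_def by blast
  show ?thesis
    by (rule ptimeI[OF computes_plus[OF 1(1) 2(1)]]) (intro polybd_add polybd_const 1 2)+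
qed

lemma ptime_Suc [ptime_intros]: "ptime H r f \<Longrightarrow> ptime H r (\<lambda>A e. Suc (f A e))"
  using ptime_plus[OF _ ptime_const, of H r f 1] by simp

lemma ptime_minus [ptime_intros]:
  assumes "ptime H r f" "ptime H r g"
  shows "ptime H r (\<lambda>A e. f A e - g A e)"
proof -
  obtain C1 T1 where 1: "computes C1 r f T1" "polybd H r T1" "polybd H r f"
    using assms(1) unfolding ptime_def by blast
  obtain C2 T2 where 2: "computes C2 r g T2" "polybd H r T2" "polybd H r g"
    using assms(2) unfolding ptime_def by blast
  have "polybd H r (\<lambda>A e. f A e - g A e)"
    by (rule polybd_mono[OF 1(3)]) simp
  then show ?thesis
    by (intro ptimeI[OF computes_minus[OF 1(1) 2(1)]] polybd_add polybd_const 1 2)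
qed

lemma polybd_if:
  assumes "polybd Ht r S" "polybd He r T"
    and "\<And>A e. P A e \<Longrightarrow> Ht A e \<le> H A e" "\<And>A e. \<not> P A e \<Longrightarrow> He A e \<le> H A e"
  shows "polybd H r (\<lambda>A e. if P A e then S A e else T A e)"
proof -
  obtain c where c: "\<And>A e M. 2 \<le> M \<Longrightarrow> (\<And>i. i < r \<Longrightarrow> e i \<le> M) \<Longrightarrow> Ht A e \<le> M \<Longrightarrow> S A e \<le> M ^ c"
    using assms(1) unfolding polybd_def by blast
  obtain d where d: "\<And>A e M. 2 \<le> M \<Longrightarrow> (\<And>i. i < r \<Longrightarrow> e i \<le> M) \<Longrightarrow> He A e \<le> M \<Longrightarrow> T A e \<le> M ^ d"
    using assms(2) unfolding polybd_def by blast
  show ?thesis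
  proof (rule polybdI[where c = "c + d"])
    fix A e and M :: nat
    assume *: "2 \<le> M" "\<And>i. i < r \<Longrightarrow> e i \<le> M" "H A e \<le> M"
    have "M ^ c \<le> M ^ (c + d)" "M ^ d \<le> M ^ (c + d)" using *(1) by simp_all
    moreover have "S A e \<le> M ^ c" if "P A e"
      using c[OF *(1,2)] assms(3)[OF that] *(3) by (meson le_trans)
    moreover have "T A e \<le> M ^ d" if "\<not> P A e"
      using d[OF *(1,2)] assms(4)[OF that] *(3) by (meson le_trans)
    ultimately show "(if P A e then S A e else T A e) \<le> M ^ (c + d)"
      by (auto intro: le_trans)
  qed
qed

text \<open>Each branch brings its own size, which has to stay below \<open>H\<close> only where
  that branch is taken. In \<open>ptime_maxstars\<close> one branch has size 0 and the other the
  size of an exponential search.\<close>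

lemma ptime_if_less:
  assumes "ptime H r f" "ptime H r g" "ptime Ht r h" "ptime He r k"
    and "\<And>A e. f A e < g A e \<Longrightarrow> Ht A e \<le> H A e" "\<And>A e. \<not> f A e < g A e \<Longrightarrow> He A e \<le> H A e"
  shows "ptime H r (\<lambda>A e. if f A e < g A e then h A e else k A e)"
proof -
  obtain C1 T1 where 1: "computes C1 r f T1" "polybd H r T1" "polybd H r f"
    using assms(1) unfolding ptime_def by blast
  obtain C2 T2 where 2: "computes C2 r g T2" "polybd H r T2" "polybd H r g"
    using assms(2) unfolding ptime_def by blast
  obtain C3 T3 where 3: "computes C3 r h T3" "polybd Ht r T3" "polybd Ht r h"
    using assms(3) unfolding ptime_def by blast
  obtain C4 T4 where 4: "computes C4 r k T4" "polybd He r T4" "polybd He r k"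
    using assms(4) unfolding ptime_def by blast
  show ?thesis
    by (rule ptimeI[OF computes_if[OF 1(1) 2(1) 3(1) 4(1)]])
      (intro polybd_add polybd_const 1 2 polybd_if[OF 3(2) 4(2) assms(5,6)]
        polybd_if[OF 3(3) 4(3) assms(5,6)]; assumption)+
qed

text \<open>The inner size \<open>H'\<close> may depend on the new value and is compared with
  \<open>H\<close> only at the value actually bound. Passing this value and the old environment to
  \<open>g\<close> separately lets unification match ordinary terms.\<close>

lemma ptime_let_size:
  assumes "ptime H r f" "ptime H' (Suc r) (\<lambda>A e. g A (e 0) (\<lambda>i. e (Suc i)))"
    and "\<And>A e. H' A (case_nat (f A e) e) \<le> H A e"
  shows "ptime H r (\<lambda>A e. g A (f A e) e)"
proof -
  obtain C1 T1 where 1: "computes C1 r f T1" "polybd H r T1" "polybd H r f"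
    using assms(1) unfolding ptime_def by blast
  obtain C2 T2 where 2: "computes C2 (Suc r) (\<lambda>A e. g A (e 0) (\<lambda>i. e (Suc i))) T2"
    "polybd H' (Suc r) T2"
    "polybd H' (Suc r) (\<lambda>A e. g A (e 0) (\<lambda>i. e (Suc i)))"
    using assms(2) unfolding ptime_def by blast
  have "ptime H r (\<lambda>A e. (\<lambda>A e. g A (e 0) (\<lambda>i. e (Suc i))) A (case_nat (f A e) e))"
    by (rule ptimeI[OF computes_let[OF 1(1) 2(1)]
            polybd_add[OF polybd_add[OF 1(2) polybd_push[OF 1(3) 2(2) assms(3)]] polybd_const]
            polybd_push[OF 1(3) 2(3) assms(3)]])
  then show ?thesis by simp
qed

lemma ptime_let:
  assumes "ptime H r f" "ptime (\<lambda>A e. H A (\<lambda>i. e (Suc i))) (Suc r) (\<lambda>A e. g A (e 0) (\<lambda>i. e (Suc i)))"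
  shows "ptime H r (\<lambda>A e. g A (f A e) e)"
  by (rule ptime_let_size[OF assms]) simp

lemma ptime_rename:
  assumes "ptime H q F" "\<And>i. i < q \<Longrightarrow> p i < r"
  shows "ptime (\<lambda>A e. H A (\<lambda>i. e (p i))) r (\<lambda>A e. F A (\<lambda>i. e (p i)))"
proof -
  obtain C T where 1: "computes C q F T" "polybd H q T" "polybd H q F"
    using assms(1) unfolding ptime_def by blast
  show ?thesis
    by (rule ptimeI[OF computes_rename[OF 1(1)]]; (rule polybd_rename)?)
      (use 1 assms(2) in auto)
qed

lemma ptime_shift: "ptime H r F \<Longrightarrow> ptime (\<lambda>A e. H A (\<lambda>i. e (Suc i))) (Suc r) (\<lambda>A e. F A (\<lambda>i. e (Suc i)))"
  by (rule ptime_rename) auto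

text \<open>The bounds on the accumulator and on the size of a round are required only for the
  values that the recursion really reaches; arbitrary values of the accumulator need not satisfy
  them.\<close>

lemma ptime_rec:
  assumes "ptime H r b" "ptime H r f"
    and "ptime H' (Suc (Suc r)) (\<lambda>A e. g A (e 0) (e (Suc 0)) (\<lambda>i. e (Suc (Suc i))))"
    and "polybd H r h"
    and "\<And>A e i. i \<le> f A e \<Longrightarrow> rec_nat (b A e) (\<lambda>i a. g A i a e) i \<le> h A e"
    and "\<And>A e i. i < f A e \<Longrightarrow>
           H' A (case_nat i (case_nat (rec_nat (b A e) (\<lambda>i a. g A i a e) i) e)) \<le> H A e"
  shows "ptime H r (\<lambda>A e. rec_nat (b A e) (\<lambda>i a. g A i a e) (f A e))"
proof -
  obtain C0 T0 where 0: "computes C0 r b T0" "polybd H r T0" "polybd H r b"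
    using assms(1) unfolding ptime_def by blast
  obtain C1 T1 where 1: "computes C1 r f T1" "polybd H r T1" "polybd H r f"
    using assms(2) unfolding ptime_def by blast
  obtain C2 T2 where 2: "computes C2 (Suc (Suc r)) (\<lambda>A e. g A (e 0) (e (Suc 0)) (\<lambda>i. e (Suc (Suc i)))) T2"
    "polybd H' (Suc (Suc r)) T2"
    using assms(3) unfolding ptime_def by blast
  have "polybd H r (\<lambda>A e. rec_nat (b A e) (\<lambda>i a. g A i a e) (f A e))"
    by (rule polybd_mono[OF assms(4)]) (use assms(5) in simp)
  moreover have "polybd H' (Suc (Suc r)) (\<lambda>A e. T2 A e + 10)"
    by (intro polybd_add 2 polybd_const)
  note polybd_sum[OF 1(3) assms(4) this, of "\<lambda>A e. rec_nat (b A e) (\<lambda>i a. g A i a e)"]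
  ultimately show ?thesis
    using computes_fold[OF 0(1) 1(1) 2(1)] assms(5,6)
    by (intro ptimeI[where T = "\<lambda>A e. T0 A e + T1 A e + 6 +
            (\<Sum>i<f A e. T2 A (case_nat i (case_nat (rec_nat (b A e) (\<lambda>i a. g A i a e) i) e)) + 10)"])
      (auto intro!: polybd_add 0 1 2 polybd_const)
qed

lemma ptime_sum [ptime_intros]:
  assumes "ptime H r f"
    and "ptime (\<lambda>A e. H A (\<lambda>i. e (Suc i))) (Suc r) (\<lambda>A e. g A (e 0) (\<lambda>i. e (Suc i)))"
  shows "ptime H r (\<lambda>A e. \<Sum>i<f A e. g A i e)"
proof -
  \<comment> \<open>A summand does not see the accumulator, so the renaming skips index 1.\<close>
  let ?p = "case_nat 0 (\<lambda>i. Suc (Suc i))"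
  have g2: "ptime (\<lambda>A e. H A (\<lambda>i. e (Suc (Suc i)))) (Suc (Suc r)) (\<lambda>A e. g A (e 0) (\<lambda>i. e (Suc (Suc i))))"
    using ptime_rename[OF assms(2), of ?p "Suc (Suc r)"] by (auto split: nat.splits)
  have rec: "rec_nat 0 (\<lambda>i a. a + g A i e) n = (\<Sum>i<n. g A i e)" for A e n
    by (induction n) auto
  have "polybd H r f" "polybd (\<lambda>A e. H A (\<lambda>i. e (Suc (Suc i)))) (Suc (Suc r)) (\<lambda>A e. g A (e 0) (\<lambda>i. e (Suc (Suc i))))"
    using assms(1) g2 unfolding ptime_def by blast+
  \<comment> \<open>The whole sum is polynomially bounded and dominates all partial sums, so it is
    the bound on the accumulator demanded by \<open>ptime_rec\<close>.\<close>
  from polybd_sum[OF this(1) polybd_const this(2), of "\<lambda>A e i. 0" 0]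
  have bd: "polybd H r (\<lambda>A e. \<Sum>i<f A e. g A i e)" by simp
  have "ptime H r (\<lambda>A e. rec_nat 0 (\<lambda>i a. a + g A i e) (f A e))"
  proof (rule ptime_rec[where b = "\<lambda>A e. 0" and f = f and g = "\<lambda>A i a e. a + g A i e", OF ptime_const assms(1) _ bd])
    show "ptime (\<lambda>A e. H A (\<lambda>i. e (Suc (Suc i)))) (Suc (Suc r))
        (\<lambda>A e. e (Suc 0) + g A (e 0) (\<lambda>i. e (Suc (Suc i))))"
      by (intro ptime_plus ptime_var g2) simp
    show "rec_nat 0 (\<lambda>i a. a + g A i e) i \<le> (\<Sum>i<f A e. g A i e)" if "i \<le> f A e" for A e i
      unfolding rec using that by (intro sum_mono2) auto
  qed simp
  then show ?thesis unfolding rec .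
qed

lemma pdec_less [ptime_intros]:
  assumes "ptime H r f" "ptime H r g"
  shows "pdec H r (\<lambda>A e. f A e < g A e)"
proof -
  have "ptime H r (\<lambda>A e. if f A e < g A e then 1 else 0)"
    by (rule ptime_if_less[OF assms ptime_const ptime_const]) (rule order_refl)+
  then show ?thesis unfolding pdec_def of_bool_def .
qed

lemma ptime_if [ptime_intros]:
  assumes "pdec H r P" "ptime H r f" "ptime H r g"
  shows "ptime H r (\<lambda>A e. if P A e then f A e else g A e)"
proof -
  have "ptime H r (\<lambda>A e. if 0 < (of_bool (P A e) :: nat) then f A e else g A e)"
    by (rule ptime_if_less[OF ptime_const assms(1)[unfolded pdec_def] assms(2,3)]) simp_all
  then show ?thesis by simp
qed

lemma pdec_not [ptime_intros]:
  assumes "pdec H r P"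
  shows "pdec H r (\<lambda>A e. \<not> P A e)"
proof -
  have "ptime H r (\<lambda>A e. if P A e then 0 else 1)"
    by (intro ptime_if assms ptime_const)
  moreover have "(\<lambda>A e. if P A e then 0 else 1 :: nat) = (\<lambda>A e. of_bool (\<not> P A e))"
    by (intro ext) simp
  ultimately show ?thesis unfolding pdec_def by simp
qed

lemma pdec_and [ptime_intros]:
  assumes "pdec H r P" "pdec H r Q"
  shows "pdec H r (\<lambda>A e. P A e \<and> Q A e)"
proof -
  have "ptime H r (\<lambda>A e. if P A e then of_bool (Q A e) else 0)"
    by (intro ptime_if assms[unfolded pdec_def] assms ptime_const)
  moreover have "(\<lambda>A e. if P A e then of_bool (Q A e) else 0 :: nat) = (\<lambda>A e. of_bool (P A e \<and> Q A e))"
    by (intro ext) simp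
  ultimately show ?thesis unfolding pdec_def by simp
qed

lemma pdec_cong: "pdec H r P \<Longrightarrow> (\<And>A e. P A e = Q A e) \<Longrightarrow> pdec H r Q"
  by (subgoal_tac "P = Q") (auto intro!: ext)

lemma pdec_imp [ptime_intros]: "pdec H r P \<Longrightarrow> pdec H r Q \<Longrightarrow> pdec H r (\<lambda>A e. P A e \<longrightarrow> Q A e)"
  by (rule pdec_cong[of _ _ "\<lambda>A e. \<not> (P A e \<and> \<not> Q A e)"]) (intro ptime_intros | simp)+

lemma pdec_iff [ptime_intros]: "pdec H r P \<Longrightarrow> pdec H r Q \<Longrightarrow> pdec H r (\<lambda>A e. P A e = Q A e)"
  by (rule pdec_cong[of _ _ "\<lambda>A e. (P A e \<longrightarrow> Q A e) \<and> (Q A e \<longrightarrow> P A e)"]) (intro ptime_intros | blast)+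

lemma pdec_eq [ptime_intros]: "ptime H r f \<Longrightarrow> ptime H r g \<Longrightarrow> pdec H r (\<lambda>A e. f A e = g A e)"
  by (rule pdec_cong[of _ _ "\<lambda>A e. \<not> f A e < g A e \<and> \<not> g A e < f A e"]) (intro ptime_intros | force)+

lemma pdec_le [ptime_intros]: "ptime H r f \<Longrightarrow> ptime H r g \<Longrightarrow> pdec H r (\<lambda>A e. f A e \<le> g A e)"
  by (rule pdec_cong[of _ _ "\<lambda>A e. \<not> g A e < f A e"]) (intro ptime_intros | force)+

lemma card_eq_sum_of_bool: "card {i. i < n \<and> P i} = (\<Sum>i<n. of_bool (P i))" for n :: nat
proof -
  have "{i. i < n \<and> P i} = {i \<in> {..<n}. P i}" by auto
  then show ?thesis by (simp add: sum.If_cases of_bool_def Int_def)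
qed

lemma ptime_card [ptime_intros]:
  assumes "ptime H r f"
    and "pdec (\<lambda>A e. H A (\<lambda>i. e (Suc i))) (Suc r) (\<lambda>A e. P A (e 0) (\<lambda>i. e (Suc i)))"
  shows "ptime H r (\<lambda>A e. card {i. i < f A e \<and> P A i e})"
  unfolding card_eq_sum_of_bool
  by (intro ptime_sum assms[unfolded pdec_def])

lemma pdec_ex [ptime_intros]:
  assumes "ptime H r f"
    and "pdec (\<lambda>A e. H A (\<lambda>i. e (Suc i))) (Suc r) (\<lambda>A e. P A (e 0) (\<lambda>i. e (Suc i)))"
  shows "pdec H r (\<lambda>A e. \<exists>i<f A e. P A i e)"
  by (rule pdec_cong[of _ _ "\<lambda>A e. 0 < card {i. i < f A e \<and> P A i e}"])
    (intro ptime_intros assms, auto simp: card_gt_0_iff)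

lemma pdec_all [ptime_intros]:
  assumes "ptime H r f"
    and "pdec (\<lambda>A e. H A (\<lambda>i. e (Suc i))) (Suc r) (\<lambda>A e. P A (e 0) (\<lambda>i. e (Suc i)))"
  shows "pdec H r (\<lambda>A e. \<forall>i<f A e. P A i e)"
  by (rule pdec_cong[of _ _ "\<lambda>A e. \<not> (\<exists>i<f A e. \<not> P A i e)"]) (intro ptime_intros assms, auto)

text \<open>A test for zero has a result of at most 1, so entries of any magnitude are harmless
  here. Using an entry as a number, as in \<open>ptime_input\<close>, requires the size to dominate
  it.\<close>

lemma pdec_input [ptime_intros]:
  assumes "ptime H r f"
  shows "pdec H r (\<lambda>A e. A (f A e) \<noteq> 0)"
proof -
  obtain C T where C: "computes C r f T" "polybd H r T"
    using assms unfolding ptime_def by blast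
  have "computes (\<lambda>\<rho> d. Seq (Assign (loc d) (Const 0)) (Seq (Seq (C \<rho> (Suc d)) (Assign (loc (Suc d)) (Elem ''in'' (Var (loc (Suc d))))))
      (Cond (BLess (Var (loc d)) (Var (loc (Suc d)))) (Assign (loc d) (Const 1)) (Assign (loc d) (Const 0))))) r
     (\<lambda>A e. if 0 < A (f A e) then 1 else 0) (\<lambda>A e. 2 + (T A e + 3) + 4 + (if 0 < A (f A e) then 2 else 2))"
    by (rule computes_if[OF computes_const computes_input[OF C(1)] computes_const computes_const])
  moreover have "polybd H r (\<lambda>A e. 2 + (T A e + 3) + 4 + (if 0 < A (f A e) then 2 else 2))"
    by (intro polybd_add polybd_const C polybd_max)
  moreover have "polybd H r (\<lambda>A e. if 0 < A (f A e) then 1 else 0)"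
    by (intro polybd_const polybd_max)
  ultimately have "ptime H r (\<lambda>A e. if 0 < A (f A e) then 1 else 0)"
    by (rule ptimeI)
  then show ?thesis by (simp add: pdec_def of_bool_def)
qed

lemma ptime_input:
  assumes "ptime H r f" "\<And>A e. A (f A e) \<le> H A e"
  shows "ptime H r (\<lambda>A e. A (f A e))"
proof -
  obtain C T where C: "computes C r f T" "polybd H r T"
    using assms(1) unfolding ptime_def by blast
  show ?thesis
    by (rule ptimeI[OF computes_input[OF C(1)] polybd_add[OF C(2) polybd_const]
          polybd_mono[OF polybd_size assms(2)]])
qed

text \<open>Substitution by nested bindings. The value bound last has index 0, hence the reversal
  \<open>\<lambda>i. 1 - i\<close>. The base function must have size 0, that is, be polynomial in
  its own arguments; then it can be used under every size.\<close>

lemma ptime_comp2: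
  assumes G: "ptime (\<lambda>A e. 0) 2 (\<lambda>A e. G A (e 0) (e (Suc 0)))"
    and "ptime H r a" "ptime H r b"
  shows "ptime H r (\<lambda>A e. G A (a A e) (b A e))"
proof -
  have "ptime (\<lambda>A e. 0) (Suc (Suc r)) (\<lambda>A e. G A (e (Suc 0)) (e 0))"
    using ptime_rename[OF G, of "\<lambda>i. 1 - i" "Suc (Suc r)"] by simp
  from ptime_weaken_size[OF this]
  have "ptime (\<lambda>A e. H A (\<lambda>i. e (Suc i))) (Suc r) (\<lambda>A e. G A (e 0) (b A (\<lambda>i. e (Suc i))))"
    by (intro ptime_let[where g = "\<lambda>A y e. G A (e 0) y", OF ptime_shift[OF assms(3)]])
  then show ?thesis
    by (intro ptime_let[where g = "\<lambda>A x e. G A x (b A e)", OF assms(2)])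
qed

lemma ptime_comp3:
  assumes G: "ptime (\<lambda>A e. 0) 3 (\<lambda>A e. G A (e 0) (e (Suc 0)) (e (Suc (Suc 0))))"
    and "ptime H r a" "ptime H r b" "ptime H r c"
  shows "ptime H r (\<lambda>A e. G A (a A e) (b A e) (c A e))"
proof -
  have "ptime (\<lambda>A e. 0) (Suc (Suc (Suc r))) (\<lambda>A e. G A (e (Suc (Suc 0))) (e (Suc 0)) (e 0))"
    using ptime_rename[OF G, of "\<lambda>i. Suc (Suc 0) - i" "Suc (Suc (Suc r))"] by simp
  from ptime_weaken_size[OF this]
  have "ptime (\<lambda>A e. H A (\<lambda>i. e (Suc (Suc i)))) (Suc (Suc r))
      (\<lambda>A e. G A (e (Suc 0)) (e 0) (c A (\<lambda>i. e (Suc (Suc i)))))"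
    by (intro ptime_let[where g = "\<lambda>A y e. G A (e (Suc 0)) (e 0) y",
          OF ptime_shift[OF ptime_shift[OF assms(4)]]])
  then have "ptime (\<lambda>A e. H A (\<lambda>i. e (Suc i))) (Suc r)
      (\<lambda>A e. G A (e 0) (b A (\<lambda>i. e (Suc i))) (c A (\<lambda>i. e (Suc i))))"
    by (intro ptime_let[where g = "\<lambda>A y e. G A (e 0) y (c A (\<lambda>i. e (Suc i)))",
          OF ptime_shift[OF assms(3)]])
  then show ?thesis
    by (intro ptime_let[where g = "\<lambda>A x e. G A x (b A e) (c A e)", OF assms(2)])
qed

lemma ptime_comp4:
  assumes G: "ptime (\<lambda>A e. 0) 4 (\<lambda>A e. G A (e 0) (e (Suc 0)) (e (Suc (Suc 0))) (e (Suc (Suc (Suc 0)))))"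
    and "ptime H r a" "ptime H r b" "ptime H r c" "ptime H r d"
  shows "ptime H r (\<lambda>A e. G A (a A e) (b A e) (c A e) (d A e))"
proof -
  have "ptime (\<lambda>A e. 0) (Suc (Suc (Suc (Suc r))))
      (\<lambda>A e. G A (e (Suc (Suc (Suc 0)))) (e (Suc (Suc 0))) (e (Suc 0)) (e 0))"
    using ptime_rename[OF G, of "\<lambda>i. Suc (Suc (Suc 0)) - i" "Suc (Suc (Suc (Suc r)))"]
    by simp
  from ptime_weaken_size[OF this]
  have "ptime (\<lambda>A e. H A (\<lambda>i. e (Suc (Suc (Suc i))))) (Suc (Suc (Suc r)))
      (\<lambda>A e. G A (e (Suc (Suc 0))) (e (Suc 0)) (e 0) (d A (\<lambda>i. e (Suc (Suc (Suc i))))))"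
    by (intro ptime_let[where g = "\<lambda>A y e. G A (e (Suc (Suc 0))) (e (Suc 0)) (e 0) y",
          OF ptime_shift[OF ptime_shift[OF ptime_shift[OF assms(5)]]]])
  then have "ptime (\<lambda>A e. H A (\<lambda>i. e (Suc (Suc i)))) (Suc (Suc r))
      (\<lambda>A e. G A (e (Suc 0)) (e 0) (c A (\<lambda>i. e (Suc (Suc i)))) (d A (\<lambda>i. e (Suc (Suc i)))))"
    by (intro ptime_let[where g = "\<lambda>A y e. G A (e (Suc 0)) (e 0) y (d A (\<lambda>i. e (Suc (Suc i))))",
          OF ptime_shift[OF ptime_shift[OF assms(4)]]])
  then have "ptime (\<lambda>A e. H A (\<lambda>i. e (Suc i))) (Suc r)
      (\<lambda>A e. G A (e 0) (b A (\<lambda>i. e (Suc i))) (c A (\<lambda>i. e (Suc i))) (d A (\<lambda>i. e (Suc i))))"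
    by (intro ptime_let[where g = "\<lambda>A y e. G A (e 0) y (c A (\<lambda>i. e (Suc i))) (d A (\<lambda>i. e (Suc i)))",
          OF ptime_shift[OF assms(3)]])
  then show ?thesis
    by (intro ptime_let[where g = "\<lambda>A x e. G A x (b A e) (c A e) (d A e)", OF assms(2)])
qed

section \<open>Arithmetic by bounded sums and counting\<close>

lemma ptime_mult_base: "ptime (\<lambda>A e. 0) 2 (\<lambda>A e. e 0 * e (Suc 0))"
proof -
  have "ptime (\<lambda>A e. 0) 2 (\<lambda>A e. \<Sum>i<e 0. e (Suc 0))"
    by (intro ptime_intros) auto
  then show ?thesis by simp
qed

lemma ptime_mult [ptime_intros]:
  "ptime H r f \<Longrightarrow> ptime H r g \<Longrightarrow> ptime H r (\<lambda>A e. f A e * g A e)"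
  by (rule ptime_comp2[where G = "\<lambda>A x y. x * y", OF ptime_mult_base])

text \<open>Counting the positive multiples of \<open>n\<close> up to \<open>x\<close> reduces
  division to the closure under counting. Such unary arithmetic is affordable because the bounds
  refer to the values of the arguments, not to their lengths.\<close>

lemma div_eq_card: "x div n = (if n = 0 then 0 else card {i. i < x \<and> Suc i * n \<le> x})" for x n :: nat
proof (cases "n = 0")
  case False
  have "{i. i < x \<and> Suc i * n \<le> x} = {..<x div n}"
  proof (intro equalityI subsetI)
    fix i assume "i \<in> {i. i < x \<and> Suc i * n \<le> x}"
    then have "Suc i * n div n \<le> x div n" by (intro div_le_mono) auto
    then show "i \<in> {..<x div n}" using False by simp
  next
    fix i assume "i \<in> {..<x div n}"
    then have "Suc i \<le> x div n" by simp
    then have "Suc i * n \<le> x" using False by (simp add: less_eq_div_iff_mult_less_eq)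
    moreover have "Suc i \<le> x" using \<open>Suc i \<le> x div n\<close> div_le_dividend le_trans by blast
    ultimately show "i \<in> {i. i < x \<and> Suc i * n \<le> x}" by auto
  qed
  then show ?thesis using False by simp
qed simp

lemma ptime_div_base: "ptime (\<lambda>A e. 0) 2 (\<lambda>A e. e 0 div e (Suc 0))"
  unfolding div_eq_card by (intro ptime_intros) auto

lemma ptime_div [ptime_intros]:
  "ptime H r f \<Longrightarrow> ptime H r g \<Longrightarrow> ptime H r (\<lambda>A e. f A e div g A e)"
  by (rule ptime_comp2[where G = "\<lambda>A x y. x div y", OF ptime_div_base])

definition digit :: "nat \<Rightarrow> nat \<Rightarrow> nat \<Rightarrow> nat" where
  "digit N x i = x div N ^ i mod N"

text \<open>The power \<open>N ^ i\<close> is not polynomial in the arguments, so it is never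
  formed: dividing by \<open>N\<close> repeatedly keeps all intermediate values at most
  \<open>x\<close>.\<close>

lemma ptime_digit_base: "ptime (\<lambda>A e. 0) 3 (\<lambda>A e. digit (e 0) (e (Suc 0)) (e (Suc (Suc 0))))"
proof -
  have rec: "rec_nat x (\<lambda>i a. a div N) n = x div N ^ n" for x N n :: nat
    by (induction n) (auto simp: div_mult2_eq[symmetric] mult.commute)
  have d: "ptime (\<lambda>A e. 0) 3 (\<lambda>A e. e (Suc 0) div e 0 ^ e (Suc (Suc 0)))"
    unfolding rec[symmetric]
    by (rule ptime_rec[where h = "\<lambda>A e. e (Suc 0)" and H' = "\<lambda>A e. 0" and g = "\<lambda>A i a e. a div e 0"])
      ((intro ptime_intros polybd_var; simp)+, simp_all add: rec)
  have "ptime (\<lambda>A e. 0) 3 (\<lambda>A e. e (Suc 0) div e 0 ^ e (Suc (Suc 0)) -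
     e 0 * (e (Suc 0) div e 0 ^ e (Suc (Suc 0)) div e 0))"
    by (intro ptime_intros d) auto
  then show ?thesis unfolding digit_def minus_mult_div_eq_mod .
qed

lemma ptime_digit [ptime_intros]:
  "ptime H r f \<Longrightarrow> ptime H r g \<Longrightarrow> ptime H r h \<Longrightarrow> ptime H r (\<lambda>A e. digit (f A e) (g A e) (h A e))"
  by (rule ptime_comp3[where G = "\<lambda>A x y z. digit x y z", OF ptime_digit_base])

lemma ptime_power:
  assumes "ptime H r f" "ptime H r g" "\<And>A e. f A e ^ g A e \<le> H A e"
  shows "ptime H r (\<lambda>A e. f A e ^ g A e)"
proof -
  have rec: "rec_nat 1 (\<lambda>i a. a * N) n = N ^ n" for N n :: nat
    by (induction n) (auto simp: mult.commute)
  show ?thesis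
    unfolding rec[symmetric]
  \<comment> \<open>The summand 1 in the bound covers base 0, where the initial accumulator 1 may
    exceed the final power.\<close>
  proof (rule ptime_rec[where b = "\<lambda>A e. 1" and f = g and h = "\<lambda>A e. H A e + 1" and g = "\<lambda>A i a e. a * f A e", OF ptime_const assms(2)])
    show "ptime (\<lambda>A e. H A (\<lambda>i. e (Suc (Suc i)))) (Suc (Suc r))
         (\<lambda>A e. e (Suc 0) * f A (\<lambda>i. e (Suc (Suc i))))"
      by (rule ptime_mult[OF ptime_var ptime_shift[OF ptime_shift[OF assms(1)]]]) simp
    show "polybd H r (\<lambda>A e. H A e + 1)"
      by (intro polybd_add polybd_size polybd_const)
    show "rec_nat 1 (\<lambda>i a. a * f A e) i \<le> H A e + 1" if "i \<le> g A e" for A e i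
    proof (cases "f A e = 0")
      case False
      then have "f A e ^ i \<le> f A e ^ g A e" using that by (intro power_increasing) auto
      with assms(3)[of A e] show ?thesis unfolding rec by linarith
    qed (cases i; simp)
  qed simp
qed

section \<open>The deficiency version of Hall's theorem\<close>

text \<open>As long as some \<open>a\<close> has two neighbours, submodularity shows that one of the two edges can be
  removed without destroying the condition.\<close>

lemma deficiency_matching:
  fixes r :: "'a \<Rightarrow> 'b \<Rightarrow> bool"
  assumes "finite A" "finite B"
    and "\<And>X. X \<subseteq> A \<Longrightarrow> t \<le> card (A - X) + card {b\<in>B. \<exists>a\<in>X. r a b}"
  shows "\<exists>R f. R \<subseteq> A \<and> inj_on f R \<and> (\<forall>a\<in>R. f a \<in> B \<and> r a (f a)) \<and> t \<le> card R"
  using assms(3)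
proof (induction "card {(a, b). a \<in> A \<and> b \<in> B \<and> r a b}" arbitrary: r rule: less_induct)
  case less
  let ?N = "\<lambda>r X. {b\<in>B. \<exists>a\<in>X. r a b}"
  have fin: "finite {(a, b). a \<in> A \<and> b \<in> B \<and> r a b}"
    by (rule finite_subset[of _ "A \<times> B"]) (use assms in auto)
  show ?case
  proof (cases "\<exists>a\<in>A. \<exists>b\<in>B. \<exists>c\<in>B. b \<noteq> c \<and> r a b \<and> r a c")
    case True
    then obtain a b c where abc: "a \<in> A" "b \<in> B" "c \<in> B" "b \<noteq> c" "r a b" "r a c" by blast
    define s where "s = (\<lambda>b x y. r x y \<and> (x, y) \<noteq> (a, b))"
    have smaller: "card {(x, y). x \<in> A \<and> y \<in> B \<and> s b x y} < card {(a, b). a \<in> A \<and> b \<in> B \<and> r a b}"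
      if "b \<in> B" "r a b" for b
      by (rule psubset_card_mono[OF fin]) (use that abc in \<open>auto simp: s_def\<close>)
    have IH: ?thesis if h: "b \<in> B" "r a b" "\<And>X. X \<subseteq> A \<Longrightarrow> t \<le> card (A - X) + card (?N (s b) X)" for b
    proof -
      obtain R f where "R \<subseteq> A" "inj_on f R" "\<forall>a\<in>R. f a \<in> B \<and> s b a (f a)" "t \<le> card R"
        using less.hyps[OF smaller[OF h(1,2)] h(3)] by blast
      then show ?thesis by (intro exI[of _ R] exI[of _ f]) (auto simp: s_def)
    qed
    show ?thesis
    proof (rule ccontr)
      assume no: "\<not> ?thesis"
      obtain X where X: "X \<subseteq> A" "card (A - X) + card (?N (s b) X) < t"
        using IH[OF abc(2,5)] no not_le by blast
      obtain Y where Y: "Y \<subseteq> A" "card (A - Y) + card (?N (s c) Y) < t"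
        using IH[OF abc(3,6)] no not_le by blast
      \<comment> \<open>A set violating the condition after an edge at \<open>a\<close> was removed
        contains \<open>a\<close>, since the neighbourhoods of other sets are unchanged.\<close>
      have mem: "a \<in> Z" if Z: "Z \<subseteq> A" "card (A - Z) + card (?N (s d) Z) < t" for Z d
      proof (rule ccontr)
        assume "a \<notin> Z"
        then have "?N (s d) Z = ?N r Z" by (auto simp: s_def)
        then show False using less.prems[OF Z(1)] Z(2) by simp
      qed
      have a: "a \<in> X" "a \<in> Y" using mem X Y by blast+
      have finAB: "finite (A - Z)" "finite {b\<in>B. Q b}" for Z Q using assms by auto
      \<comment> \<open>No neighbour is lost in the union: each of the two edges at \<open>a\<close>
        is still present where the other one was removed.\<close>
      have "?N r (X \<union> Y) = ?N (s b) X \<union> ?N (s c) Y"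
        using a abc by (auto simp: s_def)
      moreover have "?N r (X \<inter> Y - {a}) \<subseteq> ?N (s b) X \<inter> ?N (s c) Y"
        by (auto simp: s_def)
      then have "card (?N r (X \<inter> Y - {a})) \<le> card (?N (s b) X \<inter> ?N (s c) Y)"
        by (rule card_mono[rotated]) (use finAB in auto)
      ultimately have N: "card (?N r (X \<union> Y)) + card (?N r (X \<inter> Y - {a})) \<le> card (?N (s b) X) + card (?N (s c) Y)"
        using card_Un_Int[OF finAB(2) finAB(2), of "\<lambda>y. \<exists>x\<in>X. s b x y" "\<lambda>y. \<exists>x\<in>Y. s c x y"] by simp
      \<comment> \<open>Taking \<open>a\<close> out of the intersection costs one. The two strict
        violations leave a slack of two, so the condition for \<open>X \<union> Y\<close> and for
        \<open>X \<inter> Y - {a}\<close> cannot hold together.\<close>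
      have "A - (X \<inter> Y - {a}) = insert a ((A - X) \<union> (A - Y))" using a abc by auto
      then have "card (A - (X \<inter> Y - {a})) = Suc (card ((A - X) \<union> (A - Y)))"
        using a finAB by simp
      moreover have "A - (X \<union> Y) = (A - X) \<inter> (A - Y)" by auto
      ultimately have "card (A - (X \<union> Y)) + card (A - (X \<inter> Y - {a})) = Suc (card (A - X) + card (A - Y))"
        using card_Un_Int[OF finAB(1) finAB(1), of X Y] by simp
      moreover have "t \<le> card (A - (X \<union> Y)) + card (?N r (X \<union> Y))"
        using X Y by (intro less.prems) auto
      moreover have "t \<le> card (A - (X \<inter> Y - {a})) + card (?N r (X \<inter> Y - {a}))"
        using X Y by (intro less.prems) auto
      ultimately show False using N X(2) Y(2) by linarith
    qed
  next
    case False
    let ?M = "?N r A"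
    \<comment> \<open>Now every \<open>a\<close> has at most one neighbour, so any choice of a
      partner for each covered \<open>b\<close> is injective, and the condition for
      \<open>X = A\<close> says that at least \<open>t\<close> vertices are covered.\<close>
    define g where "g = (\<lambda>b. SOME a. a \<in> A \<and> r a b)"
    have g: "g b \<in> A \<and> r (g b) b" if "b \<in> ?M" for b
      using someI_ex[of "\<lambda>a. a \<in> A \<and> r a b"] that by (auto simp: g_def)
    have inj: "inj_on g ?M"
    proof (rule inj_onI)
      fix b c assume *: "b \<in> ?M" "c \<in> ?M" "g b = g c"
      show "b = c" using g[OF *(1)] g[OF *(2)] * False by auto
    qed
    have "t \<le> card ?M" using less.prems[of A] by simp
    moreover have "card (g ` ?M) = card ?M" by (rule card_image[OF inj])
    moreover have "inv_into ?M g a \<in> B \<and> r a (inv_into ?M g a)" if a: "a \<in> g ` ?M" for a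
      using inv_into_into[OF a] g[OF inv_into_into[OF a]] f_inv_into_f[OF a] by auto
    moreover have "g ` ?M \<subseteq> A" using g by blast
    ultimately show ?thesis
      by (intro exI[of _ "g ` ?M"] exI[of _ "inv_into ?M g"] conjI ballI inj_on_inv_into order_refl) simp_all
  qed
qed

section \<open>Stars\<close>

lemma simple_graph_edge:
  assumes "simple_graph G" "{u, v} \<in> edges G"
  shows "u \<in> verts G" "v \<in> verts G" "u \<noteq> v"
proof -
  have "{u, v} \<subseteq> verts G" "card {u, v} = 2" using assms by (auto simp: simple_graph_def)
  then show "u \<in> verts G" "v \<in> verts G" "u \<noteq> v" by auto
qed

lemma nontrivial_star_adjacent_or_common:
  assumes S: "nontrivial_star S" and uv: "u \<in> verts S" "v \<in> verts S" "u \<noteq> v"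
  shows "{u, v} \<in> edges S \<or> (\<exists>x\<in>verts S. {u, x} \<in> edges S \<and> {x, v} \<in> edges S)"
proof -
  have fin: "finite (verts S)" and con: "graph_connected S" and diam: "graph_diameter S \<le> 2"
    using S by (auto simp: nontrivial_star_def graph_tree_def simple_graph_def)
  let ?D = "\<lambda>d. \<exists>xs. walk S xs \<and> hd xs = u \<and> last xs = v \<and> length xs = Suc d"
  obtain xs where "walk S xs" "hd xs = u" "last xs = v"
    using con uv by (auto simp: graph_connected_def)
  then have "?D (length xs - 1)" by (intro exI[of _ xs]) (auto simp: walk_def)
  then have ex: "?D (graph_dist S u v)" unfolding graph_dist_def by (rule LeastI[of ?D])
  have "finite {graph_dist S u v | u v. u \<in> verts S \<and> v \<in> verts S}"
    using finite_image_set2[of "\<lambda>u. u \<in> verts S" "\<lambda>u. u \<in> verts S" "graph_dist S"] fin by simp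
  then have "graph_dist S u v \<le> graph_diameter S"
    unfolding graph_diameter_def using uv by (intro Max_ge) auto
  with diam have le: "graph_dist S u v \<le> 2" by linarith
  obtain ys where ys: "walk S ys" "hd ys = u" "last ys = v" "length ys = Suc (graph_dist S u v)"
    using ex by blast
  consider "length ys = Suc 0" | "length ys = Suc (Suc 0)" | "length ys = Suc (Suc (Suc 0))"
    using ys(4) le by linarith
  then show ?thesis
  proof cases
    case 1
    then show ?thesis using ys uv by (auto simp: length_Suc_conv)
  next
    case 2
    then show ?thesis using ys uv by (auto simp: length_Suc_conv walk_def)
  next
    case 3
    then show ?thesis using ys uv by (auto simp: length_Suc_conv walk_def)
  qed
qed

text \<open>A vertex \<open>c\<close> with two neighbours is adjacent to everything: a vertex
  \<open>w\<close> at distance two, reached through \<open>x\<close>, would close a cycle of length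
  at most 5 with a second neighbour \<open>y'\<close> of \<open>c\<close>, as \<open>y'\<close> and
  \<open>w\<close> are also at distance at most two. If no vertex has two neighbours, common
  neighbours do not exist, any two vertices are adjacent, and every vertex can serve as the
  centre.\<close>

lemma nontrivial_star_center:
  assumes S: "nontrivial_star S"
  shows "\<exists>c\<in>verts S. \<forall>v\<in>verts S - {c}. {c, v} \<in> edges S"
proof -
  have sg: "simple_graph S" and nocyc: "\<not> graph_cycle S xs" and card: "card (verts S) \<ge> 2" for xs
    using S by (auto simp: nontrivial_star_def graph_tree_def)
  note E = simple_graph_edge[OF sg]
  note D = nontrivial_star_adjacent_or_common[OF S]
  have sym: "{u, v} \<in> edges S \<Longrightarrow> {v, u} \<in> edges S" for u v by (simp add: insert_commute)
  have c3: False if "{a, b} \<in> edges S" "{b, c} \<in> edges S" "{c, a} \<in> edges S" for a b c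
    using nocyc[of "[a, b, c]"] that E[OF that(1)] E[OF that(2)] E[OF that(3)]
    by (auto simp: graph_cycle_def walk_def)
  have c4: False if "{a, b} \<in> edges S" "{b, c} \<in> edges S" "{c, d} \<in> edges S" "{d, a} \<in> edges S"
      "a \<noteq> c" "b \<noteq> d" for a b c d
    using nocyc[of "[a, b, c, d]"] that E[OF that(1)] E[OF that(2)] E[OF that(3)] E[OF that(4)]
    by (auto simp: graph_cycle_def walk_def)
  have c5: False if "{a, b} \<in> edges S" "{b, c} \<in> edges S" "{c, d} \<in> edges S" "{d, e} \<in> edges S"
      "{e, a} \<in> edges S" "distinct [a, b, c, d, e]" for a b c d e
    using nocyc[of "[a, b, c, d, e]"] that E[OF that(1)] E[OF that(2)] E[OF that(3)] E[OF that(4)]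
    by (auto simp: graph_cycle_def walk_def)
  show ?thesis
  proof (cases "\<exists>c y z. y \<noteq> z \<and> {c, y} \<in> edges S \<and> {c, z} \<in> edges S")
    case True
    then obtain c y z where c: "y \<noteq> z" "{c, y} \<in> edges S" "{c, z} \<in> edges S" by blast
    have "{c, w} \<in> edges S" if w: "w \<in> verts S" "w \<noteq> c" for w
    proof (rule ccontr)
      assume no: "{c, w} \<notin> edges S"
      obtain x where x: "{c, x} \<in> edges S" "{x, w} \<in> edges S"
        using D[of c w] w no E[OF c(2)] by blast
      obtain y' where y': "{c, y'} \<in> edges S" "y' \<noteq> x" using c by metis
      have "y' \<noteq> w" using no y' by auto
      show False
      proof (cases "{y', w} \<in> edges S")
        case True
        then show False
          using c4[of c x w y'] x y' w sym by blast
      next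
        case False
        then obtain u where u: "{y', u} \<in> edges S" "{u, w} \<in> edges S"
          using D[of y' w] \<open>y' \<noteq> w\<close> w E(2)[OF y'(1)] by blast
        have "u \<noteq> c" using u no by auto
        moreover have "u \<noteq> x" using c3[of c x y'] x y' u sym by blast
        ultimately have "distinct [c, x, w, u, y']"
          using E[OF x(1)] E[OF x(2)] E[OF u(1)] E[OF u(2)] E[OF y'(1)] y' w \<open>y' \<noteq> w\<close> by auto
        then show False using c5[of c x w u y'] x u y' sym by blast
      qed
    qed
    then show ?thesis using E[OF c(2)] by blast
  next
    case False
    obtain a b where ab: "a \<in> verts S" "b \<in> verts S" "a \<noteq> b"
      using card by (metis card_2_iff' obtain_subset_with_card_n subset_iff)
    have adj: "{u, v} \<in> edges S" if "u \<in> verts S" "v \<in> verts S" "u \<noteq> v" for u v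
      using D[OF that] False sym that by metis
    then show ?thesis using ab by blast
  qed
qed

definition star_graph :: "'a \<Rightarrow> 'a set \<Rightarrow> 'a graph" where
  "star_graph c L = Graph (insert c L) ((\<lambda>l. {c, l}) ` L)"

lemma star_graph_simps [simp]:
  "verts (star_graph c L) = insert c L"
  "edges (star_graph c L) = (\<lambda>l. {c, l}) ` L"
  by (simp_all add: star_graph_def)

lemma nontrivial_star_star_graph:
  assumes L: "finite L" "L \<noteq> {}" "c \<notin> L"
  shows "nontrivial_star (star_graph c L)"
proof -
  let ?G = "star_graph c L"
  have edge: "{u, v} \<in> edges ?G \<longleftrightarrow> u = c \<and> v \<in> L \<or> v = c \<and> u \<in> L" for u v
    by (auto simp: doubleton_eq_iff)
  have walk: "\<exists>xs. walk ?G xs \<and> hd xs = u \<and> last xs = v \<and> (\<exists>d\<le>2. length xs = Suc d)"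
    if uv: "u \<in> verts ?G" "v \<in> verts ?G" for u v
  proof -
    consider "u = v" | "u \<noteq> v" "u = c \<or> v = c" | "u \<noteq> v" "u \<noteq> c" "v \<noteq> c" by blast
    then show ?thesis
    proof cases
      case 1
      then show ?thesis using uv by (intro exI[of _ "[u]"]) (auto simp: walk_def)
    next
      case 2
      then show ?thesis using uv edge[of u v]
        by (intro exI[of _ "[u, v]"] conjI exI[of _ 1]) (auto simp: walk_def)
    next
      case 3
      then show ?thesis using uv edge[of u c] edge[of c v]
        by (intro exI[of _ "[u, c, v]"] conjI exI[of _ 2]) (auto simp: walk_def)
    qed
  qed
  have simple: "simple_graph ?G" using L by (auto simp: simple_graph_def card_insert_if)
  have conn: "graph_connected ?G"
    unfolding graph_connected_def using walk by (auto simp del: star_graph_simps(2))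
  have nocyc: "\<not> graph_cycle ?G xs" for xs
  proof
    assume cyc: "graph_cycle ?G xs"
    then obtain a b d ys where xs: "xs = a # b # d # ys"
      by (auto simp: graph_cycle_def numeral_3_eq_3 Suc_le_length_iff)
    have "{a, b} \<in> edges ?G" "{b, d} \<in> edges ?G" "distinct (a # b # d # ys)"
      "{last xs, a} \<in> edges ?G" "ys \<noteq> [] \<Longrightarrow> {d, hd ys} \<in> edges ?G"
      using cyc unfolding graph_cycle_def walk_def xs by (cases ys; simp)+
    \<comment> \<open>The vertex \<open>b\<close> must be the centre, since otherwise both
      \<open>a\<close> and \<open>d\<close> would be. Then \<open>a\<close> is a leaf, so the last
      vertex would also be the centre.\<close>
    then show False unfolding edge xs using L by (cases ys) auto
  qed
  have "graph_diameter ?G \<le> 2"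
    unfolding graph_diameter_def
  proof (rule Max.boundedI)
    show "finite {graph_dist ?G u v | u v. u \<in> verts ?G \<and> v \<in> verts ?G}"
      using finite_image_set2[of "\<lambda>u. u \<in> verts ?G" "\<lambda>u. u \<in> verts ?G" "graph_dist ?G"] L by simp
    show "{graph_dist ?G u v | u v. u \<in> verts ?G \<and> v \<in> verts ?G} \<noteq> {}" by auto
    fix d assume "d \<in> {graph_dist ?G u v | u v. u \<in> verts ?G \<and> v \<in> verts ?G}"
    then obtain u v where uv: "d = graph_dist ?G u v" "u \<in> verts ?G" "v \<in> verts ?G" by blast
    obtain xs d' where "walk ?G xs" "hd xs = u" "last xs = v" "d' \<le> 2" "length xs = Suc d'"
      using walk[OF uv(2,3)] by blast
    then have "graph_dist ?G u v \<le> d'" unfolding graph_dist_def by (intro Least_le) blast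
    then show "d \<le> 2" using uv \<open>d' \<le> 2\<close> by simp
  qed
  moreover have "card (verts ?G) \<ge> 2"
    using L by (simp add: Suc_le_eq card_gt_0_iff)
  ultimately show ?thesis
    using simple conn nocyc by (auto simp: nontrivial_star_def graph_tree_def)
qed

section \<open>Common star forests and matchings\<close>

text \<open>The \<open>j\<close>-th star has the centre \<open>xs (2 * j)\<close> and the distinguished leaf \<open>xs (2 * j + 1)\<close>.\<close>

definition star_roots :: "(nat \<Rightarrow> nat \<Rightarrow> bool) \<Rightarrow> nat \<Rightarrow> nat \<Rightarrow> (nat \<Rightarrow> nat) \<Rightarrow> bool" where
  "star_roots a n m xs \<longleftrightarrow> (\<forall>i<2*m. xs i < n) \<and> (\<forall>i<2*m. \<forall>j<i. xs i \<noteq> xs j) \<and>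
     (\<forall>j<m. a (xs (2*j)) (xs (2*j+1)))"

definition free_count :: "(nat \<Rightarrow> nat \<Rightarrow> bool) \<Rightarrow> nat \<Rightarrow> nat \<Rightarrow> (nat \<Rightarrow> nat) \<Rightarrow> (nat \<Rightarrow> bool) \<Rightarrow> nat" where
  "free_count a n m xs P = card {v. v < n \<and> (\<forall>i<2*m. xs i \<noteq> v) \<and> (\<exists>j<m. P j \<and> a (xs (2*j)) v)}"

definition adj :: "nat graph \<Rightarrow> nat \<Rightarrow> nat \<Rightarrow> bool" where
  "adj G u v \<longleftrightarrow> {u, v} \<in> edges G"

lemma star_roots_inj_on: "star_roots a n m xs \<Longrightarrow> inj_on xs {..<2*m}"
  unfolding star_roots_def inj_on_def by (metis lessThan_iff linorder_neqE_nat)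

lemma index_parity_cases:
  fixes i m :: nat
  assumes "i < 2 * m"
  obtains j where "j < m" "i = 2 * j" | j where "j < m" "i = 2 * j + 1"
proof (cases "even i")
  case True
  then show ?thesis using assms that(1)[of "i div 2"] by auto
next
  case False
  then show ?thesis using assms that(2)[of "i div 2"] by (auto elim!: oddE)
qed

text \<open>The forest is built inside \<open>G1\<close>, so its first embedding is the identity;
  the matching supplies the second one. Hypothesis \<open>t\<close> is the inequality half of the
  deficiency formula, for every set \<open>P\<close> of stars.\<close>

lemma common_star_forest_of_star_roots:
  assumes G: "input_graph G1" "input_graph G2"
    and x: "star_roots (adj G1) (card (verts G1)) m xs" and y: "star_roots (adj G2) (card (verts G2)) m ys"
    and t: "\<And>P. t \<le> 2 * m + free_count (adj G1) (card (verts G1)) m xs P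
              + free_count (adj G2) (card (verts G2)) m ys (\<lambda>j. \<not> P j)"
  shows "\<exists>H. common_star_forest G1 G2 H \<and> t \<le> card (verts H)"
proof -
  define n1 n2 where n: "n1 = card (verts G1)" "n2 = card (verts G2)"
  have V: "verts G1 = {..<n1}" "verts G2 = {..<n2}" using G by (auto simp: input_graph_def n)
  note x = x[folded n] and y = y[folded n] and t = t[folded n]
  define A where "A = {v. v < n1 \<and> (\<forall>i<2*m. xs i \<noteq> v)}"
  define B where "B = {v. v < n2 \<and> (\<forall>i<2*m. ys i \<noteq> v)}"
  define r where "r = (\<lambda>v w. \<exists>j<m. adj G1 (xs (2*j)) v \<and> adj G2 (ys (2*j)) w)"
  have fin: "finite A" "finite B" by (auto simp: A_def B_def)
  have ix: "inj_on xs {..<2*m}" and iy: "inj_on ys {..<2*m}" using x y star_roots_inj_on by blast+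
  have "t - 2 * m \<le> card (A - X) + card {w\<in>B. \<exists>v\<in>X. r v w}" if "X \<subseteq> A" for X
  proof -
    define P where "P = (\<lambda>j. \<not> (\<exists>v\<in>X. adj G1 (xs (2*j)) v))"
    have "free_count (adj G1) n1 m xs P \<le> card (A - X)"
      unfolding free_count_def by (intro card_mono) (auto simp: fin A_def P_def)
    moreover have "free_count (adj G2) n2 m ys (\<lambda>j. \<not> P j) \<le> card {w\<in>B. \<exists>v\<in>X. r v w}"
      unfolding free_count_def by (intro card_mono) (auto simp: fin(2), auto simp: B_def P_def r_def)
    ultimately show ?thesis using t[of P] by linarith
  qed
  from deficiency_matching[OF fin this]
  obtain R f where R: "R \<subseteq> A" "inj_on f R" "\<And>v. v \<in> R \<Longrightarrow> f v \<in> B \<and> r v (f v)" "t - 2 * m \<le> card R"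
    by blast
  have "\<forall>v\<in>R. \<exists>j. j < m \<and> adj G1 (xs (2*j)) v \<and> adj G2 (ys (2*j)) (f v)"
    using R(3) by (auto simp: r_def)
  \<comment> \<open>Several stars may allow the pair of \<open>v\<close> and \<open>f v\<close>;
    choosing one of them keeps the stars disjoint.\<close>
  then obtain g where g: "\<And>v. v \<in> R \<Longrightarrow> g v < m \<and> adj G1 (xs (2 * g v)) v \<and> adj G2 (ys (2 * g v)) (f v)"
    by metis
  define L where "L = (\<lambda>j. insert (xs (2*j+1)) {v\<in>R. g v = j})"
  define star where "star = (\<lambda>j. star_graph (xs (2*j)) (L j))"
  define H where "H = Graph (\<Union>S\<in>star ` {..<m}. verts S) (\<Union>S\<in>star ` {..<m}. edges S)"
  have finR: "finite R" using R(1) fin(1) finite_subset by blast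
  have Rx: "v \<noteq> xs i" if "v \<in> R" "i < 2 * m" for v i using that R(1) by (auto simp: A_def)
  have xeq: "xs i = xs j \<longleftrightarrow> i = j" if "i < 2*m" "j < 2*m" for i j
    using ix that by (auto simp: inj_on_def)
  have star: "nontrivial_star (star j)" if "j < m" for j
    unfolding star_def
    by (rule nontrivial_star_star_graph) (use that Rx[of _ "2*j"] finR in \<open>auto simp: L_def xeq\<close>)
  have disj: "disjnt (verts (star i)) (verts (star j))" if "i < m" "j < m" "i \<noteq> j" for i j
  proof -
    have "2 * i \<noteq> 2 * j + 1" "2 * j \<noteq> 2 * i + 1" by presburger+
    then show ?thesis
      using that Rx[of _ "2*i"] Rx[of _ "2*i+1"] Rx[of _ "2*j"] Rx[of _ "2*j+1"]
      by (auto simp: disjnt_def star_def L_def xeq)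
  qed
  have sf: "star_forest H"
    unfolding star_forest_def
    by (intro exI[of _ "star ` {..<m}"] conjI)
      (auto simp: H_def star pairwise_def intro!: disj)
  have vH: "verts H = xs ` {..<2*m} \<union> R"
  proof (intro equalityI subsetI)
    fix v assume "v \<in> verts H"
    then show "v \<in> xs ` {..<2*m} \<union> R" by (auto simp: H_def star_def L_def)
  next
    fix v assume "v \<in> xs ` {..<2*m} \<union> R"
    then show "v \<in> verts H"
    proof
      assume "v \<in> R"
      then show ?thesis using g[of v] by (auto simp: H_def star_def L_def)
    next
      assume "v \<in> xs ` {..<2*m}"
      then obtain i where i: "i < 2*m" "v = xs i" by auto
      then show ?thesis
        by (cases rule: index_parity_cases[OF i(1)]) (auto simp: H_def star_def L_def)
    qed
  qed
  have eH: "\<exists>j<m. \<exists>l\<in>L j. e = {xs (2*j), l}" if "e \<in> edges H" for e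
    using that by (auto simp: H_def star_def)
  have "card (verts H) = card (xs ` {..<2*m}) + card R"
    unfolding vH by (rule card_Un_disjoint) (use finR Rx in auto)
  then have card: "t \<le> card (verts H)" using R(4) card_image[OF ix] by simp
  have sub1: "is_subgraph H G1"
    unfolding is_subgraph_def
  proof (intro exI[of _ id] conjI allI impI)
    show "id ` verts H \<subseteq> verts G1"
      using x R(1) unfolding vH V by (auto simp: star_roots_def A_def)
    fix u v assume "{u, v} \<in> edges H"
    then obtain j l where j: "j < m" "l \<in> L j" "{u, v} = {xs (2*j), l}" using eH by blast
    have "{xs (2*j), l} \<in> edges G1"
      using j(1,2) x g[of l] by (auto simp: L_def star_roots_def adj_def)
    then show "{id u, id v} \<in> edges G1" using j by simp
  qed simp
  define h where "h = (\<lambda>v. if v \<in> R then f v else ys (inv_into {..<2*m} xs v))"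
  have hx: "h (xs i) = ys i" if "i < 2*m" for i
    using that Rx[of "xs i" i] ix by (auto simp: h_def inv_into_f_f)
  have hR: "h v = f v" if "v \<in> R" for v using that by (simp add: h_def)
  have fB: "f v \<noteq> ys i" if "v \<in> R" "i < 2*m" for v i using R(3)[OF that(1)] that(2) by (auto simp: B_def)
  have sub2: "is_subgraph H G2"
    unfolding is_subgraph_def
  proof (intro exI[of _ h] conjI allI impI)
    have "inj_on h (xs ` {..<2*m})"
      using iy by (auto simp: inj_on_def hx)
    moreover have "inj_on h R" using R(2) by (auto simp: inj_on_def hR)
    moreover have "h ` (xs ` {..<2*m} - R) \<inter> h ` (R - xs ` {..<2*m}) = {}"
      using fB by (auto simp: hx hR) metis
    ultimately show "inj_on h (verts H)" unfolding vH inj_on_Un by blast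
    show "h ` verts H \<subseteq> verts G2"
      using y R(3) unfolding vH V by (auto simp: hx hR star_roots_def B_def)
    fix u v assume "{u, v} \<in> edges H"
    then obtain j l where j: "j < m" "l \<in> L j" "{u, v} = {xs (2*j), l}" using eH by blast
    have "{h (xs (2*j)), h l} \<in> edges G2"
      using j(1,2) y g[of l] by (auto simp: L_def star_roots_def adj_def hx hR)
    moreover have "{h u, h v} = h ` {u, v}" by simp
    ultimately show "{h u, h v} \<in> edges G2" unfolding j(3) by simp
  qed
  show ?thesis using sf sub1 sub2 card by (auto simp: common_star_forest_def)
qed

lemma star_roots_of_common_star_forest:
  assumes G: "input_graph G1" "input_graph G2" and H: "common_star_forest G1 G2 H"
  shows "\<exists>m xs ys. star_roots (adj G1) (card (verts G1)) m xs \<and> star_roots (adj G2) (card (verts G2)) m ys \<and>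
    (\<forall>P. card (verts H) \<le> 2 * m + free_count (adj G1) (card (verts G1)) m xs P
              + free_count (adj G2) (card (verts G2)) m ys (\<lambda>j. \<not> P j))"
proof -
  define n1 n2 where n: "n1 = card (verts G1)" "n2 = card (verts G2)"
  have V: "verts G1 = {..<n1}" "verts G2 = {..<n2}" using G by (auto simp: input_graph_def n)
  obtain F where F: "finite F" "\<And>S. S \<in> F \<Longrightarrow> nontrivial_star S"
    "pairwise (\<lambda>S T. disjnt (verts S) (verts T)) F"
    and HF: "H = Graph (\<Union>S\<in>F. verts S) (\<Union>S\<in>F. edges S)"
    using H by (auto simp: common_star_forest_def star_forest_def)
  obtain f1 where f1: "inj_on f1 (verts H)" "f1 ` verts H \<subseteq> verts G1"
     "\<And>u v. {u, v} \<in> edges H \<Longrightarrow> {f1 u, f1 v} \<in> edges G1"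
    using H[unfolded common_star_forest_def, THEN conjunct2, THEN conjunct1] unfolding is_subgraph_def by blast
  obtain f2 where f2: "inj_on f2 (verts H)" "f2 ` verts H \<subseteq> verts G2"
     "\<And>u v. {u, v} \<in> edges H \<Longrightarrow> {f2 u, f2 v} \<in> edges G2"
    using H[unfolded common_star_forest_def, THEN conjunct2, THEN conjunct2] unfolding is_subgraph_def by blast
  define m where "m = card F"
  obtain s where s: "bij_betw s {..<m} F"
    using ex_bij_betw_nat_finite[OF F(1)] unfolding m_def lessThan_atLeast0 by blast
  have sF: "s j \<in> F" if "j < m" for j using s that by (auto simp: bij_betw_def)
  have "\<exists>c l. c \<in> verts S \<and> l \<in> verts S \<and> c \<noteq> l \<and> (\<forall>v\<in>verts S - {c}. {c, v} \<in> edges S)"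
    if "S \<in> F" for S
  proof -
    have S: "nontrivial_star S" using that by (rule F(2))
    obtain c where c: "c \<in> verts S" "\<forall>v\<in>verts S - {c}. {c, v} \<in> edges S"
      using nontrivial_star_center[OF S] by blast
    have "card (verts S) \<ge> 2" using S by (simp add: nontrivial_star_def)
    then have "\<not> verts S \<subseteq> {c}" using card_mono[of "{c}" "verts S"] by auto
    then show ?thesis using c by auto
  qed
  then obtain c l where cl: "\<And>S. S \<in> F \<Longrightarrow> c S \<in> verts S \<and> l S \<in> verts S \<and> c S \<noteq> l S \<and>
      (\<forall>v\<in>verts S - {c S}. {c S, v} \<in> edges S)"
    by metis
  define z where "z = (\<lambda>i. if even i then c (s (i div 2)) else l (s (i div 2)))"
  have z0: "z (2*j) = c (s j)" and z1: "z (2*j+1) = l (s j)" for j by (auto simp: z_def)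
  have disj: "i = j" if "i < m" "j < m" "v \<in> verts (s i)" "v \<in> verts (s j)" for i j v
  proof (rule ccontr)
    assume "i \<noteq> j"
    then have "s i \<noteq> s j" using s that by (auto simp: bij_betw_def inj_on_def)
    then show False using F(3) sF that by (auto simp: pairwise_def disjnt_def)
  qed
  have zs: "z i \<in> verts (s (i div 2))" if "i < 2*m" for i
    using that cl[OF sF[of "i div 2"]] by (auto simp: z_def)
  have sV: "verts (s j) \<subseteq> verts H" if "j < m" for j using sF[OF that] by (auto simp: HF)
  have sE: "edges (s j) \<subseteq> edges H" if "j < m" for j using sF[OF that] by (auto simp: HF)
  have zinj: "inj_on z {..<2*m}"
  proof (rule inj_onI)
    fix i j assume ij: "i \<in> {..<2*m}" "j \<in> {..<2*m}" "z i = z j"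
    then have d: "i div 2 = j div 2" using disj[of "i div 2" "j div 2" "z i"] zs[of i] zs[of j] by auto
    moreover have "i div 2 < m" using ij by auto
    then have "even i \<longleftrightarrow> even j" using cl[OF sF[of "i div 2"]] ij d by (auto simp: z_def split: if_splits)
    ultimately show "i = j" by (metis bit_eq_rec)
  qed
  have zH: "z i \<in> verts H" if "i < 2*m" for i using zs[OF that] sV[of "i div 2"] less_mult_imp_div_less[of i m 2] that by (auto simp: mult.commute)
  have finH: "finite (verts H)" using F unfolding HF
    by (auto simp: nontrivial_star_def graph_tree_def simple_graph_def)
  have center: "{z (2*j), v} \<in> edges H" if "j < m" "v \<in> verts (s j)" "v \<noteq> z (2*j)" for j v
    using cl[OF sF[OF that(1)]] that sE unfolding z0 by blast
  define W where "W = verts H - z ` {..<2*m}"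
  have "card (verts H) = card (z ` {..<2*m}) + card W"
    unfolding W_def using zH finH
    by (subst card_Diff_subset) (auto intro!: card_mono le_add_diff_inverse[symmetric])
  then have cardH: "card (verts H) = 2*m + card W" using card_image[OF zinj] by simp
  have star_roots: "star_roots (adj G) n m (\<lambda>i. f (z i))"
    if f: "inj_on f (verts H)" "f ` verts H \<subseteq> {..<n}" "\<And>u v. {u, v} \<in> edges H \<Longrightarrow> {f u, f v} \<in> edges G"
    for f and n :: nat and G :: "nat graph"
    unfolding star_roots_def adj_def
  proof (intro conjI allI impI)
    fix i assume i: "i < 2*m"
    show "f (z i) < n" using zH[OF i] f(2) by auto
    fix j assume "j < i"
    then show "f (z i) \<noteq> f (z j)" using i zH[of i] zH[of j] f(1) zinj
      by (auto simp: inj_on_eq_iff)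
  next
    fix j assume j: "j < m"
    then have "z (2*j+1) \<in> verts (s j)" "z (2*j+1) \<noteq> z (2*j)"
      using cl[OF sF[OF j]] by (auto simp: z0 z1[simplified])
    then show "{f (z (2*j)), f (z (2*j+1))} \<in> edges G"
      by (intro f(3) center j)
  qed
  have free_count: "card {v\<in>W. \<exists>j<m. P j \<and> v \<in> verts (s j)} \<le> free_count (adj G) n m (\<lambda>i. f (z i)) P"
    if f: "inj_on f (verts H)" "f ` verts H \<subseteq> {..<n}" "\<And>u v. {u, v} \<in> edges H \<Longrightarrow> {f u, f v} \<in> edges G"
    for f and n :: nat and G :: "nat graph" and P
    unfolding free_count_def adj_def
  proof (rule card_inj_on_le)
    show "inj_on f {v\<in>W. \<exists>j<m. P j \<and> v \<in> verts (s j)}"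
      by (rule inj_on_subset[OF f(1)]) (auto simp: W_def)
    show "f ` {v\<in>W. \<exists>j<m. P j \<and> v \<in> verts (s j)} \<subseteq>
      {v. v < n \<and> (\<forall>i<2*m. f (z i) \<noteq> v) \<and> (\<exists>j<m. P j \<and> {f (z (2*j)), v} \<in> edges G)}"
    proof
      fix w assume "w \<in> f ` {v\<in>W. \<exists>j<m. P j \<and> v \<in> verts (s j)}"
      then obtain v j where v: "w = f v" "v \<in> W" "j < m" "P j" "v \<in> verts (s j)" by blast
      have "v \<in> verts H" "v \<noteq> z i" if "i < 2*m" for i using v(2) that by (auto simp: W_def)
      moreover have "v \<in> verts H" using v(2) by (auto simp: W_def)
      ultimately show "w \<in> {v. v < n \<and> (\<forall>i<2*m. f (z i) \<noteq> v) \<and> (\<exists>j<m. P j \<and> {f (z (2*j)), v} \<in> edges G)}"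
        using v f(2) zH f(1) center[OF v(3,5)] f(3)
        by (auto simp: inj_on_eq_iff intro!: exI[of _ j])
    qed
  qed auto
  have "card (verts H) \<le> 2 * m + free_count (adj G1) n1 m (\<lambda>i. f1 (z i)) P + free_count (adj G2) n2 m (\<lambda>i. f2 (z i)) (\<lambda>j. \<not> P j)" for P
  proof -
    have "W \<subseteq> {v\<in>W. \<exists>j<m. P j \<and> v \<in> verts (s j)} \<union> {v\<in>W. \<exists>j<m. \<not> P j \<and> v \<in> verts (s j)}"
    proof
      fix v assume v: "v \<in> W"
      then obtain S where "S \<in> F" "v \<in> verts S" by (auto simp: W_def HF)
      moreover then obtain j where "j < m" "S = s j" using s by (auto simp: bij_betw_def)
      ultimately show "v \<in> {v\<in>W. \<exists>j<m. P j \<and> v \<in> verts (s j)} \<union> {v\<in>W. \<exists>j<m. \<not> P j \<and> v \<in> verts (s j)}"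
        using v by auto
    qed
    then have "card W \<le> card ({v\<in>W. \<exists>j<m. P j \<and> v \<in> verts (s j)} \<union> {v\<in>W. \<exists>j<m. \<not> P j \<and> v \<in> verts (s j)})"
      by (rule card_mono[rotated]) (use finH in \<open>auto simp: W_def\<close>)
    also have "\<dots> \<le> card {v\<in>W. \<exists>j<m. P j \<and> v \<in> verts (s j)} + card {v\<in>W. \<exists>j<m. \<not> P j \<and> v \<in> verts (s j)}"
      by (rule card_Un_le)
    finally show ?thesis
      using free_count[OF f1(1) f1(2)[unfolded V(1)] f1(3), of P] free_count[OF f2(1) f2(2)[unfolded V(2)] f2(3), of "\<lambda>j. \<not> P j"]
      unfolding cardH by linarith
  qed
  then show ?thesis
    using star_roots[OF f1(1) f1(2)[unfolded V(1)] f1(3)] star_roots[OF f2(1) f2(2)[unfolded V(2)] f2(3)]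
    unfolding n by blast
qed

lemma star_roots_truncate: "star_roots a n m xs \<Longrightarrow> l \<le> m \<Longrightarrow> star_roots a n l xs"
  unfolding star_roots_def by (meson le_trans less_le_trans mult_le_mono2)

section \<open>Twin classes and candidate vertices\<close>

definition twin :: "(nat \<Rightarrow> nat \<Rightarrow> bool) \<Rightarrow> nat \<Rightarrow> nat \<Rightarrow> nat \<Rightarrow> bool" where
  "twin a n u v \<longleftrightarrow> (\<forall>w<n. a u w = a v w)"

definition candidate :: "(nat \<Rightarrow> nat \<Rightarrow> bool) \<Rightarrow> nat \<Rightarrow> nat \<Rightarrow> nat \<Rightarrow> bool" where
  "candidate a n q v \<longleftrightarrow> card {u. u < v \<and> twin a n u v} < q"

definition num_candidates :: "(nat \<Rightarrow> nat \<Rightarrow> bool) \<Rightarrow> nat \<Rightarrow> nat \<Rightarrow> nat" where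
  "num_candidates a n q = card {v. v < n \<and> candidate a n q v}"

text \<open>The value is \<open>n\<close>, which is not a vertex, if there are at most \<open>i\<close> candidates.\<close>

definition nth_candidate :: "(nat \<Rightarrow> nat \<Rightarrow> bool) \<Rightarrow> nat \<Rightarrow> nat \<Rightarrow> nat \<Rightarrow> nat" where
  "nth_candidate a n q i = card {u. u < n \<and> card {w. w < Suc u \<and> candidate a n q w} \<le> i}"

text \<open>The index of \<open>v\<close> is the number of candidates below it. The prefix counts
  exceed this number from \<open>v\<close> on, so exactly the \<open>v\<close> smaller vertices are
  counted.\<close>

lemma nth_candidate_surj:
  assumes v: "v < n" "candidate a n q v"
  obtains i where "i < num_candidates a n q" "nth_candidate a n q i = v"
proof
  let ?C = "\<lambda>u. {w. w < u \<and> candidate a n q w}"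
  have mono: "card (?C u) \<le> card (?C u')" if "u \<le> u'" for u u'
    by (rule card_mono) (use that in auto)
  have "?C (Suc v) = insert v (?C v)" using v(2) by (auto simp: less_Suc_eq)
  then have Suc: "card (?C (Suc v)) = Suc (card (?C v))" by simp
  show "card (?C v) < num_candidates a n q"
    using mono[of "Suc v" n] v(1) Suc unfolding num_candidates_def by simp
  have "{u. u < n \<and> card (?C (Suc u)) \<le> card (?C v)} = {..<v}"
  proof (intro equalityI subsetI)
    fix u assume "u \<in> {u. u < n \<and> card (?C (Suc u)) \<le> card (?C v)}"
    then show "u \<in> {..<v}" using mono[of "Suc v" "Suc u"] Suc by (cases "u < v") auto
  next
    fix u assume "u \<in> {..<v}"
    then show "u \<in> {u. u < n \<and> card (?C (Suc u)) \<le> card (?C v)}"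
      using mono[of "Suc u" v] v(1) by auto
  qed
  then show "nth_candidate a n q (card (?C v)) = v" unfolding nth_candidate_def by simp
qed

text \<open>A vertex outside the candidates is exchanged for an unused earlier twin; as open
  neighbourhoods agree, the transposition of the two is an automorphism.\<close>

lemma star_roots_candidates:
  assumes sym: "symp a" and val: "star_roots a n m xs"
  shows "\<exists>ys. star_roots a n m ys \<and> (\<forall>i<2*m. candidate a n (2*m) (ys i)) \<and> (\<forall>P. free_count a n m ys P = free_count a n m xs P)"
  using val
proof (induction "card {i. i < 2*m \<and> \<not> candidate a n (2*m) (xs i)}" arbitrary: xs rule: less_induct)
  case less
  show ?case
  proof (cases "\<forall>i<2*m. candidate a n (2*m) (xs i)")
    case True
    then show ?thesis using less.prems by blast
  next
    case False
    then obtain i where i: "i < 2*m" "\<not> candidate a n (2*m) (xs i)" by blast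
    define v where "v = xs i"
    have vn: "v < n" using less.prems i(1) by (auto simp: star_roots_def v_def)
    let ?T = "{u. u < v \<and> twin a n u v}"
    have "finite ?T" "2*m \<le> card ?T" using i(2) by (auto simp: candidate_def v_def)
    then obtain T where T: "T \<subseteq> ?T" "card T = 2*m" "finite T"
      by (meson obtain_subset_with_card_n finite_subset)
    have ex: "\<exists>u\<in>?T. candidate a n (2*m) u \<and> u \<notin> xs ` {..<2*m}"
    proof (rule ccontr)
      assume no: "\<not> ?thesis"
      define U where "U = {u \<in> ?T. candidate a n (2*m) u}"
      have twin: "twin a n u w \<longleftrightarrow> twin a n v w" if "u \<in> ?T" for u w
        using that by (auto simp: twin_def)
      \<comment> \<open>Otherwise the least earlier twin outside \<open>U\<close> would have all its
        own earlier twins in \<open>U\<close>, fewer than \<open>2 * m\<close> of them, and would be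
        a candidate itself.\<close>
      have "2 * m \<le> card U"
      proof (rule ccontr)
        assume "\<not> 2 * m \<le> card U"
        then have lt: "card U < 2 * m" by simp
        have "\<exists>u\<in>?T. u \<notin> U"
        proof (rule ccontr)
          assume "\<not> ?thesis"
          then have "?T \<subseteq> U" by blast
          then have "card ?T \<le> card U" by (rule card_mono[rotated]) (simp add: U_def)
          then show False using lt \<open>2*m \<le> card ?T\<close> by simp
        qed
        then obtain u where "u \<in> ?T" "u \<notin> U"
          and least: "\<And>w. w < u \<Longrightarrow> w \<in> ?T \<Longrightarrow> w \<in> U"
          using exists_least_iff[of "\<lambda>u. u \<in> ?T \<and> u \<notin> U"] by auto
        have "{w. w < u \<and> twin a n w u} \<subseteq> U"
        proof
          fix w assume w: "w \<in> {w. w < u \<and> twin a n w u}"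
          then have "w \<in> ?T" using \<open>u \<in> ?T\<close> by (auto simp: twin_def)
          then show "w \<in> U" using least w by blast
        qed
        then have "card {w. w < u \<and> twin a n w u} \<le> card U"
          by (rule card_mono[rotated]) (simp add: U_def)
        then have "candidate a n (2*m) u" using lt by (simp add: candidate_def)
        then show False using \<open>u \<in> ?T\<close> \<open>u \<notin> U\<close> by (simp add: U_def)
      qed
      \<comment> \<open>Position \<open>i\<close> holds \<open>v\<close>, which is not an earlier
        twin of itself, so only \<open>2 * m - 1\<close> positions could block the
        candidates.\<close>
      moreover have "U \<subseteq> xs ` ({..<2*m} - {i})"
      proof
        fix u assume u: "u \<in> U"
        then obtain j where "j < 2*m" "u = xs j" using no by (auto simp: U_def)
        moreover have "u \<noteq> xs i" using u by (auto simp: U_def v_def)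
        ultimately show "u \<in> xs ` ({..<2*m} - {i})" by auto
      qed
      then have "card U \<le> card ({..<2*m} - {i})"
        by (meson surj_card_le finite_Diff finite_lessThan)
      then have "card U < 2 * m" using i(1) by simp
      ultimately show False by simp
    qed
    then obtain u where u: "u < v" "twin a n u v" "candidate a n (2*m) u" "u \<notin> xs ` {..<2*m}" by blast
    define s where "s = (\<lambda>w. if w = u then v else if w = v then u else w)"
    have un: "u < n" using u(1) vn by simp
    have s_less: "s w < n \<longleftrightarrow> w < n" for w using un vn by (auto simp: s_def)
    have ss: "s (s w) = w" for w by (auto simp: s_def)
    have s_eq: "s w = s w' \<longleftrightarrow> w = w'" for w w' using ss by metis
    have tw: "a u w = a v w" if "w < n" for w using u(2) that by (simp add: twin_def)
    have tw1: "a (s w) w' = a w w'" if "w' < n" for w w'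
      using tw[OF that] by (simp add: s_def)
    have tw2: "a w (s w') = a w w'" if "w < n" for w w'
      using tw1[OF that, of w'] sympD[OF sym] by blast
    have sa: "a (s w) (s w') = a w w'" if "w < n" "w' < n" for w w'
      using tw1[of "s w'" w] tw2[of w w'] that s_less by blast
    define zs where "zs = (\<lambda>i. s (xs i))"
    have xn: "xs j < n" if "j < 2*m" for j using less.prems that by (simp add: star_roots_def)
    have vz: "star_roots a n m zs"
      using less.prems unfolding star_roots_def zs_def by (auto simp: s_less s_eq sa)
    have cz: "free_count a n m zs P = free_count a n m xs P" for P
      unfolding free_count_def
    proof (rule bij_betw_same_card[of s], rule bij_betw_imageI)
      show "inj_on s {v. v < n \<and> (\<forall>i<2*m. zs i \<noteq> v) \<and> (\<exists>j<m. P j \<and> a (zs (2*j)) v)}"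
        by (auto simp: inj_on_def s_eq)
      show "s ` {v. v < n \<and> (\<forall>i<2*m. zs i \<noteq> v) \<and> (\<exists>j<m. P j \<and> a (zs (2*j)) v)}
          = {v. v < n \<and> (\<forall>i<2*m. xs i \<noteq> v) \<and> (\<exists>j<m. P j \<and> a (xs (2*j)) v)}"
      proof (intro equalityI subsetI)
        fix w assume "w \<in> s ` {v. v < n \<and> (\<forall>i<2*m. zs i \<noteq> v) \<and> (\<exists>j<m. P j \<and> a (zs (2*j)) v)}"
        then obtain w' j where w': "w = s w'" "w' < n" "\<forall>i<2*m. s (xs i) \<noteq> w'" "j < m" "P j" "a (s (xs (2*j))) w'"
          by (auto simp: zs_def)
        have "a (xs (2*j)) (s w')" using sa[of "xs (2*j)" "s w'"] w' xn by (simp add: ss s_less)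
        moreover have "\<forall>i<2*m. xs i \<noteq> s w'" using w'(3) ss by metis
        ultimately show "w \<in> {v. v < n \<and> (\<forall>i<2*m. xs i \<noteq> v) \<and> (\<exists>j<m. P j \<and> a (xs (2*j)) v)}"
          using w' by (auto simp: s_less)
      next
        fix w assume w: "w \<in> {v. v < n \<and> (\<forall>i<2*m. xs i \<noteq> v) \<and> (\<exists>j<m. P j \<and> a (xs (2*j)) v)}"
        then have "s w \<in> {v. v < n \<and> (\<forall>i<2*m. zs i \<noteq> v) \<and> (\<exists>j<m. P j \<and> a (zs (2*j)) v)}"
          using xn by (auto simp: zs_def s_less s_eq sa)
        then show "w \<in> s ` {v. v < n \<and> (\<forall>i<2*m. zs i \<noteq> v) \<and> (\<exists>j<m. P j \<and> a (zs (2*j)) v)}"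
          using ss[of w] by (metis (no_types, lifting) imageI)
      qed
    qed
    have "{i. i < 2*m \<and> \<not> candidate a n (2*m) (zs i)} \<subset> {i. i < 2*m \<and> \<not> candidate a n (2*m) (xs i)}"
    proof
      show "{i. i < 2*m \<and> \<not> candidate a n (2*m) (zs i)} \<subseteq> {i. i < 2*m \<and> \<not> candidate a n (2*m) (xs i)}"
        using u(3,4) by (auto simp: zs_def s_def split: if_splits)
      have "candidate a n (2*m) (zs i)" using u(3) by (simp add: zs_def s_def v_def)
      then show "{i. i < 2*m \<and> \<not> candidate a n (2*m) (zs i)} \<noteq> {i. i < 2*m \<and> \<not> candidate a n (2*m) (xs i)}"
        using i by blast
    qed
    then have "card {i. i < 2*m \<and> \<not> candidate a n (2*m) (zs i)} < card {i. i < 2*m \<and> \<not> candidate a n (2*m) (xs i)}"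
      by (rule psubset_card_mono[rotated]) simp
    from less.hyps[OF this vz] show ?thesis using cz by simp
  qed
qed

section \<open>The algorithm\<close>

lemma digits_surj:
  fixes b :: "nat \<Rightarrow> nat"
  assumes "\<And>i. i < l \<Longrightarrow> b i < N"
  shows "\<exists>x<N ^ l. \<forall>i<l. digit N x i = b i"
  using assms
proof (induction l arbitrary: b)
  case 0
  then show ?case by auto
next
  case (Suc l)
  obtain x where x: "x < N ^ l" "\<forall>i<l. digit N x i = b (Suc i)"
    using Suc.IH[of "\<lambda>i. b (Suc i)"] Suc.prems by auto
  let ?x = "b 0 + N * x"
  have b0: "b 0 < N" using Suc.prems by simp
  have "?x < N + N * x" using b0 by simp
  also have "\<dots> = N * Suc x" by simp
  also have "\<dots> \<le> N * N ^ l" using x(1) by (intro mult_le_mono2) simp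
  finally have "?x < N ^ Suc l" by simp
  moreover have "digit N ?x i = b i" if "i < Suc l" for i
  proof (cases i)
    case 0
    then show ?thesis using b0 by (simp add: digit_def)
  next
    case (Suc i')
    have "?x div N ^ Suc i' = ?x div N div N ^ i'" by (simp add: div_mult2_eq)
    also have "?x div N = x" using b0 by simp
    finally show ?thesis using x(2) that Suc by (simp add: digit_def)
  qed
  ultimately show ?case by blast
qed

text \<open>The number \<open>x\<close> encodes the fixed vertices in both graphs and \<open>y\<close> encodes a set of stars.  The
  maximum is computed as the number of the \<open>t\<close> below it, which avoids a separate loop construct.\<close>

definition search_best :: "(nat \<Rightarrow> nat \<Rightarrow> bool) \<Rightarrow> nat \<Rightarrow> (nat \<Rightarrow> nat \<Rightarrow> bool) \<Rightarrow> nat \<Rightarrow> nat \<Rightarrow> nat \<Rightarrow> nat \<Rightarrow> nat \<Rightarrow> nat" where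
  "search_best a1 n1 a2 n2 m N X Y = card {t. t < n1 + n2 \<and>
     (\<exists>x<X. star_roots a1 n1 m (\<lambda>i. nth_candidate a1 n1 (2*m) (digit N x i)) \<and>
        star_roots a2 n2 m (\<lambda>i. nth_candidate a2 n2 (2*m) (digit N x (2*m+i))) \<and>
        (\<forall>y<Y. t < 2*m + free_count a1 n1 m (\<lambda>i. nth_candidate a1 n1 (2*m) (digit N x i)) (\<lambda>j. digit 2 y j = 1)
           + free_count a2 n2 m (\<lambda>i. nth_candidate a2 n2 (2*m) (digit N x (2*m+i))) (\<lambda>j. \<not> digit 2 y j = 1)))}"

text \<open>One base for both graphs. Digits that are too large for one of them decode to its number
  of vertices and are rejected by \<open>star_roots\<close>.\<close>

definition digit_base :: "(nat \<Rightarrow> nat \<Rightarrow> bool) \<Rightarrow> nat \<Rightarrow> (nat \<Rightarrow> nat \<Rightarrow> bool) \<Rightarrow> nat \<Rightarrow> nat \<Rightarrow> nat" where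
  "digit_base a1 n1 a2 n2 m = num_candidates a1 n1 (2*m) + num_candidates a2 n2 (2*m) + 1"

text \<open>There are \<open>4 * m\<close> digits, namely for \<open>2 * m\<close> fixed vertices in
  each of the two graphs.\<close>

definition best_forest :: "(nat \<Rightarrow> nat \<Rightarrow> bool) \<Rightarrow> nat \<Rightarrow> (nat \<Rightarrow> nat \<Rightarrow> bool) \<Rightarrow> nat \<Rightarrow> nat \<Rightarrow> nat" where
  "best_forest a1 n1 a2 n2 m =
     search_best a1 n1 a2 n2 m (digit_base a1 n1 a2 n2 m) (digit_base a1 n1 a2 n2 m ^ (4*m)) (2 ^ m)"

text \<open>The test \<open>l < i\<close> stops the search at the first infeasible number of stars; without it the
  running time would be \<open>n\<close> to the power \<open>n\<close>.\<close>

definition maxstars :: "(nat \<Rightarrow> nat \<Rightarrow> bool) \<Rightarrow> nat \<Rightarrow> (nat \<Rightarrow> nat \<Rightarrow> bool) \<Rightarrow> nat \<Rightarrow> nat \<Rightarrow> nat" where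
  "maxstars a1 n1 a2 n2 = rec_nat 0 (\<lambda>i l. if l < i then l else
     if 0 < best_forest a1 n1 a2 n2 (Suc i) then Suc i else l)"

text \<open>The \<open>Suc\<close> lets the loop counter reach the number of stars
  \<open>maxstars\<close> itself.\<close>

definition msf :: "(nat \<Rightarrow> nat \<Rightarrow> bool) \<Rightarrow> nat \<Rightarrow> (nat \<Rightarrow> nat \<Rightarrow> bool) \<Rightarrow> nat \<Rightarrow> nat" where
  "msf a1 n1 a2 n2 = rec_nat 0 (\<lambda>i l. if l < best_forest a1 n1 a2 n2 i then best_forest a1 n1 a2 n2 i else l)
     (Suc (maxstars a1 n1 a2 n2 n1))"

section \<open>Correctness of the search\<close>

definition realizable :: "(nat \<Rightarrow> nat \<Rightarrow> bool) \<Rightarrow> nat \<Rightarrow> (nat \<Rightarrow> nat \<Rightarrow> bool) \<Rightarrow> nat \<Rightarrow> nat \<Rightarrow> nat \<Rightarrow> bool" where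
  "realizable a1 n1 a2 n2 m t \<longleftrightarrow> (\<exists>xs ys. star_roots a1 n1 m xs \<and> star_roots a2 n2 m ys \<and>
     (\<forall>P. t \<le> 2*m + free_count a1 n1 m xs P + free_count a2 n2 m ys (\<lambda>j. \<not> P j)))"

text \<open>The counted numbers form an initial segment because \<open>Q\<close> is downward closed.
  This is how a maximum stored as a count is read back.\<close>

lemma less_card_antimono:
  fixes K :: nat
  assumes "\<And>s t. s \<le> t \<Longrightarrow> Q t \<Longrightarrow> Q s"
  shows "t < card {t. t < K \<and> Q t} \<longleftrightarrow> t < K \<and> Q t"
proof
  assume t: "t < card {t. t < K \<and> Q t}"
  show "t < K \<and> Q t"
  proof (rule ccontr)
    assume "\<not> (t < K \<and> Q t)"
    then have "{t. t < K \<and> Q t} \<subseteq> {..<t}"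
      using assms by (auto simp: not_less) (meson le_less_trans not_le nat_le_linear order_trans)+
    then have "card {t. t < K \<and> Q t} \<le> card {..<t}" by (rule card_mono[rotated]) simp
    then show False using t by simp
  qed
next
  assume t: "t < K \<and> Q t"
  then have "{..t} \<subseteq> {t. t < K \<and> Q t}" using assms by auto
  then have "card {..t} \<le> card {t. t < K \<and> Q t}" by (rule card_mono[rotated]) simp
  then show "t < card {t. t < K \<and> Q t}" by simp
qed

lemma free_count_cong:
  assumes "\<And>i. i < 2*m \<Longrightarrow> xs i = ys i" "\<And>j. j < m \<Longrightarrow> P j = Q j"
  shows "free_count a n m xs P = free_count a n m ys Q"
proof -
  have "(\<exists>j<m. P j \<and> a (xs (2*j)) v) = (\<exists>j<m. Q j \<and> a (ys (2*j)) v)" for v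
    using assms by auto
  then show ?thesis unfolding free_count_def using assms(1) by simp
qed

lemma star_roots_cong:
  assumes "\<And>i. i < 2*m \<Longrightarrow> xs i = ys i"
  shows "star_roots a n m xs = star_roots a n m ys"
proof -
  have "(\<forall>i<2*m. \<forall>j<i. xs i \<noteq> xs j) = (\<forall>i<2*m. \<forall>j<i. ys i \<noteq> ys j)"
    using assms by (metis less_trans)
  moreover have "(\<forall>j<m. a (xs (2*j)) (xs (2*j+1))) = (\<forall>j<m. a (ys (2*j)) (ys (2*j+1)))"
    using assms by auto
  ultimately show ?thesis unfolding star_roots_def using assms by auto
qed

lemma of_bool_less_2: "of_bool b < (2 :: nat)"
  by simp

text \<open>Here the numeric codes vanish: \<open>star_roots_candidates\<close> replaces arbitrary
  fixed vertices by candidates, \<open>nth_candidate_surj\<close> and \<open>digits_surj\<close>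
  turn them into a code \<open>x\<close>, and every set of stars agrees on the indices below
  \<open>m\<close> with some \<open>y < 2 ^ m\<close>. The strict inequality in the search is why
  \<open>t\<close> corresponds to \<open>Suc t\<close> vertices.\<close>

lemma less_best_forest_iff:
  assumes "symp a1" "symp a2"
  shows "t < best_forest a1 n1 a2 n2 m \<longleftrightarrow> t < n1 + n2 \<and> realizable a1 n1 a2 n2 m (Suc t)"
proof -
  let ?N = "digit_base a1 n1 a2 n2 m"
  let ?xs = "\<lambda>x i. nth_candidate a1 n1 (2*m) (digit ?N x i)"
  let ?ys = "\<lambda>x i. nth_candidate a2 n2 (2*m) (digit ?N x (2*m+i))"
  let ?Q = "\<lambda>t. \<exists>x<?N ^ (4*m). star_roots a1 n1 m (?xs x) \<and> star_roots a2 n2 m (?ys x) \<and>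
     (\<forall>y<2^m. t < 2*m + free_count a1 n1 m (?xs x) (\<lambda>j. digit 2 y j = 1)
            + free_count a2 n2 m (?ys x) (\<lambda>j. \<not> digit 2 y j = 1))"
  have "t < best_forest a1 n1 a2 n2 m \<longleftrightarrow> t < n1 + n2 \<and> ?Q t"
    unfolding best_forest_def search_best_def by (rule less_card_antimono) (meson le_less_trans)
  moreover have "?Q t \<longleftrightarrow> realizable a1 n1 a2 n2 m (Suc t)"
  proof
    assume "?Q t"
    then obtain x where x: "star_roots a1 n1 m (?xs x)" "star_roots a2 n2 m (?ys x)"
      and y: "\<And>y. y < 2^m \<Longrightarrow> t < 2*m + free_count a1 n1 m (?xs x) (\<lambda>j. digit 2 y j = 1)
            + free_count a2 n2 m (?ys x) (\<lambda>j. \<not> digit 2 y j = 1)" by blast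
    have "t < 2*m + free_count a1 n1 m (?xs x) P + free_count a2 n2 m (?ys x) (\<lambda>j. \<not> P j)" for P
    proof -
      obtain y' where y': "y' < 2^m" "\<forall>j<m. digit 2 y' j = of_bool (P j)"
        using digits_surj[of m "\<lambda>j. of_bool (P j)" 2] of_bool_less_2 by blast
      have "free_count a1 n1 m (?xs x) (\<lambda>j. digit 2 y' j = 1) = free_count a1 n1 m (?xs x) P"
        "free_count a2 n2 m (?ys x) (\<lambda>j. \<not> digit 2 y' j = 1) = free_count a2 n2 m (?ys x) (\<lambda>j. \<not> P j)"
        by (rule free_count_cong; use y'(2) in simp)+
      then show ?thesis using y[OF y'(1)] by simp
    qed
    then show "realizable a1 n1 a2 n2 m (Suc t)" unfolding realizable_def Suc_le_eq using x by blast
  next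
    assume "realizable a1 n1 a2 n2 m (Suc t)"
    then obtain xs ys where v: "star_roots a1 n1 m xs" "star_roots a2 n2 m ys"
      and t: "\<And>P. t < 2*m + free_count a1 n1 m xs P + free_count a2 n2 m ys (\<lambda>j. \<not> P j)"
      unfolding realizable_def Suc_le_eq by blast
    obtain xs' where xs': "star_roots a1 n1 m xs'" "\<forall>i<2*m. candidate a1 n1 (2*m) (xs' i)"
      "\<And>P. free_count a1 n1 m xs' P = free_count a1 n1 m xs P"
      using star_roots_candidates[OF assms(1) v(1)] by blast
    obtain ys' where ys': "star_roots a2 n2 m ys'" "\<forall>i<2*m. candidate a2 n2 (2*m) (ys' i)"
      "\<And>P. free_count a2 n2 m ys' P = free_count a2 n2 m ys P"
      using star_roots_candidates[OF assms(2) v(2)] by blast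
    have "\<exists>d<?N. nth_candidate a1 n1 (2*m) d = xs' i" if i: "i < 2*m" for i
    proof -
      have "xs' i < n1" using xs'(1) i by (simp add: star_roots_def)
      then obtain d where "d < num_candidates a1 n1 (2*m)" "nth_candidate a1 n1 (2*m) d = xs' i"
        by (rule nth_candidate_surj) (use i xs'(2) in auto)
      then show ?thesis by (intro exI[of _ d]) (simp add: digit_base_def)
    qed
    then obtain d1 where d1: "\<And>i. i < 2*m \<Longrightarrow> d1 i < ?N \<and> nth_candidate a1 n1 (2*m) (d1 i) = xs' i" by metis
    have "\<exists>d<?N. nth_candidate a2 n2 (2*m) d = ys' i" if i: "i < 2*m" for i
    proof -
      have "ys' i < n2" using ys'(1) i by (simp add: star_roots_def)
      then obtain d where "d < num_candidates a2 n2 (2*m)" "nth_candidate a2 n2 (2*m) d = ys' i"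
        by (rule nth_candidate_surj) (use i ys'(2) in auto)
      then show ?thesis by (intro exI[of _ d]) (simp add: digit_base_def)
    qed
    then obtain d2 where d2: "\<And>i. i < 2*m \<Longrightarrow> d2 i < ?N \<and> nth_candidate a2 n2 (2*m) (d2 i) = ys' i" by metis
    have "(if i < 2*m then d1 i else d2 (i - 2*m)) < ?N" if "i < 4*m" for i
      using d1[of i] d2[of "i - 2*m"] that by auto
    then obtain x where x: "x < ?N ^ (4*m)"
      "\<forall>i<4*m. digit ?N x i = (if i < 2*m then d1 i else d2 (i - 2*m))"
      using digits_surj[of "4*m" "\<lambda>i. if i < 2*m then d1 i else d2 (i - 2*m)" ?N] by blast
    have e: "?xs x i = xs' i" "?ys x i = ys' i" if "i < 2*m" for i
      using that x(2) d1[OF that] d2[OF that] by simp_all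
    have "star_roots a1 n1 m (?xs x)" "star_roots a2 n2 m (?ys x)"
      using star_roots_cong[of m "?xs x" xs', OF e(1)] star_roots_cong[of m "?ys x" ys', OF e(2)] xs'(1) ys'(1)
      by blast+
    moreover have "free_count a1 n1 m (?xs x) P = free_count a1 n1 m xs P" for P
      using free_count_cong[of m "?xs x" xs' P P, OF e(1) refl] xs'(3) by simp
    moreover have "free_count a2 n2 m (?ys x) P = free_count a2 n2 m ys P" for P
      using free_count_cong[of m "?ys x" ys' P P, OF e(2) refl] ys'(3) by simp
    ultimately show "?Q t" using x(1) t by (intro exI[of _ x]) simp
  qed
  ultimately show ?thesis by blast
qed

text \<open>Forgetting the last stars keeps the others valid, so feasibility is inherited by smaller
  numbers of stars; this justifies stopping at the first failure.\<close>

lemma realizable_fewer_stars: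
  assumes "realizable a1 n1 a2 n2 m t" "l \<le> m"
  shows "\<exists>s. realizable a1 n1 a2 n2 l s \<and> 2 * l \<le> s"
  using assms star_roots_truncate unfolding realizable_def
  by (meson le_add1 le_trans order_refl)

lemma star_roots_le: "star_roots a n m xs \<Longrightarrow> 2 * m \<le> n"
  using card_inj_on_le[of xs "{..<2*m}" "{..<n}"] star_roots_inj_on[of a n m xs]
  by (auto simp: star_roots_def)

lemma maxstars_le: "maxstars a1 n1 a2 n2 i \<le> i"
  by (induction i) (auto simp: maxstars_def)

lemma maxstars_mono: "i \<le> j \<Longrightarrow> maxstars a1 n1 a2 n2 i \<le> maxstars a1 n1 a2 n2 j"
proof (rule lift_Suc_mono_le[of "maxstars a1 n1 a2 n2"])
  fix j show "maxstars a1 n1 a2 n2 j \<le> maxstars a1 n1 a2 n2 (Suc j)"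
    using maxstars_le[of a1 n1 a2 n2 j] by (auto simp: maxstars_def)
qed

context
  fixes a1 a2 :: "nat \<Rightarrow> nat \<Rightarrow> bool" and n1 n2 :: nat
  assumes sym: "symp a1" "symp a2"
begin

text \<open>The fixed vertices alone give a forest on \<open>2 * m > 0\<close> vertices, so the
  value 0 signals infeasibility. For \<open>m = 0\<close> the value is 0 although the empty forest
  is feasible.\<close>

lemma best_forest_pos_iff:
  assumes "0 < m"
  shows "0 < best_forest a1 n1 a2 n2 m \<longleftrightarrow> (\<exists>t. realizable a1 n1 a2 n2 m t)"
proof
  assume "0 < best_forest a1 n1 a2 n2 m"
  then show "\<exists>t. realizable a1 n1 a2 n2 m t" using less_best_forest_iff[OF sym, of 0 n1 n2 m] by auto
next
  assume "\<exists>t. realizable a1 n1 a2 n2 m t"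
  then obtain xs ys where v: "star_roots a1 n1 m xs" "star_roots a2 n2 m ys" unfolding realizable_def by blast
  have "realizable a1 n1 a2 n2 m (Suc 0)"
    unfolding realizable_def by (rule exI[of _ xs], rule exI[of _ ys]) (use v assms in simp)
  moreover have "0 < n1 + n2" using star_roots_le[OF v(1)] assms by simp
  ultimately show "0 < best_forest a1 n1 a2 n2 m" using less_best_forest_iff[OF sym, of 0 n1 n2 m] by simp
qed

text \<open>Serves the running time: a feasible number of stars is at most the size of a vertex
  cover.\<close>

lemma realizable_maxstars: "\<exists>t. realizable a1 n1 a2 n2 (maxstars a1 n1 a2 n2 i) t"
proof (induction i)
  case 0
  have "star_roots a n 0 xs" for a n xs by (simp add: star_roots_def)
  then show ?case by (auto simp: maxstars_def realizable_def)
next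
  case (Suc i)
  then show ?case
    using best_forest_pos_iff[of "Suc i"] by (auto simp: maxstars_def)
qed

text \<open>Up to a feasible \<open>m\<close> the loop never stalls, and its \<open>n1\<close>
  rounds suffice because \<open>m\<close> stars occupy \<open>2 * m\<close> vertices of the first
  graph.\<close>

lemma realizable_le_maxstars:
  assumes "realizable a1 n1 a2 n2 m t"
  shows "m \<le> maxstars a1 n1 a2 n2 n1"
proof -
  have "maxstars a1 n1 a2 n2 i = i" if "i \<le> m" for i
    using that
  proof (induction i)
    case 0
    then show ?case by (simp add: maxstars_def)
  next
    case (Suc i)
    have "0 < best_forest a1 n1 a2 n2 (Suc i)"
      using realizable_fewer_stars[OF assms Suc.prems] best_forest_pos_iff[of "Suc i"] by auto
    then show ?case using Suc by (simp add: maxstars_def)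
  qed
  moreover obtain xs where "star_roots a1 n1 m xs" using assms unfolding realizable_def by blast
  then have "m \<le> n1" using star_roots_le[of a1 n1 m xs] by linarith
  ultimately show ?thesis using maxstars_mono[of m n1 a1 n1 a2 n2] by simp
qed

lemma msf_eq_Max: "msf a1 n1 a2 n2 = Max (best_forest a1 n1 a2 n2 ` {..maxstars a1 n1 a2 n2 n1})"
proof -
  have "rec_nat 0 (\<lambda>i l. if l < f i then f i else l) (Suc k) = Max (f ` {..k})" for f :: "nat \<Rightarrow> nat" and k
  proof (induction k)
    case (Suc k)
    let ?r = "rec_nat 0 (\<lambda>i l. if l < f i then f i else l)"
    have "?r (Suc (Suc k)) = max (f (Suc k)) (?r (Suc k))" by (auto simp: max_def)
    also have "\<dots> = Max (f ` {..Suc k})" unfolding Suc by (simp add: atMost_Suc)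
    finally show ?case .
  qed simp
  then show ?thesis unfolding msf_def .
qed

lemma realizable_le_msf:
  assumes "realizable a1 n1 a2 n2 m t" "t \<le> n1 + n2"
  shows "t \<le> msf a1 n1 a2 n2"
proof (cases t)
  case (Suc s)
  then have "s < best_forest a1 n1 a2 n2 m" using assms less_best_forest_iff[OF sym] by simp
  moreover have "best_forest a1 n1 a2 n2 m \<le> msf a1 n1 a2 n2"
    unfolding msf_eq_Max using realizable_le_maxstars[OF assms(1)] by (intro Max_ge) auto
  ultimately show ?thesis using Suc by simp
qed simp

lemma realizable_msf:
  assumes "0 < msf a1 n1 a2 n2"
  obtains m where "realizable a1 n1 a2 n2 m (msf a1 n1 a2 n2)"
proof -
  have "msf a1 n1 a2 n2 \<in> best_forest a1 n1 a2 n2 ` {..maxstars a1 n1 a2 n2 n1}"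
    unfolding msf_eq_Max by (rule Max_in) auto
  then obtain m where "msf a1 n1 a2 n2 = best_forest a1 n1 a2 n2 m" by auto
  then have "realizable a1 n1 a2 n2 m (Suc (msf a1 n1 a2 n2 - 1))"
    using less_best_forest_iff[OF sym, of "msf a1 n1 a2 n2 - 1" n1 n2 m] assms by simp
  then show ?thesis using that assms by simp
qed

end

section \<open>The computed value is the maximum for the input graphs\<close>

lemma adj_sym: "symp (adj G)"
  by (simp add: symp_def adj_def insert_commute)

abbreviation graph_msf :: "nat graph \<Rightarrow> nat graph \<Rightarrow> nat" where
  "graph_msf G1 G2 \<equiv> msf (adj G1) (card (verts G1)) (adj G2) (card (verts G2))"

lemma common_star_forest_le:
  assumes G: "input_graph G1" "input_graph G2" and H: "common_star_forest G1 G2 H"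
  shows "card (verts H) \<le> graph_msf G1 G2"
proof -
  obtain m where m: "realizable (adj G1) (card (verts G1)) (adj G2) (card (verts G2)) m (card (verts H))"
    using star_roots_of_common_star_forest[OF assms] unfolding realizable_def by blast
  have "is_subgraph H G1" using H by (simp add: common_star_forest_def)
  then obtain f where "inj_on f (verts H)" "f ` verts H \<subseteq> verts G1" unfolding is_subgraph_def by blast
  moreover have "finite (verts G1)" using G by (simp add: input_graph_def simple_graph_def)
  ultimately have "card (verts H) \<le> card (verts G1)" by (rule card_inj_on_le)
  then show ?thesis using realizable_le_msf[OF adj_sym adj_sym m] by simp
qed

lemma empty_common_star_forest: "common_star_forest G1 G2 (Graph {} {})"
  unfolding common_star_forest_def star_forest_def is_subgraph_def
  by (auto intro!: exI[of _ "{}"])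

lemma common_star_forest_ge:
  assumes G: "input_graph G1" "input_graph G2"
  obtains H where "common_star_forest G1 G2 H" "card (verts H) = graph_msf G1 G2"
proof (cases "graph_msf G1 G2 = 0")
  case True
  then show ?thesis using that[OF empty_common_star_forest] by simp
next
  case False
  then obtain m where "realizable (adj G1) (card (verts G1)) (adj G2) (card (verts G2)) m (graph_msf G1 G2)"
    using realizable_msf[OF adj_sym adj_sym] by blast
  then obtain H where "common_star_forest G1 G2 H" "graph_msf G1 G2 \<le> card (verts H)"
    unfolding realizable_def using common_star_forest_of_star_roots[OF G] by blast
  then show ?thesis using that common_star_forest_le[OF G] le_antisym by blast
qed

lemma max_common_star_forest_eq:
  assumes G: "input_graph G1" "input_graph G2"
  shows "max_common_star_forest G1 G2 = graph_msf G1 G2"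
  unfolding max_common_star_forest_def
proof (rule Max_eqI)
  have "{card (verts H) | H. common_star_forest G1 G2 H} \<subseteq> {..graph_msf G1 G2}"
    using common_star_forest_le[OF G] by auto
  then show "finite {card (verts H) | H. common_star_forest G1 G2 H}" using finite_subset by blast
  show "y \<le> graph_msf G1 G2" if "y \<in> {card (verts H) | H. common_star_forest G1 G2 H}" for y
    using that common_star_forest_le[OF G] by auto
  show "graph_msf G1 G2 \<in> {card (verts H) | H. common_star_forest G1 G2 H}"
    using common_star_forest_ge[OF G] by (metis (mono_tags, lifting) mem_Collect_eq)
qed

lemma mcsf_yes_iff:
  assumes G: "input_graph G1" "input_graph G2"
  shows "mcsf_yes (G1, G2, h) \<longleftrightarrow> h \<le> graph_msf G1 G2"
  unfolding mcsf_yes_def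
  using common_star_forest_le[OF G] common_star_forest_ge[OF G] by (auto intro: le_trans) metis

section \<open>Running time of the algorithm\<close>

text \<open>The range conditions give equality with \<open>adj G\<close> as functions; without them
  an index beyond \<open>n\<close> would read an unrelated entry of the input.\<close>

definition arr_adj :: "(nat \<Rightarrow> nat) \<Rightarrow> nat \<Rightarrow> nat \<Rightarrow> nat \<Rightarrow> nat \<Rightarrow> bool" where
  "arr_adj A off n u v \<longleftrightarrow> u < n \<and> v < n \<and> A (off + u * n + v) \<noteq> 0"

lemma ptime_candidate_base:
  "ptime (\<lambda>A e. 0) 4 (\<lambda>A e. of_bool (candidate (arr_adj A (e 0) (e (Suc 0))) (e (Suc 0)) (e (Suc (Suc 0))) (e (Suc (Suc (Suc 0))))))"
  unfolding pdec_def[symmetric] candidate_def twin_def arr_adj_def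
  by (intro ptime_intros; simp)

lemma pdec_candidate [ptime_intros]:
  "ptime H r off \<Longrightarrow> ptime H r n \<Longrightarrow> ptime H r q \<Longrightarrow> ptime H r v \<Longrightarrow>
    pdec H r (\<lambda>A e. candidate (arr_adj A (off A e) (n A e)) (n A e) (q A e) (v A e))"
  unfolding pdec_def
  by (rule ptime_comp4[where G = "\<lambda>A off n q v. of_bool (candidate (arr_adj A off n) n q v)", OF ptime_candidate_base])

lemma ptime_num_candidates [ptime_intros]:
  "ptime H r off \<Longrightarrow> ptime H r n \<Longrightarrow> ptime H r q \<Longrightarrow>
    ptime H r (\<lambda>A e. num_candidates (arr_adj A (off A e) (n A e)) (n A e) (q A e))"
  unfolding num_candidates_def
  by (intro ptime_intros ptime_shift; simp)

lemma ptime_nth_candidate_base: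
  "ptime (\<lambda>A e. 0) 4 (\<lambda>A e. nth_candidate (arr_adj A (e 0) (e (Suc 0))) (e (Suc 0)) (e (Suc (Suc 0))) (e (Suc (Suc (Suc 0)))))"
  unfolding nth_candidate_def
  by (intro ptime_intros; simp)

lemma ptime_nth_candidate [ptime_intros]:
  "ptime H r off \<Longrightarrow> ptime H r n \<Longrightarrow> ptime H r q \<Longrightarrow> ptime H r i \<Longrightarrow>
    ptime H r (\<lambda>A e. nth_candidate (arr_adj A (off A e) (n A e)) (n A e) (q A e) (i A e))"
  by (rule ptime_comp4[where G = "\<lambda>A off n q i. nth_candidate (arr_adj A off n) n q i", OF ptime_nth_candidate_base])

text \<open>With the base and both loop lengths as arguments 0, 2 and 1, the search is polynomial in
  its arguments. The exponential cost arises only when these are set to powers.\<close>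

lemma ptime_search_best:
  "ptime (\<lambda>A e. 0) 6 (\<lambda>A e. search_best (arr_adj A 1 (e 3)) (e 3) (arr_adj A (2 + e 3 * e 3) (e 4)) (e 4) (e 5) (e 0) (e 2) (e (Suc 0)))"
  unfolding search_best_def star_roots_def free_count_def arr_adj_def[of _ _ _ "nth_candidate _ _ _ _"]
  by (intro ptime_intros; simp)

definition search_size :: "(nat \<Rightarrow> nat) \<Rightarrow> nat \<Rightarrow> nat \<Rightarrow> nat \<Rightarrow> nat" where
  "search_size A n1 n2 m = digit_base (arr_adj A 1 n1) n1 (arr_adj A (2 + n1 * n1) n2) n2 m ^ (4 * m) + 2 ^ m"

text \<open>The first matrix starts after the entry \<open>n1\<close>; the second one also follows
  the \<open>n1 * n1\<close> entries of the first and the entry \<open>n2\<close>.\<close>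

definition arr_best_forest :: "(nat \<Rightarrow> nat) \<Rightarrow> nat \<Rightarrow> nat \<Rightarrow> nat \<Rightarrow> nat" where
  "arr_best_forest A n1 n2 m = best_forest (arr_adj A 1 n1) n1 (arr_adj A (2 + n1 * n1) n2) n2 m"

lemma ptime_best_forest:
  "ptime (\<lambda>A e. search_size A (e 0) (e (Suc 0)) (e (Suc (Suc 0)))) 3 (\<lambda>A e. arr_best_forest A (e 0) (e (Suc 0)) (e (Suc (Suc 0))))"
proof -
  let ?a1 = "\<lambda>A e. arr_adj A 1 (e 0)" and ?a2 = "\<lambda>A e. arr_adj A (2 + e 0 * e 0) (e (Suc 0))"
  let ?H = "\<lambda>A e. search_size A (e 0) (e (Suc 0)) (e (Suc (Suc 0)))"
  let ?digit_base = "\<lambda>A e. digit_base (?a1 A e) (e 0) (?a2 A e) (e (Suc 0)) (e (Suc (Suc 0)))"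
  have digit_base: "ptime H 3 ?digit_base" for H
    unfolding digit_base_def by (intro ptime_intros; simp)
  have X: "ptime ?H 3 (\<lambda>A e. ?digit_base A e ^ (4 * e (Suc (Suc 0))))"
    by (rule ptime_power[OF digit_base]) ((intro ptime_intros; simp), simp add: search_size_def)
  have Y: "ptime ?H 3 (\<lambda>A e. 2 ^ e (Suc (Suc 0)))"
    by (rule ptime_power) ((intro ptime_intros; simp)+, simp add: search_size_def)
  have search_best: "ptime H 6 (\<lambda>A e. search_best (arr_adj A 1 (e 3)) (e 3) (arr_adj A (2 + e 3 * e 3) (e 4)) (e 4) (e 5) (e 0) (e 2) (e (Suc 0)))" for H
    by (rule ptime_weaken_size[OF ptime_search_best])
  \<comment> \<open>The base and the two loop lengths are substituted from the inside out, each
    removing the argument with index 0.\<close>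
  have 1: "ptime (\<lambda>A e. ?H A (\<lambda>i. e (Suc (Suc i)))) 5
     (\<lambda>A e. search_best (arr_adj A 1 (e 2)) (e 2) (arr_adj A (2 + e 2 * e 2) (e 3)) (e 3) (e 4) (?digit_base A (\<lambda>i. e (Suc (Suc i)))) (e (Suc 0)) (e 0))"
    using ptime_let[where g = "\<lambda>A N e. search_best (arr_adj A 1 (e 2)) (e 2) (arr_adj A (2 + e 2 * e 2) (e 3)) (e 3) (e 4) N (e (Suc 0)) (e 0)",
        OF ptime_shift[OF ptime_shift[OF digit_base]], of "?H"] search_best
    by (simp add: numeral_eq_Suc)
  have 2: "ptime (\<lambda>A e. ?H A (\<lambda>i. e (Suc i))) 4
     (\<lambda>A e. search_best (arr_adj A 1 (e 1)) (e 1) (arr_adj A (2 + e 1 * e 1) (e 2)) (e 2) (e 3) (?digit_base A (\<lambda>i. e (Suc i))) (e 0) (2 ^ e 3))"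
    using ptime_let[where g = "\<lambda>A Y e. search_best (arr_adj A 1 (e 1)) (e 1) (arr_adj A (2 + e 1 * e 1) (e 2)) (e 2) (e 3) (?digit_base A (\<lambda>i. e (Suc i))) (e 0) Y",
        OF ptime_shift[OF Y]] 1
    by (simp add: numeral_eq_Suc)
  have 3: "ptime ?H 3
     (\<lambda>A e. search_best (?a1 A e) (e 0) (?a2 A e) (e (Suc 0)) (e (Suc (Suc 0))) (?digit_base A e) (?digit_base A e ^ (4 * e (Suc (Suc 0)))) (2 ^ e (Suc (Suc 0))))"
    using ptime_let[where g = "\<lambda>A X e. search_best (?a1 A e) (e 0) (?a2 A e) (e (Suc 0)) (e (Suc (Suc 0))) (?digit_base A e) X (2 ^ e (Suc (Suc 0)))",
        OF X] 2
    by (simp add: numeral_eq_Suc)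
  then show ?thesis unfolding arr_best_forest_def best_forest_def .
qed

definition arr_maxstars :: "(nat \<Rightarrow> nat) \<Rightarrow> nat \<Rightarrow> nat \<Rightarrow> nat" where
  "arr_maxstars A n1 n2 = maxstars (arr_adj A 1 n1) n1 (arr_adj A (2 + n1 * n1) n2) n2 n1"

text \<open>The \<open>Suc\<close> accounts for the search that fails: it is carried out as
  well.\<close>

definition max_search_size :: "(nat \<Rightarrow> nat) \<Rightarrow> nat \<Rightarrow> nat \<Rightarrow> nat" where
  "max_search_size A n1 n2 = Max (search_size A n1 n2 ` {..Suc (arr_maxstars A n1 n2)})"

lemma search_size_le_total: "m \<le> Suc (arr_maxstars A n1 n2) \<Longrightarrow> search_size A n1 n2 m \<le> max_search_size A n1 n2"
  unfolding max_search_size_def by (rule Max_ge) auto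

text \<open>All \<open>n1\<close> rounds are executed, but a search takes place only while the
  accumulator has kept up with the counter. The conditional size \<open>H'\<close> charges nothing
  in the remaining rounds.\<close>

lemma ptime_maxstars:
  "ptime (\<lambda>A e. max_search_size A (e 0) (e (Suc 0))) 2 (\<lambda>A e. arr_maxstars A (e 0) (e (Suc 0)))"
  unfolding arr_maxstars_def maxstars_def arr_best_forest_def[symmetric]
proof (rule ptime_rec[where b = "\<lambda>A e. 0" and f = "\<lambda>A e. e 0" and h = "\<lambda>A e. e 0"
      and g = "\<lambda>A i l e. if l < i then l else if 0 < arr_best_forest A (e 0) (e (Suc 0)) (Suc i) then Suc i else l"
      and H' = "\<lambda>A e. if e (Suc 0) < e 0 then 0 else search_size A (e 2) (e 3) (Suc (e 0))"])
  show "ptime (\<lambda>A e. if e (Suc 0) < e 0 then 0 else search_size A (e 2) (e 3) (Suc (e 0))) (Suc (Suc 2))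
     (\<lambda>A e. if e (Suc 0) < e 0 then e (Suc 0) else
        if 0 < arr_best_forest A (e (Suc (Suc 0))) (e (Suc (Suc (Suc 0)))) (Suc (e 0)) then Suc (e 0) else e (Suc 0))"
  proof (rule ptime_if_less[where Ht = "\<lambda>A e. 0" and He = "\<lambda>A e. search_size A (e 2) (e 3) (Suc (e 0))"])
    have "ptime (\<lambda>A e. search_size A (e 2) (e 3) (Suc (e 0))) (Suc (Suc 2))
        (\<lambda>A e. arr_best_forest A (e (Suc (Suc 0))) (e (Suc (Suc (Suc 0)))) (Suc (e 0)))"
    proof (rule ptime_let_size[where f = "\<lambda>A e. Suc (e 0)" and g = "\<lambda>A x e. arr_best_forest A (e (Suc (Suc 0))) (e (Suc (Suc (Suc 0)))) x"
          and H' = "\<lambda>A e. search_size A (e 3) (e 4) (e 0)"])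
      show "ptime (\<lambda>A e. search_size A (e 3) (e 4) (e 0)) (Suc (Suc (Suc 2)))
         (\<lambda>A e. arr_best_forest A (e (Suc (Suc (Suc 0)))) (e (Suc (Suc (Suc (Suc 0))))) (e 0))"
        using ptime_rename[OF ptime_best_forest, of "\<lambda>i. if i = 0 then 3 else if i = 1 then 4 else 0" 5]
        by (simp add: numeral_eq_Suc)
    qed ((intro ptime_intros; simp), simp add: numeral_eq_Suc)
    then show "ptime (\<lambda>A e. search_size A (e 2) (e 3) (Suc (e 0))) (Suc (Suc 2))
     (\<lambda>A e. if 0 < arr_best_forest A (e (Suc (Suc 0))) (e (Suc (Suc (Suc 0)))) (Suc (e 0)) then Suc (e 0) else e (Suc 0))"
      by (intro ptime_intros; simp)
  qed ((intro ptime_intros; simp)+, simp_all)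
  have rec: "rec_nat 0 (\<lambda>i l. if l < i then l else if 0 < arr_best_forest A n1 n2 (Suc i) then Suc i else l)
     = maxstars (arr_adj A 1 n1) n1 (arr_adj A (2 + n1 * n1) n2) n2" for A n1 n2
    unfolding maxstars_def arr_best_forest_def ..
  fix A e i
  show "rec_nat 0 (\<lambda>i l. if l < i then l else if 0 < arr_best_forest A (e 0) (e (Suc 0)) (Suc i) then Suc i else l) i \<le> e 0"
    if "i \<le> e 0" unfolding rec using maxstars_le that le_trans by blast
  let ?l = "maxstars (arr_adj A 1 (e 0)) (e 0) (arr_adj A (2 + e 0 * e 0) (e (Suc 0))) (e (Suc 0)) i"
  assume i: "i < e 0"
  have "search_size A (e 0) (e (Suc 0)) (Suc i) \<le> max_search_size A (e 0) (e (Suc 0))" if "\<not> ?l < i"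
  proof (rule search_size_le_total)
    \<comment> \<open>A search in round \<open>i\<close> means \<open>i \<le> ?l\<close>, and
      \<open>?l\<close> only grows towards the final value.\<close>
    have "?l \<le> arr_maxstars A (e 0) (e (Suc 0))"
      unfolding arr_maxstars_def using i by (intro maxstars_mono) simp
    then show "Suc i \<le> Suc (arr_maxstars A (e 0) (e (Suc 0)))" using that by simp
  qed
  then show "(\<lambda>A e. if e (Suc 0) < e 0 then 0 else search_size A (e 2) (e 3) (Suc (e 0))) A
     (case_nat i (case_nat (rec_nat 0 (\<lambda>i l. if l < i then l else if 0 < arr_best_forest A (e 0) (e (Suc 0)) (Suc i) then Suc i else l) i) e))
      \<le> max_search_size A (e 0) (e (Suc 0))"
    unfolding rec by (simp add: numeral_eq_Suc)
qed (intro ptime_intros polybd_var; simp)+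

definition arr_msf :: "(nat \<Rightarrow> nat) \<Rightarrow> nat \<Rightarrow> nat \<Rightarrow> nat" where
  "arr_msf A n1 n2 = msf (arr_adj A 1 n1) n1 (arr_adj A (2 + n1 * n1) n2) n2"

lemma arr_best_forest_le: "arr_best_forest A n1 n2 m \<le> n1 + n2"
proof -
  have "card {t. t < n1 + n2 \<and> P t} \<le> card {..<n1 + n2}" for P by (rule card_mono) auto
  then show ?thesis unfolding arr_best_forest_def best_forest_def search_best_def by simp
qed

lemma ptime_msf:
  "ptime (\<lambda>A e. max_search_size A (e 0) (e (Suc 0))) 2 (\<lambda>A e. arr_msf A (e 0) (e (Suc 0)))"
  unfolding arr_msf_def msf_def arr_best_forest_def[symmetric] arr_maxstars_def[symmetric]
proof (rule ptime_rec[where b = "\<lambda>A e. 0" and f = "\<lambda>A e. Suc (arr_maxstars A (e 0) (e (Suc 0)))" and h = "\<lambda>A e. e 0 + e (Suc 0)"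
      and g = "\<lambda>A i l e. if l < arr_best_forest A (e 0) (e (Suc 0)) i then arr_best_forest A (e 0) (e (Suc 0)) i else l"
      and H' = "\<lambda>A e. search_size A (e 2) (e 3) (e 0)"])
  have "ptime (\<lambda>A e. search_size A (e 2) (e 3) (e 0)) (Suc (Suc 2))
     (\<lambda>A e. arr_best_forest A (e (Suc (Suc 0))) (e (Suc (Suc (Suc 0)))) (e 0))"
    using ptime_rename[OF ptime_best_forest, of "\<lambda>i. if i = 0 then 2 else if i = 1 then 3 else 0" 4]
    by (simp add: numeral_eq_Suc)
  then show "ptime (\<lambda>A e. search_size A (e 2) (e 3) (e 0)) (Suc (Suc 2))
     (\<lambda>A e. if e (Suc 0) < arr_best_forest A (e (Suc (Suc 0))) (e (Suc (Suc (Suc 0)))) (e 0)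
        then arr_best_forest A (e (Suc (Suc 0))) (e (Suc (Suc (Suc 0)))) (e 0) else e (Suc 0))"
    by (intro ptime_intros; simp)
  fix A e i
  show "rec_nat 0 (\<lambda>i l. if l < arr_best_forest A (e 0) (e (Suc 0)) i then arr_best_forest A (e 0) (e (Suc 0)) i else l) i
     \<le> e 0 + e (Suc 0)"
    by (induction i) (auto simp: arr_best_forest_le)
  show "(\<lambda>A e. search_size A (e 2) (e 3) (e 0)) A (case_nat i (case_nat
     (rec_nat 0 (\<lambda>i l. if l < arr_best_forest A (e 0) (e (Suc 0)) i then arr_best_forest A (e 0) (e (Suc 0)) i else l) i) e))
     \<le> max_search_size A (e 0) (e (Suc 0))" if "i < Suc (arr_maxstars A (e 0) (e (Suc 0)))"
    using search_size_le_total[of i] that by (simp add: numeral_eq_Suc)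
qed (intro ptime_intros polybd_var polybd_add ptime_maxstars; simp)+

text \<open>The two vertex counts are included because they are read as numbers; the threshold is
  deliberately left out.\<close>

definition input_search_size :: "(nat \<Rightarrow> nat) \<Rightarrow> nat" where
  "input_search_size A = A 0 + A (1 + A 0 * A 0) + max_search_size A (A 0) (A (1 + A 0 * A 0))"

lemma ptime_input_msf: "ptime (\<lambda>A e. input_search_size A) 0 (\<lambda>A e. arr_msf A (A 0) (A (1 + A 0 * A 0)))"
proof (rule ptime_let_size[where f = "\<lambda>A e. A 0" and g = "\<lambda>A x e. arr_msf A x (A (1 + x * x))"
      and H' = "\<lambda>A e. A (1 + e 0 * e 0) + max_search_size A (e 0) (A (1 + e 0 * e 0))"])
  show "ptime (\<lambda>A e. A (1 + e 0 * e 0) + max_search_size A (e 0) (A (1 + e 0 * e 0))) (Suc 0)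
       (\<lambda>A e. arr_msf A (e 0) (A (1 + e 0 * e 0)))"
  proof (rule ptime_let_size[where f = "\<lambda>A e. A (1 + e 0 * e 0)" and g = "\<lambda>A x e. arr_msf A (e 0) x"
        and H' = "\<lambda>A e. max_search_size A (e (Suc 0)) (e 0)"])
    show "ptime (\<lambda>A e. max_search_size A (e (Suc 0)) (e 0)) (Suc (Suc 0)) (\<lambda>A e. arr_msf A (e (Suc 0)) (e 0))"
      using ptime_rename[OF ptime_msf, of "\<lambda>i. 1 - i" "Suc (Suc 0)"] by simp
    show "ptime (\<lambda>A e. A (1 + e 0 * e 0) + max_search_size A (e 0) (A (1 + e 0 * e 0))) (Suc 0) (\<lambda>A e. A (1 + e 0 * e 0))"
      by (rule ptime_input) ((intro ptime_intros; simp), simp)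
  qed simp
  show "ptime (\<lambda>A e. input_search_size A) 0 (\<lambda>A e. A 0)"
    by (rule ptime_input[OF ptime_const]) (simp add: input_search_size_def)
qed (simp add: input_search_size_def)

section \<open>Bounds in terms of the vertex cover\<close>

lemma star_roots_le_cover:
  assumes "input_graph G" "has_vertex_cover G k" and val: "star_roots (adj G) n m xs"
  shows "m \<le> k"
proof -
  obtain S where S: "vertex_cover G S" "card S \<le> k" using assms(2) by (auto simp: has_vertex_cover_def)
  have fin: "finite S"
    using S(1) assms(1) finite_subset by (auto simp: vertex_cover_def input_graph_def simple_graph_def)
  define f where "f = (\<lambda>j. if xs (2*j) \<in> S then xs (2*j) else xs (2*j+1))"
  have cover: "u \<in> S \<or> v \<in> S" if "{u, v} \<in> edges G" for u v
    using S(1) that by (auto simp: vertex_cover_def delete_verts_def)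
  have "f j \<in> S" if "j < m" for j
    using val that cover[of "xs (2*j)" "xs (2*j+1)"] by (auto simp: f_def star_roots_def adj_def)
  moreover have "inj_on f {..<m}"
  proof (rule inj_onI)
    fix i j assume ij: "i \<in> {..<m}" "j \<in> {..<m}" "f i = f j"
    have inj: "xs k = xs l \<longleftrightarrow> k = l" if "k < 2*m" "l < 2*m" for k l
      using star_roots_inj_on[OF val] that by (auto simp: inj_on_def)
    have "2 * i \<noteq> 2 * j + 1" "2 * j \<noteq> 2 * i + 1" by presburger+
    then show "i = j" using ij by (auto simp: f_def inj split: if_splits)
  qed
  ultimately have "card {..<m} \<le> card S" using fin by (intro card_inj_on_le[of f]) auto
  then show ?thesis using S(2) by simp
qed

text \<open>Outside a cover \<open>S\<close> all neighbours lie in \<open>S\<close>, so these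
  vertices fall into at most \<open>2 ^ k\<close> classes according to their neighbourhood.\<close>

lemma num_candidates_le_cover:
  assumes G: "input_graph G" "has_vertex_cover G k"
  shows "num_candidates (adj G) (card (verts G)) q \<le> k + 2 ^ k * q"
proof -
  define n where "n = card (verts G)"
  obtain S where S: "vertex_cover G S" "card S \<le> k" using G(2) by (auto simp: has_vertex_cover_def)
  have V: "verts G = {..<n}" using G(1) by (auto simp: input_graph_def n_def)
  have fin: "finite S"
    using S(1) G(1) finite_subset by (auto simp: vertex_cover_def input_graph_def simple_graph_def)
  have cover: "u \<in> S \<or> v \<in> S" if "{u, v} \<in> edges G" for u v
    using S(1) that by (auto simp: vertex_cover_def delete_verts_def)
  let ?N = "\<lambda>v. {w. adj G v w}"
  let ?D = "\<lambda>X. {v. v < n \<and> candidate (adj G) n q v \<and> ?N v = X}"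
  have D: "card (?D X) \<le> q" for X
  proof (cases "?D X = {}")
    case False
    \<comment> \<open>All other members of the class are earlier twins of its largest candidate,
      which has fewer than \<open>q\<close> of them.\<close>
    let ?v = "Max (?D X)"
    have fD: "finite (?D X)" by simp
    have v: "?v \<in> ?D X" by (rule Max_in[OF fD False])
    have le: "u \<le> ?v" if "u \<in> ?D X" for u by (rule Max_ge[OF fD that])
    have "?D X \<subseteq> insert ?v {u. u < ?v \<and> twin (adj G) n u ?v}"
    proof
      fix u assume u: "u \<in> ?D X"
      have "?N u = ?N ?v" using u v by simp
      then have "twin (adj G) n u ?v" unfolding twin_def by blast
      then show "u \<in> insert ?v {u. u < ?v \<and> twin (adj G) n u ?v}" using le[OF u] by auto
    qed
    then have "card (?D X) \<le> card (insert ?v {u. u < ?v \<and> twin (adj G) n u ?v})"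
      by (rule card_mono[rotated]) simp
    also have "\<dots> \<le> Suc (card {u. u < ?v \<and> twin (adj G) n u ?v})"
      by (rule card_insert_le_m1[THEN order_trans]) auto
    also have "\<dots> \<le> q" using v by (simp add: candidate_def Suc_le_eq)
    finally show ?thesis .
  next
    case True
    show ?thesis by (subst True) simp
  qed
  have "{v. v < n \<and> candidate (adj G) n q v} \<subseteq> S \<union> (\<Union>X\<in>Pow S. ?D X)"
  proof
    fix v assume v: "v \<in> {v. v < n \<and> candidate (adj G) n q v}"
    have "?N v \<subseteq> S" if "v \<notin> S" using cover that by (auto simp: adj_def)
    then show "v \<in> S \<union> (\<Union>X\<in>Pow S. ?D X)" using v by auto
  qed
  then have "num_candidates (adj G) n q \<le> card (S \<union> (\<Union>X\<in>Pow S. ?D X))"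
    unfolding num_candidates_def by (rule card_mono[rotated]) (use fin in auto)
  also have "\<dots> \<le> card S + card (\<Union>X\<in>Pow S. ?D X)" by (rule card_Un_le)
  also have "card (\<Union>X\<in>Pow S. ?D X) \<le> (\<Sum>X\<in>Pow S. card (?D X))"
    using fin by (intro card_UN_le) simp
  also have "\<dots> \<le> (\<Sum>X\<in>Pow S. q)" using D by (rule sum_mono)
  also have "\<dots> = 2 ^ card S * q" using fin by (simp add: card_Pow)
  also have "card S + \<dots> \<le> k + 2 ^ k * q"
    using S(2) by (intro add_mono mult_le_mono power_increasing) auto
  finally show ?thesis unfolding n_def by simp
qed

section \<open>Adjacency matrices in the input array\<close>

lemma concat_map_nth:
  assumes "u < m" "v < n"
  shows "concat (map (\<lambda>u. map (f u) [0..<n]) [0..<m]) ! (u * n + v) = f u v"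
  using assms
proof (induction m)
  case (Suc m)
  let ?c = "\<lambda>m. concat (map (\<lambda>u. map (f u) [0..<n]) [0..<m])"
  have len: "length (?c l) = l * n" for l by (induction l) auto
  show ?case
  proof (cases "u = m")
    case True
    then show ?thesis using Suc.prems len by (simp add: nth_append)
  next
    case False
    then have u: "u < m" using Suc.prems by simp
    have "u * n + v < Suc u * n" using Suc.prems by simp
    also have "\<dots> \<le> m * n" using u by (intro mult_le_mono1) simp
    finally show ?thesis using Suc.IH[OF u] Suc.prems len by (simp add: nth_append)
  qed
qed simp

lemma length_encode_graph: "length (encode_graph G) = 1 + card (verts G) * card (verts G)"
proof -
  have "length (concat (map (\<lambda>u. map (f u) [0..<n]) [0..<l])) = l * n" for f :: "nat \<Rightarrow> nat \<Rightarrow> nat" and l n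
    by (induction l) auto
  then show ?thesis by (simp add: encode_graph_def Let_def)
qed

lemma encode_graph_nth:
  "encode_graph G ! 0 = card (verts G)"
  "u < card (verts G) \<Longrightarrow> v < card (verts G) \<Longrightarrow>
     encode_graph G ! Suc (u * card (verts G) + v) = (if adj G u v then 1 else 0)"
  unfolding encode_graph_def Let_def adj_def by (simp_all add: concat_map_nth)

lemma adj_less:
  assumes "input_graph G" "adj G u v"
  shows "u < card (verts G)" "v < card (verts G)"
  using simple_graph_edge[of G u v] assms by (auto simp: adj_def input_graph_def)

lemma row_major_less:
  fixes u n :: nat
  assumes "u < n" "v < n"
  shows "u * n + v < n * n"
proof -
  have "u * n + v < Suc u * n" using assms by simp
  also have "\<dots> \<le> n * n" using assms by (intro mult_le_mono1) simp
  finally show ?thesis .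
qed

lemma input_array_encode:
  fixes ys :: "nat list"
  assumes G: "input_graph G1" "input_graph G2"
  defines "A \<equiv> input_array (encode_graph G1 @ encode_graph G2 @ ys)"
  defines "n1 \<equiv> card (verts G1)" and "n2 \<equiv> card (verts G2)"
  shows "A 0 = n1" "A (1 + n1 * n1) = n2"
    "arr_adj A 1 n1 = adj G1" "arr_adj A (2 + n1 * n1) n2 = adj G2"
    "ys = [h] \<Longrightarrow> A (2 + n1 * n1 + n2 * n2) = h"
proof -
  have l: "length (encode_graph G1) = Suc (n1 * n1)" "length (encode_graph G2) = Suc (n2 * n2)"
    by (simp_all add: length_encode_graph n1_def n2_def)
  show "A 0 = n1" "A (1 + n1 * n1) = n2" "ys = [h] \<Longrightarrow> A (2 + n1 * n1 + n2 * n2) = h"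
    using encode_graph_nth(1)[of G1] encode_graph_nth(1)[of G2] l
    by (simp_all add: A_def input_array_def nth_append flip: n1_def n2_def)
  have "arr_adj A 1 n1 u v = adj G1 u v" for u v
    using row_major_less[of u n1 v] encode_graph_nth(2)[of u G1 v] l adj_less[OF G(1), of u v]
    by (auto simp: arr_adj_def A_def input_array_def nth_append split: if_splits simp flip: n1_def)
  then show "arr_adj A 1 n1 = adj G1" by blast
  have "arr_adj A (2 + n1 * n1) n2 u v = adj G2 u v" for u v
  proof -
    have "2 + n1 * n1 + u * n2 + v - Suc (n1 * n1) = Suc (u * n2 + v)" by simp
    then show ?thesis
      using row_major_less[of u n2 v] encode_graph_nth(2)[of u G2 v] l adj_less[OF G(2), of u v]
      by (auto simp: arr_adj_def A_def input_array_def nth_append split: if_splits simp flip: n2_def)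
  qed
  then show "arr_adj A (2 + n1 * n1) n2 = adj G2" by blast
qed

lemma arr_msf_encode:
  fixes ys :: "nat list"
  assumes G: "input_graph G1" "input_graph G2"
  defines "A \<equiv> input_array (encode_graph G1 @ encode_graph G2 @ ys)"
  shows "arr_msf A (A 0) (A (1 + A 0 * A 0)) = graph_msf G1 G2"
  unfolding arr_msf_def A_def using input_array_encode[OF G, of ys] by simp

section \<open>Double exponential bounds on the search and the time\<close>

lemma double_exp_bound:
  assumes "m \<le> Suc k" "b1 \<le> k + 2 ^ k * (2 * m)" "b2 \<le> k + 2 ^ k * (2 * m)"
  shows "(b1 + b2 + 1) ^ (4 * m) + 2 ^ m \<le> (2::nat) ^ 2 ^ (2 * k + 5)"
proof -
  have k: "Suc k \<le> 2 ^ k" by (simp add: Suc_le_eq)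
  have sq: "(2::nat) ^ (2 * k) = 2 ^ k * 2 ^ k" by (simp only: mult_2 power_add)
  \<comment> \<open>The base is at most \<open>2 ^ (2 * k + 3)\<close>. Raised to the power
    \<open>4 * m\<close> it has an exponent quadratic in \<open>k\<close>, estimated by
    \<open>2 ^ (2 * k + 4)\<close>; one more doubling of the exponent absorbs the summand
    \<open>2 ^ m\<close>.\<close>
  have "2 ^ k * (2 * m) \<le> 2 ^ k * (2 * 2 ^ k)" using assms(1) k by (intro mult_le_mono2) simp
  then have "b1 + b2 + 1 \<le> 2 * 2 ^ k + 4 * (2 ^ k * 2 ^ k)" using assms(2,3) k by linarith
  also have "\<dots> \<le> 8 * (2 ^ k * 2 ^ k)" by simp
  also have "\<dots> = 2 ^ (2 * k + 3)" unfolding power_add sq by simp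
  finally have "(b1 + b2 + 1) ^ (4 * m) \<le> (2 ^ (2 * k + 3)) ^ (4 * m)" by (rule power_mono) simp
  also have "\<dots> = 2 ^ ((2 * k + 3) * (4 * m))" by (rule power_mult[symmetric])
  also have "(2 * k + 3) * (4 * m) \<le> (4 * 2 ^ k) * (4 * 2 ^ k)"
    using assms(1) k by (intro mult_le_mono) linarith+
  also have "\<dots> = 2 ^ (2 * k + 4)" unfolding power_add sq by simp
  finally have 1: "(b1 + b2 + 1) ^ (4 * m) \<le> 2 ^ 2 ^ (2 * k + 4)" by simp
  have "m \<le> 2 ^ (2 * k + 4)"
  proof -
    have "m \<le> 2 ^ k" using assms(1) k by simp
    also have "(2::nat) ^ k \<le> 2 ^ (2 * k + 4)" by (rule power_increasing) auto
    finally show ?thesis .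
  qed
  then have 2: "(2::nat) ^ m \<le> 2 ^ 2 ^ (2 * k + 4)" by (rule power_increasing) simp
  have "(2::nat) ^ 2 ^ (2 * k + 4) * 2 \<le> 2 ^ 2 ^ (2 * k + 4) * 2 ^ 2 ^ (2 * k + 4)"
    by (intro mult_le_mono2) (metis one_le_numeral one_le_power power_increasing power_one_right)
  also have "\<dots> = 2 ^ (2 ^ (2 * k + 4) + 2 ^ (2 * k + 4))" by (rule power_add[symmetric])
  also have "2 ^ (2 * k + 4) + 2 ^ (2 * k + 4) = (2::nat) ^ (2 * k + 5)" unfolding power_add by simp
  finally show ?thesis using 1 2 by linarith
qed

lemma input_search_size_le:
  assumes G: "input_graph G1" "input_graph G2" and k: "has_vertex_cover G1 k" "has_vertex_cover G2 k"
  shows "input_search_size (input_array (encode_graph G1 @ encode_graph G2 @ ys))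
    \<le> card (verts G1) + card (verts G2) + 2 ^ 2 ^ (2 * k + 5)"
proof -
  let ?A = "input_array (encode_graph G1 @ encode_graph G2 @ ys)"
  define n1 n2 where n: "n1 = card (verts G1)" "n2 = card (verts G2)"
  note A = input_array_encode[OF G, of ys, folded n]
  let ?l = "arr_maxstars ?A n1 n2"
  have "\<exists>t. realizable (adj G1) n1 (adj G2) n2 ?l t"
    unfolding arr_maxstars_def A by (rule realizable_maxstars[OF adj_sym adj_sym])
  then have l: "?l \<le> k" unfolding realizable_def using star_roots_le_cover[OF G(1) k(1)] by blast
  have "search_size ?A n1 n2 m \<le> 2 ^ 2 ^ (2 * k + 5)" if "m \<le> Suc ?l" for m
    unfolding search_size_def digit_base_def A
    using num_candidates_le_cover[OF G(1) k(1), of "2*m"] num_candidates_le_cover[OF G(2) k(2), of "2*m"] that l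
    by (intro double_exp_bound) (simp_all add: n)
  then have "max_search_size ?A n1 n2 \<le> 2 ^ 2 ^ (2 * k + 5)"
    unfolding max_search_size_def by (intro Max.boundedI) auto
  then show ?thesis unfolding input_search_size_def A n[symmetric] by simp
qed

text \<open>The degree \<open>c\<close> moves into the second exponent because
  \<open>c \<le> 2 ^ c\<close>. The 2 added to the number of vertices ensures
  \<open>2 \<le> M\<close>. Leaving \<open>ys\<close> arbitrary covers inputs with and without a
  threshold.\<close>

lemma polybd_input_search_size_bound:
  assumes "polybd (\<lambda>A e. input_search_size A) 0 T"
  shows "\<exists>c. \<forall>G1 G2 k ys. input_graph G1 \<and> input_graph G2 \<and> has_vertex_cover G1 k \<and> has_vertex_cover G2 k \<longrightarrow>
    T (input_array (encode_graph G1 @ encode_graph G2 @ ys)) e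
      \<le> 2 ^ 2 ^ (2 * k + 5 + c) * (card (verts G1) + card (verts G2) + 2) ^ c"
proof -
  obtain c where c: "\<And>A e M. 2 \<le> M \<Longrightarrow> input_search_size A \<le> M \<Longrightarrow> T A e \<le> M ^ c"
    using assms unfolding polybd_def by auto
  have "T (input_array (encode_graph G1 @ encode_graph G2 @ ys)) e
      \<le> 2 ^ 2 ^ (2 * k + 5 + c) * (card (verts G1) + card (verts G2) + 2) ^ c"
    if "input_graph G1" "input_graph G2" "has_vertex_cover G1 k" "has_vertex_cover G2 k" for G1 G2 k ys
  proof -
    let ?n = "card (verts G1) + card (verts G2)" and ?b = "(2::nat) ^ 2 ^ (2 * k + 5)"
    have b: "1 \<le> ?b" by simp
    have "?n \<le> ?n * ?b" using b by simp
    then have "?n + ?b \<le> ?b * (?n + 2)" by (simp add: algebra_simps)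
    moreover have "2 \<le> ?b * (?n + 2)" using b by (metis le_add2 mult_le_mono nat_mult_1)
    ultimately have "T (input_array (encode_graph G1 @ encode_graph G2 @ ys)) e \<le> (?b * (?n + 2)) ^ c"
      using input_search_size_le[OF that, of ys] by (intro c) linarith+
    also have "\<dots> = ?b ^ c * (?n + 2) ^ c" by (rule power_mult_distrib)
    also have "?b ^ c = 2 ^ (2 ^ (2 * k + 5) * c)" by (rule power_mult[symmetric])
    also have "\<dots> \<le> 2 ^ (2 ^ (2 * k + 5) * 2 ^ c)"
      by (intro power_increasing mult_le_mono2 less_imp_le less_exp) simp
    also have "\<dots> = 2 ^ 2 ^ (2 * k + 5 + c)" by (simp only: power_add)
    finally show ?thesis by simp
  qed
  then show ?thesis by blast
qed

section \<open>The programs for the maximum and for the decision problem\<close>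

lemma msf_program:
  "\<exists>p c. \<forall>G1 G2 k. input_graph G1 \<and> input_graph G2 \<and> has_vertex_cover G1 k \<and> has_vertex_cover G2 k \<longrightarrow>
     (\<exists>t. outputs_in_time p (encode_graph G1 @ encode_graph G2) (max_common_star_forest G1 G2) t \<and>
       t \<le> 2 ^ 2 ^ (2 * k + 5 + c) * (card (verts G1) + card (verts G2) + 2) ^ c)"
proof -
  obtain C T where C: "computes C 0 (\<lambda>A e. arr_msf A (A 0) (A (1 + A 0 * A 0))) T" "polybd (\<lambda>A e. input_search_size A) 0 T"
    using ptime_input_msf unfolding ptime_def by blast
  have T2: "polybd (\<lambda>A e. input_search_size A) 0 (\<lambda>A e. T A e + 2)"
    by (intro polybd_add polybd_const C)
  define e :: "nat \<Rightarrow> nat" where "e = (\<lambda>_. 0)"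
  obtain c where c: "\<And>G1 G2 k ys. input_graph G1 \<Longrightarrow> input_graph G2 \<Longrightarrow> has_vertex_cover G1 k \<Longrightarrow>
      has_vertex_cover G2 k \<Longrightarrow> T (input_array (encode_graph G1 @ encode_graph G2 @ ys)) e + 2
      \<le> 2 ^ 2 ^ (2 * k + 5 + c) * (card (verts G1) + card (verts G2) + 2) ^ c"
    using polybd_input_search_size_bound[OF T2, where e = e] by blast
  show ?thesis
  proof (rule exI, rule exI, intro allI impI)
    fix G1 G2 :: "nat graph" and k
    assume G: "input_graph G1 \<and> input_graph G2 \<and> has_vertex_cover G1 k \<and> has_vertex_cover G2 k"
    then have G': "input_graph G1" "input_graph G2" by auto
    let ?xs = "encode_graph G1 @ encode_graph G2"
    have eq: "arr_msf (input_array ?xs) (input_array ?xs 0) (input_array ?xs (1 + input_array ?xs 0 * input_array ?xs 0))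
        = max_common_star_forest G1 G2"
      using arr_msf_encode[OF G', of "[]"] max_common_star_forest_eq[OF G'] by simp
    have "\<exists>t. outputs_in_time (Seq (C id 0) (Assign ''out'' (Var (loc 0)))) ?xs (max_common_star_forest G1 G2) t \<and>
        t \<le> T (input_array ?xs) e + 2"
      using computes_outputs[OF C(1), of ?xs e] eq by simp
    then show "\<exists>t. outputs_in_time (Seq (C id 0) (Assign ''out'' (Var (loc 0)))) ?xs (max_common_star_forest G1 G2) t \<and>
        t \<le> 2 ^ 2 ^ (2 * k + 5 + c) * (card (verts G1) + card (verts G2) + 2) ^ c"
      using c[of G1 G2 k "[]"] G by (auto intro: le_trans)
  qed
qed

text \<open>The threshold may be huge compared with the size, so reading it is not an instance of
  \<open>ptime_input\<close>. It takes part in a single comparison of constant cost, which is added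
  at the level of \<open>computes\<close>.\<close>

lemma mcsf_program:
  "\<exists>p c. \<forall>G1 G2 h k. input_graph G1 \<and> input_graph G2 \<and> has_vertex_cover G1 k \<and> has_vertex_cover G2 k \<longrightarrow>
     (\<exists>t. outputs_in_time p (mcsf_encode (G1, G2, h)) (if mcsf_yes (G1, G2, h) then 1 else 0) t \<and>
       t \<le> 2 ^ 2 ^ (2 * k + 5 + c) * (card (verts G1) + card (verts G2) + 2) ^ c)"
proof -
  let ?idx = "\<lambda>A. 2 + A 0 * A 0 + A (1 + A 0 * A 0) * A (1 + A 0 * A (0::nat)) :: nat"
  let ?R = "\<lambda>A. arr_msf A (A 0) (A (1 + A 0 * A 0))"
  obtain C T where C: "computes C 0 (\<lambda>A e. ?R A) T" "polybd (\<lambda>A e. input_search_size A) 0 T"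
    using ptime_input_msf unfolding ptime_def by blast
  have A0: "ptime (\<lambda>A e. input_search_size A) 0 (\<lambda>A e. A 0)"
    by (rule ptime_input[OF ptime_const]) (simp add: input_search_size_def)
  have A1: "ptime (\<lambda>A e. input_search_size A) 0 (\<lambda>A e. A (1 + A 0 * A 0))"
    by (rule ptime_input) ((intro ptime_intros A0), simp add: input_search_size_def)
  have "ptime (\<lambda>A e. input_search_size A) 0 (\<lambda>A e. ?idx A)"
    by (intro ptime_plus ptime_mult ptime_const A0 A1)
  then obtain D S where D: "computes D 0 (\<lambda>A e. ?idx A) S" "polybd (\<lambda>A e. input_search_size A) 0 S"
    unfolding ptime_def by blast
  note P = computes_if[OF C(1) computes_input[OF D(1)] computes_const[of 0] computes_const[of 1]]
  define e :: "nat \<Rightarrow> nat" where "e = (\<lambda>_. 0)"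
  have T2: "polybd (\<lambda>A e. input_search_size A) 0 (\<lambda>A e. T A e + (S A e + 3) + 4 + 2 + 2)"
    by (intro polybd_add polybd_const C D)
  obtain c where c: "\<And>G1 G2 k ys. input_graph G1 \<Longrightarrow> input_graph G2 \<Longrightarrow> has_vertex_cover G1 k \<Longrightarrow>
      has_vertex_cover G2 k \<Longrightarrow>
      T (input_array (encode_graph G1 @ encode_graph G2 @ ys)) e + (S (input_array (encode_graph G1 @ encode_graph G2 @ ys)) e + 3) + 4 + 2 + 2
      \<le> 2 ^ 2 ^ (2 * k + 5 + c) * (card (verts G1) + card (verts G2) + 2) ^ c"
    using polybd_input_search_size_bound[OF T2, where e = e] by blast
  define p where "p = Seq (Seq (C id 0) (Seq (Seq (D id (Suc 0)) (Assign (loc (Suc 0)) (Elem ''in'' (Var (loc (Suc 0))))))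
      (Cond (BLess (Var (loc 0)) (Var (loc (Suc 0)))) (Assign (loc 0) (Const 0)) (Assign (loc 0) (Const 1)))))
      (Assign ''out'' (Var (loc 0)))"
  show ?thesis
  proof (rule exI, rule exI, intro allI impI)
    fix G1 G2 :: "nat graph" and h k
    assume G: "input_graph G1 \<and> input_graph G2 \<and> has_vertex_cover G1 k \<and> has_vertex_cover G2 k"
    then have G': "input_graph G1" "input_graph G2" by auto
    let ?xs = "encode_graph G1 @ encode_graph G2 @ [h]"
    let ?A = "input_array ?xs"
    have xs: "mcsf_encode (G1, G2, h) = ?xs" by (simp add: mcsf_encode_def)
    have R: "?R ?A = graph_msf G1 G2" by (rule arr_msf_encode[OF G'])
    have h: "?A (?idx ?A) = h" using input_array_encode[OF G', of "[h]"] by simp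
    have out: "(if ?R ?A < ?A (?idx ?A) then 0 else 1) = (if mcsf_yes (G1, G2, h) then 1 else 0 :: nat)"
      unfolding R h mcsf_yes_iff[OF G'] by simp
    have "\<exists>t. outputs_in_time p ?xs (if ?R ?A < ?A (?idx ?A) then 0 else 1) t \<and>
       t \<le> T ?A e + (S ?A e + 3) + 4 + (if ?R ?A < ?A (?idx ?A) then 2 else 2) + 2"
      using computes_outputs[OF P, of ?xs e] by (simp add: p_def)
    then show "\<exists>t. outputs_in_time p (mcsf_encode (G1, G2, h)) (if mcsf_yes (G1, G2, h) then 1 else 0) t \<and>
       t \<le> 2 ^ 2 ^ (2 * k + 5 + c) * (card (verts G1) + card (verts G2) + 2) ^ c"
      unfolding out xs using c[of G1 G2 k "[h]"] G by (auto intro: le_trans)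
  qed
qed

lemma computable_double_exp: "computable (\<lambda>k. 2 ^ 2 ^ (2 * k + c))"
proof -
  \<comment> \<open>Computability does not limit the time, so the size may simply contain all
    intermediate values.\<close>
  let ?H = "\<lambda>A e. A 0 + 2 ^ (2 * A 0 + c) + 2 ^ 2 ^ (2 * A 0 + c) :: nat"
  have "ptime ?H 0 (\<lambda>A e. 2 ^ 2 ^ (2 * A 0 + c))"
    by (intro ptime_power ptime_plus ptime_mult ptime_const ptime_input) simp_all
  then obtain C T where C: "computes C 0 (\<lambda>A e. 2 ^ 2 ^ (2 * A 0 + c)) T"
    unfolding ptime_def by blast
  have "\<exists>t. outputs_in_time (Seq (C id 0) (Assign ''out'' (Var (loc 0)))) [k] (2 ^ 2 ^ (2 * k + c)) t" for k
    using computes_outputs[OF C, of "[k]"] by (auto simp: input_array_def)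
  then show ?thesis unfolding computable_def by blast
qed

text \<open>The least value exists because the set of all vertices is a vertex cover.\<close>

lemma has_vertex_cover_mcsf_parameter:
  assumes "simple_graph G1" "simple_graph G2"
  shows "has_vertex_cover G1 (mcsf_parameter (G1, G2, h)) \<and> has_vertex_cover G2 (mcsf_parameter (G1, G2, h))"
proof -
  have "vertex_cover G (verts G)" if "simple_graph G" for G :: "nat graph"
  proof -
    have "e \<inter> verts G \<noteq> {}" if "e \<in> edges G" for e
    proof -
      have "e \<subseteq> verts G" "card e = 2" using that \<open>simple_graph G\<close> by (auto simp: simple_graph_def)
      then show ?thesis by (metis Int_absorb2 card.empty zero_neq_numeral)
    qed
    then show ?thesis by (auto simp: vertex_cover_def delete_verts_def)
  qed
  then have "has_vertex_cover G1 (max (card (verts G1)) (card (verts G2)))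
      \<and> has_vertex_cover G2 (max (card (verts G1)) (card (verts G2)))"
    unfolding has_vertex_cover_def using assms by (meson max.cobounded1 max.cobounded2)
  then show ?thesis unfolding mcsf_parameter_def prod.case by (rule LeastI)
qed

lemma input_size_ge_length: "length xs \<le> input_size xs"
  unfolding input_size_def by (induction xs) auto

lemma input_size_mcsf_encode:
  "card (verts G1) + card (verts G2) + 2 \<le> input_size (mcsf_encode (G1, G2, h))"
proof -
  have "length (mcsf_encode (G1, G2, h))
      = card (verts G1) * card (verts G1) + card (verts G2) * card (verts G2) + 3"
    by (simp add: mcsf_encode_def length_encode_graph)
  then have "card (verts G1) + card (verts G2) + 2 \<le> length (mcsf_encode (G1, G2, h))"
    using le_square[of "card (verts G1)"] le_square[of "card (verts G2)"] by linarith
  then show ?thesis using input_size_ge_length le_trans by blast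
qed

lemma fixed_parameter_tractable_mcsf:
  "fixed_parameter_tractable mcsf_instances mcsf_encode mcsf_yes mcsf_parameter"
proof -
  obtain p c where p: "\<And>G1 G2 h k. input_graph G1 \<Longrightarrow> input_graph G2 \<Longrightarrow> has_vertex_cover G1 k \<Longrightarrow>
     has_vertex_cover G2 k \<Longrightarrow>
     \<exists>t. outputs_in_time p (mcsf_encode (G1, G2, h)) (if mcsf_yes (G1, G2, h) then 1 else 0) t \<and>
       t \<le> 2 ^ 2 ^ (2 * k + 5 + c) * (card (verts G1) + card (verts G2) + 2) ^ c"
    using mcsf_program by blast
  have "\<exists>t. outputs_in_time p (mcsf_encode x) (if mcsf_yes x then 1 else 0) t \<and>
      t \<le> 2 ^ 2 ^ (2 * mcsf_parameter x + (5 + c)) * input_size (mcsf_encode x) ^ c"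
    if "x \<in> mcsf_instances" for x
  proof -
    obtain G1 G2 h where x: "x = (G1, G2, h)" by (cases x)
    have G: "input_graph G1" "input_graph G2" using that by (auto simp: mcsf_instances_def x)
    then have cover: "has_vertex_cover G1 (mcsf_parameter x)" "has_vertex_cover G2 (mcsf_parameter x)"
      using has_vertex_cover_mcsf_parameter by (auto simp: x input_graph_def)
    have "(card (verts G1) + card (verts G2) + 2) ^ c \<le> input_size (mcsf_encode x) ^ c"
      unfolding x by (rule power_mono[OF input_size_mcsf_encode]) simp
    then have "2 ^ 2 ^ (2 * mcsf_parameter x + 5 + c) * (card (verts G1) + card (verts G2) + 2) ^ c
       \<le> 2 ^ 2 ^ (2 * mcsf_parameter x + (5 + c)) * input_size (mcsf_encode x) ^ c"
      by (simp add: add.assoc)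
    then show ?thesis using p[OF G cover, of h] unfolding x[symmetric] by (meson le_trans)
  qed
  then show ?thesis
    unfolding fixed_parameter_tractable_def using computable_double_exp[of "5 + c"] by blast
qed

theorem theorem17:
  "(\<exists>(p :: com) (g :: nat \<Rightarrow> nat) (q :: nat \<Rightarrow> nat) (c :: nat).
      (\<lambda>k. real (g k)) \<in> O(\<lambda>k. real k) \<and>
      (\<lambda>n. real (q n)) \<in> O(\<lambda>n. real n ^ c) \<and>
      (\<forall>(k :: nat) (G1 :: nat graph) (G2 :: nat graph).
         input_graph G1 \<and> input_graph G2 \<and> has_vertex_cover G1 k \<and> has_vertex_cover G2 k \<longrightarrow>
         (\<exists>t. outputs_in_time p (encode_graph G1 @ encode_graph G2)
                (max_common_star_forest G1 G2) t \<and>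
              t \<le> 2 ^ (2 ^ g k) * q (card (verts G1) + card (verts G2))))) \<and>
   fixed_parameter_tractable mcsf_instances mcsf_encode mcsf_yes mcsf_parameter"
proof
  obtain p c where p: "\<forall>G1 G2 k. input_graph G1 \<and> input_graph G2 \<and> has_vertex_cover G1 k \<and> has_vertex_cover G2 k \<longrightarrow>
     (\<exists>t. outputs_in_time p (encode_graph G1 @ encode_graph G2) (max_common_star_forest G1 G2) t \<and>
       t \<le> 2 ^ 2 ^ (2 * k + 5 + c) * (card (verts G1) + card (verts G2) + 2) ^ c)"
    using msf_program by blast
  have "(\<lambda>k. real (2 * k + 5 + c)) \<in> O(\<lambda>k. real k)"
  proof (rule bigoI[where c = "real (7 + c)"], rule eventually_mono[OF eventually_ge_at_top[of 1]])
    fix k :: nat assume "1 \<le> k"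
    then have "2 * k + 5 + c \<le> 2 * k + (5 + c) * k" by simp
    also have "\<dots> = (7 + c) * k" by (simp add: algebra_simps)
    finally have "real (2 * k + 5 + c) \<le> real ((7 + c) * k)" by (rule of_nat_mono)
    then show "norm (real (2 * k + 5 + c)) \<le> real (7 + c) * norm (real k)" by simp
  qed
  \<comment> \<open>The constant \<open>3 ^ c\<close> comes from \<open>n + 2 \<le> 3 * n\<close>
    for \<open>n \<ge> 1\<close>.\<close>
  moreover have "(\<lambda>n. real ((n + 2) ^ c)) \<in> O(\<lambda>n. real n ^ c)"
  proof (rule bigoI[where c = "3 ^ c"], rule eventually_mono[OF eventually_ge_at_top[of 1]])
    fix n :: nat assume "1 \<le> n"
    then have "(n + 2) ^ c \<le> (3 * n) ^ c" by (intro power_mono) auto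
    then have "real ((n + 2) ^ c) \<le> real ((3 * n) ^ c)" by (rule of_nat_mono)
    then show "norm (real ((n + 2) ^ c)) \<le> 3 ^ c * norm (real n ^ c)"
      by (simp add: power_mult_distrib)
  qed
  ultimately show "\<exists>(p :: com) (g :: nat \<Rightarrow> nat) (q :: nat \<Rightarrow> nat) (c :: nat).
      (\<lambda>k. real (g k)) \<in> O(\<lambda>k. real k) \<and>
      (\<lambda>n. real (q n)) \<in> O(\<lambda>n. real n ^ c) \<and>
      (\<forall>(k :: nat) (G1 :: nat graph) (G2 :: nat graph).
         input_graph G1 \<and> input_graph G2 \<and> has_vertex_cover G1 k \<and> has_vertex_cover G2 k \<longrightarrow>
         (\<exists>t. outputs_in_time p (encode_graph G1 @ encode_graph G2)
                (max_common_star_forest G1 G2) t \<and>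
              t \<le> 2 ^ (2 ^ g k) * q (card (verts G1) + card (verts G2))))"
    using p by (intro exI[of _ p] exI[of _ "\<lambda>k. 2 * k + 5 + c"] exI[of _ "\<lambda>n. (n + 2) ^ c"] exI[of _ c]) blast
qed (rule fixed_parameter_tractable_mcsf)

end
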